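(* The $\mathbb{Q}$-algebra $\mathcal{C}$ of cell-zeta values is equal, as a subset of $\mathbb{R}$, to the $\mathbb{Q}$-algebra $\mathcal{Z}$ of multizeta values; in particular they are isomorphic $\mathbb{Q}$-algebras.
   Context: For $n\ge5$ and $\ell=n-3$, $\mathfrak{M}_{0,n}=\{(t_1,\ldots,t_\ell): t_i\neq 0,1,\infty,\ t_i\ne t_j\text{ for }i\neq j\}$ is the moduli space of genus $0$ curves with $n$ ordered marked points $(0,t_1,\ldots,t_\ell,1,\infty)$, and $\overline{\mathfrak{M}}_{0,n}$ is its Deligne–Mumford compactification, whose boundary divisors correspond to partitions of the marked points into two subsets of cardinality $\ge2$. The standard cell is $X_{n,\delta}=\{0<t_1<\cdots<t_\ell<1\}$; the divisors bounding it are those whose partition consists of two subsets, each formed of consecutive elements for the cyclic order $(0,t_1,\ldots,t_\ell,1,\infty)$. An $\ell$-form converges on $X_{n,\delta}$ if it has no pole along these divisors. $\mathcal{C}$ is the $\mathbb{Q}$-subspace of $\mathbb{R}$ spanned by all integrals $\int_{X_{n,\delta}}\omega$, $n\ge 5$, where $\omega$ is a holomorphic $\ell$-form on $\mathfrak{M}_{0,n}$ with logarithmic singularities along the boundary, defined over $\mathbb{Q}$ (equivalently a $\mathbb{Q}$-linear combination of forms $\frac{dt_1\cdots dt_\ell}{(y_2-y_1)(y_3-y_2)\cdots(y_{n-1}-y_{n-2})}$ with $y_1,\ldots,y_{n-1}$ an ordering of $\{0,1,t_1,\ldots,t_\ell\}$), which converges on $X_{n,\delta}$. These integrals are called cell-zeta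 values; $\mathcal{C}$ is closed under multiplication. $\mathcal{Z}$ is the $\mathbb{Q}$-subspace of $\mathbb{R}$ spanned by the multizeta values $\zeta(n_1,\ldots,n_r)=\sum_{0<k_1<\cdots<k_r}\frac{1}{k_1^{n_1}\cdots k_r^{n_r}}$, $r\ge1$, $n_i\ge1$, $n_r\ge2$; it is closed under multiplication. (Neither $\mathcal{C}$ nor $\mathcal{Z}$ is required to contain $1$.) *)

theory Defs
  imports "HOL-Analysis.Analysis" "HOL-Library.Landau_Symbols"
begin

section \<open>Rational subspaces and (non-unital) rational subalgebras of the reals\<close>

interpretation rat_real: vector_space "\<lambda>(q::rat) (x::real). of_rat q * x"
  by unfold_locales (auto simp: algebra_simps of_rat_add of_rat_mult)

definition rat_subalgebra :: "real set \<Rightarrow> bool" where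
  "rat_subalgebra A \<longleftrightarrow> rat_real.subspace A \<and> (\<forall>x\<in>A. \<forall>y\<in>A. x * y \<in> A)"

definition rat_algebra_iso :: "(real \<Rightarrow> real) \<Rightarrow> real set \<Rightarrow> real set \<Rightarrow> bool" where
  "rat_algebra_iso \<phi> A B \<longleftrightarrow> bij_betw \<phi> A B \<and>
     (\<forall>x\<in>A. \<forall>y\<in>A. \<phi> (x + y) = \<phi> x + \<phi> y \<and> \<phi> (x * y) = \<phi> x * \<phi> y) \<and>
     (\<forall>q::rat. \<forall>x\<in>A. \<phi> (of_rat q * x) = of_rat q * \<phi> x)"


section \<open>Multizeta values\<close>

definition mzv :: "nat list \<Rightarrow> real" where
  "mzv ns = (\<Sum>\<^sub>\<infinity>ks\<in>{ks. length ks = length ns \<and> sorted_wrt (<) ks \<and> (\<forall>k\<in>set ks. 0 < k)}.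
               1 / (\<Prod>i<length ns. real (ks ! i) ^ (ns ! i)))"

definition mzv_algebra :: "real set" where
  "mzv_algebra = rat_real.span {mzv ns | ns. ns \<noteq> [] \<and> (\<forall>m\<in>set ns. 1 \<le> m) \<and> 2 \<le> last ns}"


section \<open>Regular forms on the moduli space of n-pointed genus 0 curves\<close>

text \<open>
  The n marked points \<open>(0, t\<^sub>1, \<dots>, t\<^sub>l, 1, \<infinity>)\<close>, with \<open>l = n - 3\<close>, carry the labels
  \<open>0, 1, \<dots>, n - 3, n - 2, n - 1\<close>, so that the cyclic order is that of the labels modulo n.
  The function \<open>marked\<close> gives the position of the points with label at most \<open>n - 2\<close>;
  label \<open>n - 1\<close> is the point at infinity. Only the coordinates \<open>t 1, \<dots>, t (n - 3)\<close>
  of a function \<open>t\<close> are relevant.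
\<close>

definition marked :: "nat \<Rightarrow> (nat \<Rightarrow> 'a::zero_neq_one) \<Rightarrow> nat \<Rightarrow> 'a" where
  "marked n t i = (if i = 0 then 0 else if i = n - 2 then 1 else t i)"

text \<open>
  The ring of regular functions on the moduli space defined over the rationals, that is,
  \<open>\<rat>[t\<^sub>i, 1/t\<^sub>i, 1/(1 - t\<^sub>i), 1/(t\<^sub>j - t\<^sub>i)]\<close>. The function \<open>f\<close> stands for the form
  \<open>f dt\<^sub>1 \<dots> dt\<^sub>l\<close>.
\<close>

inductive_set regular_functions :: "nat \<Rightarrow> ((nat \<Rightarrow> complex) \<Rightarrow> complex) set" for n :: nat where
  const: "(\<lambda>t. of_rat q) \<in> regular_functions n"
| coord: "1 \<le> i \<Longrightarrow> i \<le> n - 3 \<Longrightarrow> (\<lambda>t. t i) \<in> regular_functions n"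
| inv_diff: "i < j \<Longrightarrow> j \<le> n - 2 \<Longrightarrow>
    (\<lambda>t. 1 / (marked n t j - marked n t i)) \<in> regular_functions n"
| add: "f \<in> regular_functions n \<Longrightarrow> g \<in> regular_functions n \<Longrightarrow>
    (\<lambda>t. f t + g t) \<in> regular_functions n"
| mult: "f \<in> regular_functions n \<Longrightarrow> g \<in> regular_functions n \<Longrightarrow>
    (\<lambda>t. f t * g t) \<in> regular_functions n"


section \<open>Boundary divisors and pole orders\<close>

text \<open>
  A boundary divisor is a partition of the n labels into two parts with at least two elements
  each. It is represented by the part \<open>S\<close> which does not contain the label \<open>n - 1\<close> of infinity.
\<close>

definition boundary_divisors :: "nat \<Rightarrow> nat set set" where
  "boundary_divisors n = {S. S \<subseteq> {..<n} \<and> n - 1 \<notin> S \<and> 2 \<le> card S \<and> 2 \<le> card ({..<n} - S)}"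

definition cyclically_consecutive :: "nat \<Rightarrow> nat set \<Rightarrow> bool" where
  "cyclically_consecutive n A \<longleftrightarrow> (\<exists>a k. A = (\<lambda>i. (a + i) mod n) ` {..<k})"

definition cell_divisors :: "nat \<Rightarrow> nat set set" where
  "cell_divisors n = {S \<in> boundary_divisors n.
     cyclically_consecutive n S \<and> cyclically_consecutive n ({..<n} - S)}"

text \<open>
  A point of the open stratum of the divisor \<open>S\<close> is a stable curve with two components. One of
  them carries the points \<open>x\<^sub>k\<close>, \<open>k \<in> S\<close>, and its node at infinity. The other one carries
  infinity, the points \<open>x\<^sub>k\<close>, \<open>k \<notin> S\<close>, and its node at \<open>0\<close>.
\<close>

definition open_stratum :: "nat \<Rightarrow> nat set \<Rightarrow> (nat \<Rightarrow> complex) set" where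
  "open_stratum n S = {x. inj_on x S \<and> inj_on x ({..n - 2} - S) \<and> (\<forall>k\<in>{..n - 2} - S. x k \<noteq> 0)}"

text \<open>
  The smoothing of that stable curve with parameter \<open>\<epsilon>\<close>: the marked points are \<open>\<epsilon> x\<^sub>k\<close> for
  \<open>k \<in> S\<close>, \<open>x\<^sub>k\<close> for \<open>k \<notin> S\<close>, and infinity. The affine map sending the points with labels \<open>0\<close> and
  \<open>n - 2\<close> to \<open>0\<close> and \<open>1\<close> gives its coordinates \<open>t\<^sub>i\<close>. This is a curve which crosses the divisor
  transversally, at the given point of the open stratum, for \<open>\<epsilon> = 0\<close>.
\<close>

definition smoothing :: "nat \<Rightarrow> nat set \<Rightarrow> (nat \<Rightarrow> complex) \<Rightarrow> complex \<Rightarrow> nat \<Rightarrow> complex" where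
  "smoothing n S x \<epsilon> i =
     (let w = (\<lambda>k. if k \<in> S then \<epsilon> * x k else x k) in (w i - w 0) / (w (n - 2) - w 0))"

text \<open>
  The order of vanishing of \<open>dt\<^sub>1 \<dots> dt\<^sub>l\<close> along the divisor \<open>S\<close>. If \<open>S\<close> does not contain both
  \<open>0\<close> and \<open>n - 2\<close>, local coordinates are given by \<open>t\<^sub>i = c + \<epsilon> u\<^sub>i\<close> for \<open>i \<in> S\<close>, where two of
  the parameters \<open>c\<close>, \<open>u\<^sub>i\<close> are normalised, and \<open>t\<^sub>j\<close> for \<open>j \<notin> S\<close>; then
  \<open>dt\<^sub>1 \<dots> dt\<^sub>l = \<plusminus> \<epsilon>\<^bsup>|S| - 2\<^esup> d\<epsilon> \<dots>\<close>. Otherwise, the \<open>n - 1 - |S|\<close> points \<open>t\<^sub>j\<close> with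
  \<open>j \<notin> S\<close> go to infinity: local coordinates are \<open>t\<^sub>i\<close> for \<open>i \<in> S\<close> and \<open>t\<^sub>j = v\<^sub>j / \<epsilon>\<close> for
  \<open>j \<notin> S\<close>, where one \<open>v\<^sub>j\<close> is \<open>1\<close>; then \<open>dt\<^sub>1 \<dots> dt\<^sub>l = \<plusminus> \<epsilon>\<^bsup>|S| - n\<^esup> d\<epsilon> \<dots>\<close>.
\<close>

definition volume_order :: "nat \<Rightarrow> nat set \<Rightarrow> int" where
  "volume_order n S =
     (if 0 \<in> S \<and> n - 2 \<in> S then int (card S) - int n else int (card S) - 2)"

text \<open>
  The form \<open>f dt\<^sub>1 \<dots> dt\<^sub>l\<close> has at most a pole of order \<open>k\<close> along the divisor \<open>S\<close>. In the local
  coordinates above the only denominators of a regular function \<open>f\<close>, near the open stratum, are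
  powers of \<open>\<epsilon>\<close>; so the order of \<open>f\<close> along \<open>S\<close> is at least \<open>m\<close> if and only if \<open>f\<close> is
  \<open>O(\<epsilon>\<^sup>m)\<close> along the smoothings of all the points of the open stratum.
\<close>

definition pole_order_le :: "nat \<Rightarrow> ((nat \<Rightarrow> complex) \<Rightarrow> complex) \<Rightarrow> nat set \<Rightarrow> int \<Rightarrow> bool" where
  "pole_order_le n f S k \<longleftrightarrow> (\<forall>x\<in>open_stratum n S.
     (\<lambda>\<epsilon>. f (smoothing n S x \<epsilon>)) \<in> O[at 0](\<lambda>\<epsilon>. \<epsilon> powi (- k - volume_order n S)))"

text \<open>
  A form of top degree is closed, so it has logarithmic singularities along the boundary, which
  is a normal crossings divisor, if and only if it has at most simple poles there.
\<close>

definition log_forms :: "nat \<Rightarrow> ((nat \<Rightarrow> complex) \<Rightarrow> complex) set" where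
  "log_forms n = {f \<in> regular_functions n. \<forall>S\<in>boundary_divisors n. pole_order_le n f S 1}"

definition converges_on_cell :: "nat \<Rightarrow> ((nat \<Rightarrow> complex) \<Rightarrow> complex) \<Rightarrow> bool" where
  "converges_on_cell n f \<longleftrightarrow> (\<forall>S\<in>cell_divisors n. pole_order_le n f S 0)"


section \<open>Cell-zeta values\<close>

text \<open>The condition says that \<open>0 < t 1 < \<dots> < t (n - 3) < 1\<close>.\<close>

definition standard_cell :: "nat \<Rightarrow> (nat \<Rightarrow> real) set" where
  "standard_cell n = {t \<in> {1..n - 3} \<rightarrow>\<^sub>E UNIV. strict_mono_on {..n - 2} (marked n t)}"

definition cell_integral :: "nat \<Rightarrow> ((nat \<Rightarrow> complex) \<Rightarrow> complex) \<Rightarrow> complex" where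
  "cell_integral n f =
     set_lebesgue_integral (Pi\<^sub>M {1..n - 3} (\<lambda>_. lborel)) (standard_cell n)
       (\<lambda>t. f (\<lambda>i. complex_of_real (t i)))"

definition cell_zeta_algebra :: "real set" where
  "cell_zeta_algebra = rat_real.span
     {x. \<exists>n\<ge>5. \<exists>f\<in>log_forms n. converges_on_cell n f \<and> complex_of_real x = cell_integral n f}"

end

theory Submission
  imports Defs "HOL-Computational_Algebra.Polynomial" "HOL-Real_Asymp.Real_Asymp"
begin

text \<open>
  A logarithmic form is expanded in partial fractions in the first coordinate: its poles are simple
  and there is no polynomial part, and the residues are again logarithmic. Inductively it is a
  rational combination of products of factors 1/(t i - b i) with b i among 0, the later coordinates
  and 1. Such a product is integrated one coordinate after the other. Each partial integral is a
  combination of hyperlogarithms evaluated at the next coordinate; at the upper end of the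
  integration it has an expansion in powers of a logarithm whose coefficients are hyperlogarithms
  in the remaining letters, with coefficients rational up to multizeta values. If the whole integral
  exists, the divergences cancel and only the constant terms of the expansions count. Differentiating
  with respect to the colliding letter reduces the expansions to words in the letters 0 and 1, where
  they follow from shuffle regularisation.

  Conversely, a multizeta value is the iterated integral of a word in the letters 0 and 1 that
  starts with 0 and ends with 1. The corresponding form is logarithmic and has no pole along the
  divisors that bound the standard cell.
\<close>


section \<open>Coefficients of hyperlogarithms\<close>

text \<open>The products of simple poles into which a form is expanded need not be integrable one by
  one, so the integral cannot be split along the expansion. Linearity is recovered on the level of
  primitives: each product has a primitive with an expansion in powers of \<open>ln (1 - u)\<close>
  at the upper end, and constant terms of expansions do add up. Putting \<open>x m = t\<close> and
  evaluating at the point ut separates the two scales. Working with the coefficients of powers of t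
  makes all estimates uniform up to a factor \<open>q ^ J\<close>, so that expansions can be
  multiplied by kernels, divided by J and summed. A second obstacle is that the multizeta algebra Z
  need not contain 1. Two sets of constants are therefore carried along: nonempty words may have
  coefficients in Q + Z, while the coefficient of the empty word must lie in Z. A rational form
  violates this at the start; the first integration repairs it, because the regularised value at 1
  of a nonempty word in the letters 0 and 1 lies in Z.\<close>

text \<open>Multiplication of a power series in t by t/(t - y), on coefficients.\<close>
fun conv :: "real \<Rightarrow> (nat \<Rightarrow> real) \<Rightarrow> nat \<Rightarrow> real" where
  "conv y f 0 = 0"
| "conv y f (Suc n) = (conv y f n - f n) / y"

text \<open>The same for series in u and t and multiplication by ut/(ut - y).\<close>
fun dconv :: "real \<Rightarrow> (nat \<Rightarrow> nat \<Rightarrow> real) \<Rightarrow> nat \<Rightarrow> nat \<Rightarrow> real" where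
  "dconv y g 0 J = 0"
| "dconv y g (Suc N) 0 = 0"
| "dconv y g (Suc N) (Suc J) = (dconv y g N J - g N J) / y"

text \<open>Taylor coefficients of a hyperlogarithm. A word lists the letters from the outermost
  integration inwards; the label 0 stands for the letter 0, any other label a for the letter x a.
  Since 1/0 = 0, a word whose innermost label is 0 yields the zero series.\<close>
fun hcoef :: "(nat \<Rightarrow> real) \<Rightarrow> nat list \<Rightarrow> nat \<Rightarrow> real" where
  "hcoef x [] N = (if N = 0 then 1 else 0)"
| "hcoef x (a # w) N = (if a = 0 then hcoef x w N else conv (x a) (hcoef x w) N) / real N"

text \<open>Multiplication by u/(u - 1). This is the kernel of the letter m, since ut/(ut - t) =
  u/(u - 1).\<close>

definition uconv :: "(nat \<Rightarrow> nat \<Rightarrow> real) \<Rightarrow> nat \<Rightarrow> nat \<Rightarrow> real" where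
  "uconv g N J = conv 1 (\<lambda>N. g N J) N"

text \<open>Multiplication by t/(t - y), a factor that arises only when a product of two kernels is
  split into partial fractions.\<close>

definition tconv :: "real \<Rightarrow> (nat \<Rightarrow> nat \<Rightarrow> real) \<Rightarrow> nat \<Rightarrow> nat \<Rightarrow> real" where
  "tconv y g N J = conv y (g N) J"

text \<open>The division by \<open>real N\<close> integrates with respect to du/u at fixed t. For N
  = 0 it yields 0, which is the right constant of integration.\<close>

definition prefix :: "nat \<Rightarrow> (nat \<Rightarrow> real) \<Rightarrow> nat \<Rightarrow> (nat \<Rightarrow> nat \<Rightarrow> real) \<Rightarrow> nat \<Rightarrow> nat \<Rightarrow> real" where
  "prefix m x a g N J = (if a = 0 then g N J else if a = m then uconv g N J else dconv (x a) g N J) / real N"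

text \<open>Coefficients of the hyperlogarithm of a word at the point ut when the letter m equals t:
  the powers of u and t are separated, so that u = 1 is the collision with m.\<close>
fun gam :: "nat \<Rightarrow> (nat \<Rightarrow> real) \<Rightarrow> nat list \<Rightarrow> nat \<Rightarrow> nat \<Rightarrow> real" where
  "gam m x [] = (\<lambda>N J. if N = 0 \<and> J = 0 then 1 else 0)"
| "gam m x (a # w) = prefix m x a (gam m x w)"

section \<open>Commutation rules for the multiplication operators\<close>

lemma uconv_simps [simp]: "uconv g 0 J = 0" "uconv g (Suc N) J = uconv g N J - g N J"
  by (simp_all add: uconv_def)
lemma tconv_simps [simp]: "tconv y g N 0 = 0" "tconv y g N (Suc J) = (tconv y g N J - g N J) / y"
  by (simp_all add: tconv_def)
lemma dconv_0 [simp]: "dconv y g N 0 = 0" by (cases N) auto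

lemma uconv_dconv_Suc: "uconv (dconv y g) (Suc N) (Suc J) = (uconv (dconv y g) N J - uconv g N J) / y"
  by (induction N) (auto simp: algebra_simps add_divide_distrib diff_divide_distrib)

lemma uconv_dconv_0: "uconv (dconv y g) N 0 = 0" by (induction N) auto

text \<open>The partial fraction identity U D = T U + D - T D for U = u/(u - 1), D = ut/(ut - y) and
  T = t/(t - y). It replaces a product of two kernels in u by single kernels with coefficients
  depending on t alone.\<close>

lemma uconv_dconv:
  "uconv (dconv y g) N J = tconv y (uconv g) N J + dconv y g N J - tconv y (dconv y g) N J"
proof (induction J arbitrary: N)
  case 0 then show ?case by (simp add: uconv_dconv_0)
next
  case (Suc J)
  show ?case
  proof (cases N)
    case 0
    have "tconv y (uconv g) 0 j = 0" "tconv y (dconv y g) 0 j = 0" for j by (induction j) auto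
    then show ?thesis using 0 by (simp del: tconv_simps)
  next
    case (Suc M)
    show ?thesis unfolding Suc uconv_dconv_Suc using Suc.IH[of "Suc M"]
      by (simp add: algebra_simps add_divide_distrib diff_divide_distrib)
        (simp add: add_divide_distrib[symmetric] diff_divide_distrib[symmetric] algebra_simps)?
  qed
qed

lemma conv_diff: "conv y (\<lambda>n. f n + g n) n = conv y f n + conv y g n"
  by (induction n) (auto simp: algebra_simps add_divide_distrib diff_divide_distrib)
lemma conv_scale: "conv y (\<lambda>n. c * f n) n = c * conv y f n"
  by (induction n) (auto simp: algebra_simps add_divide_distrib diff_divide_distrib)

text \<open>A factor depending on t alone passes through an integration in u.\<close>

lemma tconv_prefix: "prefix m x a (tconv y g) N J = tconv y (prefix m x a g) N J"
proof -
  have u: "uconv (tconv y g) N J = tconv y (uconv g) N J" for N J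
  proof (induction N arbitrary: J)
    case 0 have "tconv y (uconv g) 0 j = 0" for j by (induction j) auto then show ?case by (simp del: tconv_simps)
  next
    case (Suc N)
    have "tconv y (uconv g) (Suc N) J = tconv y (uconv g) N J - tconv y g N J"
      by (induction J) (simp_all add: diff_divide_distrib)
    then show ?case using Suc by simp
  qed
  have d: "dconv z (tconv y g) N J = tconv y (dconv z g) N J" for N J z
  proof (induction N arbitrary: J)
    case 0 have "tconv y (dconv z g) 0 j = 0" for j by (induction j) auto then show ?case by (simp del: tconv_simps)
  next
    case (Suc N)
    have "tconv y (dconv z g) (Suc N) (Suc J) = (tconv y (dconv z g) N J - tconv y g N J)/z" for J
    proof (induction J)
      case (Suc J)
      show ?case unfolding tconv_simps(2)[of y "dconv z g" "Suc N" "Suc J"] Suc.IH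
        by (simp add: diff_divide_distrib mult.commute[of y z])
    qed simp
    then show ?case using Suc by (cases J) (simp_all del: tconv_simps(2))
  qed
  have s: "tconv y (\<lambda>N J. h N J / real N) N J = tconv y h N J / real N" for h
    by (induction J) (auto simp: algebra_simps add_divide_distrib diff_divide_distrib)
  show ?thesis unfolding prefix_def[abs_def] s using u d by (auto simp: s prefix_def)
qed

text \<open>The kernel ut/(ut - y) is a series in the product ut, so multiplication by it commutes
  with t d/dt - u d/du, which acts on coefficients as J - N.\<close>

lemma dconv_JN: "dconv y (\<lambda>N J. (real J - real N) * g N J) N J = (real J - real N) * dconv y g N J"
proof (induction N arbitrary: J)
  case (Suc N)
  show ?case
  proof (cases J)
    case (Suc K)
    then show ?thesis unfolding Suc dconv.simps Suc.IH by (simp add: algebra_simps diff_divide_distrib add_divide_distrib)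
  qed simp
qed auto

lemma uconv_J: "uconv (\<lambda>N J. real J * g N J) N J = real J * uconv g N J"
  by (induction N) (auto simp: algebra_simps)

lemma uconv_lin: "uconv (\<lambda>N J. c * f N J + d * g N J) N J = c * uconv f N J + d * uconv g N J"
  by (induction N) (auto simp: algebra_simps)
lemma dconv_lin: "dconv y (\<lambda>N J. c * f N J + d * g N J) N J = c * dconv y f N J + d * dconv y g N J"
proof (induction N arbitrary: J)
  case (Suc N) show ?case by (cases J) (auto simp: Suc algebra_simps add_divide_distrib diff_divide_distrib)
qed auto

lemma prefix_lin: "prefix m x a (\<lambda>N J. c * f N J + d * g N J) N J = c * prefix m x a f N J + d * prefix m x a g N J"
  by (simp add: prefix_def uconv_lin dconv_lin add_divide_distrib)

section \<open>The differential equation in the colliding letter\<close>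

text \<open>The innermost letter is not 0: the iterated integral converges at 0 and is a power
  series there, without logarithms.\<close>

definition ok_word :: "nat list \<Rightarrow> bool" where "ok_word w \<longleftrightarrow> w = [] \<or> last w \<noteq> 0"

lemma ok_word_Nil [simp]: "ok_word []" by (simp add: ok_word_def)
lemma ok_word_Cons: "ok_word (a # w) \<longleftrightarrow> (if w = [] then a \<noteq> 0 else ok_word w)" by (auto simp: ok_word_def)

lemma gam_Suc0: "w \<noteq> [] \<Longrightarrow> gam m x w 0 J = 0" by (cases w) (auto simp: prefix_def)

definition wvars :: "nat \<Rightarrow> nat list \<Rightarrow> nat set" where "wvars m w = set w - {0, m}"

text \<open>Holds the derivatives of words of length l + 1. Each generator has no term with J = 0,
  be it by the letter in \<open>wvars m v\<close> or by the factor t/(t - x a), so the derivation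
  can be undone by dividing by J.\<close>

inductive_set dspan :: "nat \<Rightarrow> nat set \<Rightarrow> nat \<Rightarrow> ((nat \<Rightarrow> real) \<Rightarrow> nat \<Rightarrow> nat \<Rightarrow> real) set"
  for m :: nat and A :: "nat set" and l :: nat where
  zero: "(\<lambda>x N J. 0) \<in> dspan m A l"
| gam: "\<lbrakk>f \<in> dspan m A l; length v = l; ok_word v; set v \<subseteq> {0, m} \<union> A; wvars m v \<noteq> {}\<rbrakk>
    \<Longrightarrow> (\<lambda>x N J. of_int q * gam m x v N J + f x N J) \<in> dspan m A l"
| tconv: "\<lbrakk>f \<in> dspan m A l; length v = l; ok_word v; set v \<subseteq> {0, m} \<union> A; a \<in> A\<rbrakk>
    \<Longrightarrow> (\<lambda>x N J. of_int q * tconv (x a) (gam m x v) N J + f x N J) \<in> dspan m A l"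

text \<open>The condition \<open>0 < l\<close> makes \<open>v\<close> nonempty, so that a prepended
  0 never becomes the innermost letter.\<close>

lemma dspan_prefix:
  assumes "f \<in> dspan m A l" "0 < l" "b \<in> {0, m} \<union> A"
  shows "(\<lambda>x. prefix m x b (f x)) \<in> dspan m A (Suc l)"
  using assms
proof (induction rule: dspan.induct)
  case zero
  have "prefix m x b (\<lambda>N J. 0) = (\<lambda>N J. 0)" for x
    using prefix_lin[of m x b 0 "\<lambda>_ _. 0" 0 "\<lambda>_ _. 0"] by (auto simp: fun_eq_iff)
  then show ?case by (simp add: dspan.zero)
next
  case (gam f v q)
  have "(\<lambda>x. prefix m x b (\<lambda>N J. of_int q * gam m x v N J + f x N J))
     = (\<lambda>x N J. of_int q * gam m x (b # v) N J + prefix m x b (f x) N J)"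
    using prefix_lin[of m _ b "of_int q" "gam m _ v" 1] by (auto simp: fun_eq_iff)
  moreover have "\<dots> \<in> dspan m A (Suc l)"
    using gam by (intro dspan.gam) (auto simp: ok_word_Cons wvars_def)
  ultimately show ?case by simp
next
  case (tconv f v a q)
  have "(\<lambda>x. prefix m x b (\<lambda>N J. of_int q * tconv (x a) (gam m x v) N J + f x N J))
     = (\<lambda>x N J. of_int q * tconv (x a) (gam m x (b # v)) N J + prefix m x b (f x) N J)"
    using prefix_lin[of m _ b "of_int q" "tconv _ (gam m _ v)" 1] by (auto simp: fun_eq_iff tconv_prefix)
  moreover have "\<dots> \<in> dspan m A (Suc l)"
    using tconv by (intro dspan.tconv) (auto simp: ok_word_Cons)
  ultimately show ?case by simp
qed

text \<open>The function of a single letter depends on u alone if the letter is m and on ut alone if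
  it lies in A. The respective derivation kills it.\<close>

lemma gam_single:
  assumes "m \<noteq> 0" "0 \<notin> A" "m \<notin> A" "a \<noteq> 0" "a = m \<or> a \<in> A"
  shows "(real J - (if a \<in> A then real N else 0)) * gam m x [a] N J = 0"
proof (cases "a = m")
  case True
  have "uconv (\<lambda>N J. if N = 0 \<and> J = 0 then 1 else 0) N J = 0" if "J > 0" for N using that by (induction N) auto
  then show ?thesis using True assms by (auto simp: prefix_def)
next
  case False
  have "dconv (x a) (\<lambda>N J. if N = 0 \<and> J = 0 then 1 else 0) N J = 0" if "J \<noteq> N" for N J
    using that
  proof (induction N arbitrary: J)
    case (Suc N) then show ?case by (cases J) auto
  qed auto
  then show ?thesis using False assms by (auto simp: prefix_def)
qed

text \<open>Goncharov's differential equation: applying t d/dt (minus u d/du, if the outermost letter is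
  another one than m) lowers the length of the word.\<close>
lemma gam_derivation:
  assumes "m \<noteq> 0" "0 \<notin> A" "m \<notin> A" "ok_word (a # w)" "set (a # w) \<subseteq> {0, m} \<union> A"
  shows "(\<lambda>x N J. (real J - (if a \<in> A then real N else 0)) * gam m x (a # w) N J) \<in> dspan m A (length w)"
  using assms(4,5)
proof (induction w arbitrary: a)
  case Nil
  then have a: "a \<noteq> 0" "a = m \<or> a \<in> A" by (auto simp: ok_word_Cons)
  have 0: "(real J - (if a \<in> A then real N else 0)) * gam m x [a] N J = 0" for x N J
    by (rule gam_single[OF assms(1-3) a])
  show ?case unfolding 0 by (simp add: dspan.zero)
next
  case (Cons b w)
  define g where "g = (\<lambda>x N J. (real J - (if b \<in> A then real N else 0)) * gam m x (b # w) N J)"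
  have okbw: "ok_word (b # w)" "set (b # w) \<subseteq> {0, m} \<union> A" and aset: "a \<in> {0, m} \<union> A"
    using Cons.prems by (auto simp: ok_word_Cons)
  have g: "g \<in> dspan m A (length w)" unfolding g_def by (rule Cons.IH[OF okbw])
  have pg: "(\<lambda>x. prefix m x a (g x)) \<in> dspan m A (length (b # w))" 
  proof (cases "w = []")
    case True
    have b: "b \<noteq> 0" "b = m \<or> b \<in> A" using True okbw by (auto simp: ok_word_Cons)
    have "g = (\<lambda>x N J. 0)" unfolding g_def True using gam_single[OF assms(1-3) b] by blast
    moreover have "prefix m x a (\<lambda>N J. 0) = (\<lambda>N J. 0)" for x
      using prefix_lin[of m x a 0 "\<lambda>_ _. 0" 0 "\<lambda>_ _. 0"] by (auto simp: fun_eq_iff)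
    ultimately show ?thesis by (simp add: dspan.zero)
  next
    case False
    then show ?thesis using dspan_prefix[OF g _ aset] by simp
  qed
  have okw: "ok_word w" "set w \<subseteq> {0, m} \<union> A" using okbw by (auto simp: ok_word_Cons split: if_splits)
  \<comment> \<open>The correction term that appears when the derivations belonging to a and b
    differ and one of the two letters is m while the other lies in A. Two kernels are then
    multiplied directly, without an integration in between, and \<open>uconv_dconv\<close> splits
    their product.\<close>
  have exch: "(\<lambda>x N J. c * (uconv (dconv (x y) (gam m x w)) N J / real N) + prefix m x a (g x) N J) \<in> dspan m A (length (b # w))"
    if y: "y \<in> A" and c: "c = 1 \<or> c = -1" for y c
  proof -
    have y0: "y \<noteq> 0" using y assms by metis
    define ci :: int where "ci = (if c = 1 then 1 else -1)"
    have ci: "of_int ci = c" using c by (auto simp: ci_def)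
    have eq: "uconv (dconv (x y) (gam m x w)) N J / real N = tconv (x y) (gam m x (m # w)) N J + gam m x (y # w) N J
       - tconv (x y) (gam m x (y # w)) N J" for x N J
    proof -
      have s: "tconv z (\<lambda>N J. h N J / real N) N J = tconv z h N J / real N" for h z
        by (induction J) (auto simp: algebra_simps add_divide_distrib diff_divide_distrib)
      show ?thesis unfolding uconv_dconv using y assms
        by (auto simp: prefix_def[abs_def] s field_simps add_divide_distrib diff_divide_distrib)
    qed
    have "(\<lambda>x N J. of_int ci * tconv (x y) (gam m x (m # w)) N J + (of_int ci * gam m x (y # w) N J
       + (of_int (-ci) * tconv (x y) (gam m x (y # w)) N J + prefix m x a (g x) N J))) \<in> dspan m A (length (b # w))"
      using okw y y0 pg assms(1-3) by (intro dspan.gam dspan.tconv) (auto simp: ok_word_Cons wvars_def)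
    then show ?thesis by (simp add: eq ci algebra_simps)
  qed
  consider "a = 0" | "a = m" | "a \<in> A" using aset by auto
  then show ?case
  proof cases
    case 1
    \<comment> \<open>If b lies in A, the derivations for 0 and for b differ by u d/du, that is by
      the factor N, which cancels the division by N in the outer letter.\<close>
    have eq: "(real J - (if a \<in> A then real N else 0)) * gam m x (a # b # w) N J
       = prefix m x a (g x) N J + (if b \<in> A then gam m x (b # w) N J else 0)" for x N J
      using 1 assms by (cases "N = 0") (auto simp: prefix_def[of m x a] prefix_def[of m x 0] g_def field_simps gam_Suc0 simp del: gam.simps(2) simp: gam.simps(2)[of m x 0 "b # w"])
    show ?thesis
    proof (cases "b \<in> A")
      case True
      have "b \<noteq> 0" using True assms by metis
      then have "(\<lambda>x N J. of_int 1 * gam m x (b # w) N J + prefix m x a (g x) N J) \<in> dspan m A (length (b # w))"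
        using True okbw pg assms(1-3) by (intro dspan.gam) (auto simp: wvars_def)
      then show ?thesis unfolding eq using True by (simp add: add.commute)
    next
      case False
      then show ?thesis unfolding eq using pg by simp
    qed
  next
    case 2
    then have aA: "a \<notin> A" "a \<noteq> 0" using assms by auto
    have gb: "real J * gam m x (b # w) N J = 1 * g x N J + (if b \<in> A then 1 else 0) * dconv (x b) (gam m x w) N J" for x N J
    proof (cases "N = 0")
      case True then show ?thesis by (simp add: g_def prefix_def)
    next
      case False then show ?thesis using assms by (auto simp: g_def prefix_def field_simps)
    qed
    have "real J * uconv (gam m x (b # w)) N J = uconv (\<lambda>N J. real J * gam m x (b # w) N J) N J" for x N J
      by (rule uconv_J[symmetric])
    then have ub: "real J * uconv (gam m x (b # w)) N J = uconv (g x) N J + (if b \<in> A then 1 else 0) * uconv (dconv (x b) (gam m x w)) N J" for x N J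
      unfolding gb uconv_lin by simp
    have eq: "(real J - (if a \<in> A then real N else 0)) * gam m x (a # b # w) N J
       = prefix m x a (g x) N J + (if b \<in> A then 1 else 0) * (uconv (dconv (x b) (gam m x w)) N J / real N)" for x N J
      unfolding gam.simps(2)[of m x a "b # w"] using aA 2 ub[where N=N and J=J] 
      by (simp add: prefix_def[of m x m] add_divide_distrib[symmetric] del: gam.simps(2))
    show ?thesis
    proof (cases "b \<in> A")
      case True
      then show ?thesis unfolding eq using exch[of b 1] by (simp add: add.commute)
    next
      case False
      then show ?thesis unfolding eq using pg by simp
    qed
  next
    case 3
    then have aA: "a \<noteq> m" "a \<noteq> 0" using assms by metis+
    \<comment> \<open>For b outside A the two derivations again differ by u d/du. It strips the
      letter b of its integration and leaves its kernel next to that of a.\<close>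
    have gb: "(real J - real N) * gam m x (b # w) N J = 1 * g x N J + (if b \<in> A then 0 else -1) * (real N * gam m x (b # w) N J)" for x N J
      by (simp add: g_def algebra_simps)
    have eq: "(real J - (if a \<in> A then real N else 0)) * gam m x (a # b # w) N J
       = prefix m x a (g x) N J + (if b \<in> A then 0 else -1) * (dconv (x a) (\<lambda>N J. real N * gam m x (b # w) N J) N J / real N)" for x N J
    proof -
      have "(real J - real N) * dconv (x a) (gam m x (b # w)) N J = dconv (x a) (\<lambda>N J. (real J - real N) * gam m x (b # w) N J) N J"
        by (rule dconv_JN[symmetric])
      also have "\<dots> = dconv (x a) (g x) N J + (if b \<in> A then 0 else -1) * dconv (x a) (\<lambda>N J. real N * gam m x (b # w) N J) N J"
        unfolding gb dconv_lin by simp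
      finally show ?thesis unfolding gam.simps(2)[of m x a "b # w"] using aA 3
        by (simp add: prefix_def[of m x a] add_divide_distrib[symmetric] del: gam.simps(2))
    qed
    consider "b \<in> A" | "b = m" | "b = 0" using okbw by auto
    then show ?thesis
    proof cases
      case 1
      then show ?thesis unfolding eq using pg by simp
    next
      case 2
      have bA: "b \<notin> A" "b \<noteq> 0" using 2 assms by auto
      have "real N * gam m x (b # w) N J = uconv (gam m x w) N J" for x N J
        using 2 bA by (cases "N = 0") (auto simp: prefix_def)
      then have n: "(\<lambda>N J. real N * gam m x (b # w) N J) = uconv (gam m x w)" for x by (simp add: fun_eq_iff)
      have "dconv (x a) (uconv (gam m x w)) N J = uconv (dconv (x a) (gam m x w)) N J" for x N J
      proof (induction N arbitrary: J)
        case 0 then show ?case by simp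
      next
        case (Suc N)
        show ?case
        proof (cases J)
          case 0 then show ?thesis using uconv_dconv_0 by (simp del: uconv_simps)
        next
          case (Suc K)
          show ?thesis unfolding Suc uconv_dconv_Suc using Suc.IH[of K] by simp
        qed
      qed
      then show ?thesis unfolding eq n using bA exch[of a "-1"] 3 by (simp add: add.commute)
    next
      case 3
      then have bA: "b \<notin> A" and wn: "w \<noteq> []" using assms okbw by (auto simp: ok_word_Cons)
      have n: "real N * gam m x (b # w) N J = gam m x w N J" for x N J
        using 3 gam_Suc0[OF wn] by (cases "N = 0") (auto simp: prefix_def)
      have "(\<lambda>x N J. of_int (-1) * gam m x (a # w) N J + prefix m x a (g x) N J) \<in> dspan m A (length (b # w))"
        using \<open>a \<in> A\<close> aA okw wn pg by (intro dspan.gam) (auto simp: wvars_def ok_word_Cons)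
      then show ?thesis unfolding eq n using bA aA by (simp add: prefix_def[of m _ a "gam m _ w"] add.commute)
    qed
  qed
qed

section \<open>Growth of the coefficients and convergence of the series\<close>

lemma conv_bound:
  assumes "\<And>k. \<bar>f k\<bar> \<le> C * q ^ k" "0 < y" "1 / y \<le> q"
  shows "\<bar>conv y f n\<bar> \<le> real n * C * q ^ n"
proof (induction n)
  case (Suc n)
  have q: "0 \<le> q" using assms(2,3) by (smt (verit) divide_pos_pos)
  have C: "0 \<le> C * q ^ n" using assms(1)[of n] by linarith
  have "\<bar>conv y f (Suc n)\<bar> = \<bar>conv y f n - f n\<bar> * (1 / y)" using assms by (simp add: abs_divide)
  also have "\<dots> \<le> (real n * C * q ^ n + C * q ^ n) * q"
    using Suc assms(1)[of n] assms(2,3) q C by (intro mult_mono) (auto intro: add_nonneg_nonneg mult_nonneg_nonneg)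
  finally show ?case by (simp add: algebra_simps)
qed simp

text \<open>Strict room between p and q removes the factor n of \<open>conv_bound\<close>: X = C
  p/(q - p) solves (X + C) p = X q, which is what the recursion for \<open>conv\<close>
  requires.\<close>

lemma conv_bound':
  assumes "\<And>k. \<bar>f k\<bar> \<le> C * q ^ k" "0 < y" "1 / y \<le> p" "p < q"
  shows "\<bar>conv y f n\<bar> \<le> C * (p / (q - p)) * q ^ n"
proof (induction n)
  case 0
  have "0 \<le> C" using assms(1)[of 0] by (simp add: order_trans[OF abs_ge_zero])
  moreover have "0 < p" using assms(2,3) by (smt (verit) divide_pos_pos)
  ultimately show ?case using assms by simp
next
  case (Suc n)
  have p: "0 < p" using assms(2,3) by (smt (verit) divide_pos_pos)
  have C: "0 \<le> C" using assms(1)[of 0] by (simp add: order_trans[OF abs_ge_zero])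
  have "\<bar>conv y f (Suc n)\<bar> = \<bar>conv y f n - f n\<bar> * (1 / y)" using assms by (simp add: abs_divide)
  also have "\<dots> \<le> (C * (p / (q - p)) * q ^ n + C * q ^ n) * p"
    using Suc assms(1)[of n] assms(2-4) p C by (intro mult_mono) (auto intro!: add_nonneg_nonneg mult_nonneg_nonneg divide_nonneg_nonneg)
  also have "\<dots> = C * (p / (q - p)) * q ^ Suc n" using assms(4) p by (simp add: field_simps)
  finally show ?case .
qed

text \<open>Moving the pole from y to y/u costs O(1 - u). The constant K = C p q/(q - p)^2 is the
  solution of K p + C p q/(q - p) = K q that closes the induction.\<close>

lemma conv_dilate_bound:
  assumes "\<And>k. \<bar>f k\<bar> \<le> C * q ^ k" "0 < y" "1 / y \<le> p" "p < q" "0 < u" "u \<le> 1"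
  shows "\<bar>conv (y / u) f n - conv y f n\<bar> \<le> (1 - u) * (C * p * q / (q - p)\<^sup>2) * q ^ n"
proof (induction n)
  case 0
  have "0 \<le> C" using assms(1)[of 0] by (simp add: order_trans[OF abs_ge_zero])
  moreover have "0 < p" using assms(2,3) by (smt (verit) divide_pos_pos)
  ultimately show ?case using assms by (simp add: mult_nonneg_nonneg)
next
  case (Suc n)
  have p: "0 < p" using assms(2,3) by (smt (verit) divide_pos_pos)
  have C: "0 \<le> C" using assms(1)[of 0] by (simp add: order_trans[OF abs_ge_zero])
  define K where "K = C * p * q / (q - p)\<^sup>2"
  have "conv (y / u) f (Suc n) - conv y f (Suc n)
     = (u * (conv (y / u) f n - conv y f n) - (1 - u) * (conv y f n - f n)) * (1 / y)"
    using assms by (simp add: field_simps)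
  then have "\<bar>conv (y / u) f (Suc n) - conv y f (Suc n)\<bar> 
     = \<bar>u * (conv (y / u) f n - conv y f n) - (1 - u) * (conv y f n - f n)\<bar> * (1 / y)"
    using assms(2) by (simp add: abs_mult)
  also have "\<dots> \<le> (1 * ((1 - u) * K * q ^ n) + (1 - u) * (C * (p / (q - p)) * q ^ n + C * q ^ n)) * p"
  proof (intro mult_mono)
    have "\<bar>u * (conv (y / u) f n - conv y f n)\<bar> \<le> 1 * ((1 - u) * K * q ^ n)"
      unfolding abs_mult using assms Suc by (intro mult_mono) (auto simp: K_def)
    moreover have "\<bar>(1 - u) * (conv y f n - f n)\<bar> \<le> (1 - u) * (C * (p / (q - p)) * q ^ n + C * q ^ n)"
      unfolding abs_mult using conv_bound'[OF assms(1-4), of n] assms(1)[of n] assms(6) by (intro mult_mono) auto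
    ultimately show "\<bar>u * (conv (y / u) f n - conv y f n) - (1 - u) * (conv y f n - f n)\<bar>
      \<le> (1 * ((1 - u) * K * q ^ n) + (1 - u) * (C * (p / (q - p)) * q ^ n + C * q ^ n))" by linarith
    show "0 \<le> 1 * ((1 - u) * K * q ^ n) + (1 - u) * (C * (p / (q - p)) * q ^ n + C * q ^ n)"
      using p C assms by (auto simp: K_def intro!: add_nonneg_nonneg mult_nonneg_nonneg divide_nonneg_nonneg)
  qed (use assms in auto)
  also have "\<dots> = (1 - u) * q ^ n * (K * p + C * p * q / (q - p))" using assms(4) by (simp add: field_simps)
  also have "K * p + C * p * q / (q - p) = K * q" 
    using assms(4) by (simp add: K_def divide_simps power2_eq_square) (simp add: algebra_simps)
  finally show ?case by (simp add: K_def algebra_simps)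
qed

lemma summable_bounded:
  fixes f :: "nat \<Rightarrow> real"
  assumes "\<And>k. \<bar>f k\<bar> \<le> C * q ^ k" "0 \<le> q" "q * \<bar>s\<bar> < 1"
  shows "summable (\<lambda>n. f n * s ^ n)"
proof (rule summable_comparison_test')
  show "summable (\<lambda>n. C * (q * \<bar>s\<bar>) ^ n)" using assms by (intro summable_mult summable_geometric) auto
  show "norm (f n * s ^ n) \<le> C * (q * \<bar>s\<bar>) ^ n" for n
    using mult_right_mono[OF assms(1)[of n], of "\<bar>s\<bar> ^ n"] by (simp add: abs_mult power_abs power_mult_distrib mult_ac)
qed

lemma summable_conv:
  assumes "\<And>k. \<bar>f k\<bar> \<le> C * q ^ k" "0 < y" "1 / y \<le> q" "q * \<bar>s\<bar> < 1"
  shows "summable (\<lambda>n. conv y f n * s ^ n)"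
proof -
  \<comment> \<open>A slightly larger growth rate p gives the strict inequality that
    \<open>conv_bound'\<close> needs and still keeps the series at s convergent.\<close>
  obtain p where p: "q < p" "p * \<bar>s\<bar> < 1"
  proof (cases "s = 0")
    case True then show ?thesis using that[of "q + 1"] by auto
  next
    case False
    then have "q < 1 / \<bar>s\<bar>" using assms(4) by (simp add: field_simps)
    from dense[OF this] show ?thesis using that False by (auto simp: field_simps)
  qed
  have q: "0 < q" using assms(2,3) by (smt (verit) divide_pos_pos)
  have C: "0 \<le> C" using assms(1)[of 0] by (simp add: order_trans[OF abs_ge_zero])
  have "\<bar>f k\<bar> \<le> C * p ^ k" for k
    using assms(1)[of k] power_mono[of q p k] p q C by (smt (verit) mult_left_mono)
  from summable_bounded[OF conv_bound'[OF this assms(2,3) p(1)] _ p(2)] show ?thesis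
    using p q by simp
qed

lemma conv_sums:
  assumes "\<And>k. \<bar>f k\<bar> \<le> C * q ^ k" "0 < y" "1 / y \<le> q" "q * \<bar>s\<bar> < 1"
  shows "(\<Sum>n. conv y f n * s ^ n) = s / (s - y) * (\<Sum>n. f n * s ^ n)"
proof -
  have q: "0 < q" using assms(2,3) by (smt (verit) divide_pos_pos)
  note sc = summable_conv[OF assms]
  have sf: "summable (\<lambda>n. f n * s ^ n)" using summable_bounded[OF assms(1) _ assms(4)] q by simp
  have "(\<Sum>n. conv y f n * s ^ n) = (\<Sum>n. conv y f (Suc n) * s ^ Suc n)"
    using suminf_split_head[OF sc] by simp
  also have "\<dots> = (\<Sum>n. s / y * (conv y f n * s ^ n - f n * s ^ n))"
    by (simp add: algebra_simps diff_divide_distrib)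
  also have "\<dots> = s / y * ((\<Sum>n. conv y f n * s ^ n) - (\<Sum>n. f n * s ^ n))"
    by (subst suminf_mult) (auto intro: summable_diff sc sf simp: suminf_diff[OF sc sf])
  finally have e: "(\<Sum>n. conv y f n * s ^ n) * (s - y) = s * (\<Sum>n. f n * s ^ n)"
    using assms(2) by (simp add: field_simps)
  have "\<bar>s\<bar> < y"
  proof -
    have "\<bar>s\<bar> / y \<le> q * \<bar>s\<bar>" using mult_right_mono[OF assms(3), of "\<bar>s\<bar>"] by simp
    then have "\<bar>s\<bar> / y < 1" using assms(4) by linarith
    then show ?thesis using assms(2) by (simp add: field_simps)
  qed
  then have "s - y \<noteq> 0" by auto
  then show ?thesis using e by (simp add: field_simps)
qed

definition wbnd :: "(nat \<Rightarrow> real) \<Rightarrow> nat set \<Rightarrow> real \<Rightarrow> bool" where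
  "wbnd x A q \<longleftrightarrow> 0 < q \<and> (\<forall>a\<in>A - {0}. 0 < x a \<and> 1 / x a \<le> q)"

text \<open>The factor N that \<open>conv_bound\<close> produces for each letter is cancelled by the
  division by N, so the constant remains 1 for words of any length.\<close>

lemma hcoef_bound:
  assumes "wbnd x (set w) q"
  shows "\<bar>hcoef x w N\<bar> \<le> 1 * q ^ N"
  using assms
proof (induction w arbitrary: N)
  case Nil then show ?case by (auto simp: wbnd_def)
next
  case (Cons a w)
  have IH: "\<bar>hcoef x w k\<bar> \<le> 1 * q ^ k" for k using Cons by (auto simp: wbnd_def)
  have q: "0 < q" using Cons.prems by (auto simp: wbnd_def)
  show ?case
  proof (cases "N = 0")
    case False
    have "\<bar>hcoef x w N\<bar> \<le> real N * q ^ N"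
      using False q by (intro order_trans[OF IH[of N]] mult_right_mono) (auto simp: Suc_le_eq)
    moreover have "\<bar>conv (x a) (hcoef x w) N\<bar> \<le> real N * 1 * q ^ N" if "a \<noteq> 0"
      using that Cons.prems by (intro conv_bound IH) (auto simp: wbnd_def)
    ultimately show ?thesis using False by (auto simp: abs_divide field_simps)
  qed (use q in auto)
qed

definition hlog :: "(nat \<Rightarrow> real) \<Rightarrow> nat list \<Rightarrow> real \<Rightarrow> real" where
  "hlog x w s = (\<Sum>n. hcoef x w n * s ^ n)"

lemma hlog_summable:
  assumes "wbnd x (set w) q" "q * \<bar>s\<bar> < 1"
  shows "summable (\<lambda>n. hcoef x w n * s ^ n)"
  using summable_bounded[OF hcoef_bound[OF assms(1)] _ assms(2)] assms(1) by (auto simp: wbnd_def)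

lemma hcoef_0: "w \<noteq> [] \<Longrightarrow> hcoef x w 0 = 0" by (cases w) auto

lemma hlog_Nil [simp]: "hlog x [] s = 1"
proof -
  have "(\<lambda>n. hcoef x [] n * s ^ n) sums (\<Sum>n\<in>{0}. hcoef x [] n * s ^ n)" by (rule sums_finite) auto
  then show ?thesis unfolding hlog_def by (simp add: sums_iff)
qed

lemma hlog_at_0: "hlog x w 0 = (if w = [] then 1 else 0)"
  by (simp add: hlog_def hcoef_0)

lemma hlog_deriv:
  assumes "wbnd x (set (a # w)) q" "q * \<bar>s\<bar> < 1" "ok_word (a # w)" "s \<noteq> 0"
  shows "(hlog x (a # w) has_real_derivative hlog x w s / (s - (if a = 0 then 0 else x a))) (at s)"
proof -
  have q: "0 < q" and wb: "wbnd x (set w) q" using assms(1) by (auto simp: wbnd_def)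
  define c where "c = hcoef x (a # w)"
  obtain K where K: "\<bar>s\<bar> < K" "q * K < 1"
  proof -
    have "\<bar>s\<bar> < 1 / q" using assms(2) q by (simp add: field_simps)
    from dense[OF this] show ?thesis using that q by (auto simp: field_simps)
  qed
  have "summable (\<lambda>n. c n * K ^ n)" unfolding c_def using K by (intro hlog_summable[OF assms(1)]) auto
  moreover have "norm s < norm K" using K by simp
  ultimately have D: "((\<lambda>s. \<Sum>n. c n * s ^ n) has_field_derivative (\<Sum>n. diffs c n * s ^ n)) (at s)"
    by (rule termdiffs_strong)
  have sd: "summable (\<lambda>n. diffs c n * s ^ n)"
  proof (rule termdiff_converges[of s K c])
    fix z :: real assume "norm z < K"
    then have "q * \<bar>z\<bar> < 1" using K(2) q by (smt (verit) mult_strict_left_mono real_norm_def)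
    then show "summable (\<lambda>n. c n * z ^ n)" unfolding c_def by (intro hlog_summable[OF assms(1)])
  qed (use K in auto)
  have "s * (\<Sum>n. diffs c n * s ^ n) = (\<Sum>n. real (Suc n) * c (Suc n) * s ^ Suc n)"
    by (subst suminf_mult[OF sd, symmetric]) (simp add: diffs_def mult_ac)
  also have "\<dots> = (\<Sum>n. (real n * c n) * s ^ n)"
  proof -
    have "summable (\<lambda>n. (real n * c n) * s ^ n)"
      by (subst summable_Suc_iff[symmetric]) (use summable_mult[OF sd, of s] in \<open>simp add: diffs_def mult_ac\<close>)
    from suminf_split_head[OF this] show ?thesis by simp
  qed
  also have "\<dots> = (if a = 0 then hlog x w s else s / (s - x a) * hlog x w s)"
  proof (cases "a = 0")
    case True
    then have "w \<noteq> []" using assms(3) by (auto simp: ok_word_Cons)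
    then have "real n * c n = hcoef x w n" for n using True by (cases n) (auto simp: c_def hcoef_0)
    then show ?thesis using True by (simp add: hlog_def)
  next
    case False
    then have "real n * c n = conv (x a) (hcoef x w) n" for n by (cases n) (auto simp: c_def)
    then show ?thesis using False assms(1,2) conv_sums[OF hcoef_bound[OF wb], of "x a" s]
      by (simp add: hlog_def wbnd_def)
  qed
  also have "\<dots> = s * (hlog x w s / (s - (if a = 0 then 0 else x a)))" using assms(4) by simp
  finally have "(\<Sum>n. diffs c n * s ^ n) = hlog x w s / (s - (if a = 0 then 0 else x a))"
    by (simp only: mult_left_cancel[OF assms(4)])
  then show ?thesis using D unfolding hlog_def c_def by simp
qed

lemma hlog_continuous:
  assumes "wbnd x (set w) q" "q * \<bar>s\<bar> < 1"
  shows "isCont (hlog x w) s"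
proof -
  have q: "0 < q" using assms(1) by (auto simp: wbnd_def)
  have "\<bar>s\<bar> < 1 / q" using assms(2) q by (simp add: field_simps)
  then obtain K where K: "\<bar>s\<bar> < K" "K < 1 / q" using dense by blast
  then have "q * K < 1" using q by (simp add: field_simps)
  then have "summable (\<lambda>n. hcoef x w n * K ^ n)" using K by (intro hlog_summable[OF assms(1)]) auto
  then show ?thesis unfolding hlog_def[abs_def] using K by (intro isCont_powser[where K=K]) auto
qed


section \<open>Asymptotic expansions at a colliding letter\<close>

text \<open>The exponent 1/4 comes from \<open>zword_rate\<close>, where it may be spent on
  coefficients of size N^(-3/2) without losing summability. Powers of the logarithm that arise on
  the way are collected in d.\<close>

definition errd :: "nat \<Rightarrow> real \<Rightarrow> real" where
  "errd d u = (1 + \<bar>ln (1 - u)\<bar>) ^ d * (1 - u) powr (1/4)"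

lemma errd_nonneg: "0 \<le> errd d u" by (simp add: errd_def)

lemma errd_mono: "d \<le> e \<Longrightarrow> errd d u \<le> errd e u"
  unfolding errd_def by (intro mult_right_mono power_increasing) auto

lemma ln_errd: "\<bar>ln (1 - u)\<bar> * errd d u \<le> errd (Suc d) u"
  unfolding errd_def by (simp add: mult_ac mult_left_mono mult_right_mono)

lemma one_minus_errd: 
  assumes "0 < u" "u < 1" shows "(1 - u) * \<bar>ln (1 - u)\<bar> ^ i \<le> errd i u"
proof -
  have "(1 - u) powr 1 \<le> (1 - u) powr (1/4)" using assms by (intro powr_mono') auto
  then have "(1 - u) \<le> (1 - u) powr (1/4)" using assms by simp
  moreover have "\<bar>ln (1 - u)\<bar> ^ i \<le> (1 + \<bar>ln (1 - u)\<bar>) ^ i" by (intro power_mono) auto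
  ultimately show ?thesis unfolding errd_def using assms by (subst mult.commute) (intro mult_mono, auto)
qed

lemma errd_tendsto: "(errd d \<longlongrightarrow> 0) (at_left 1)"
  unfolding errd_def by real_asymp

text \<open>The inequality for \<open>1 / x a\<close> is strict, in contrast to \<open>wbnd\<close>,
  to leave the room that \<open>conv_bound'\<close> and \<open>conv_dilate_bound\<close>
  need.\<close>

definition adm :: "nat set \<Rightarrow> (nat \<Rightarrow> real) \<Rightarrow> real \<Rightarrow> bool" where
  "adm A x q \<longleftrightarrow> 0 < q \<and> (\<forall>a\<in>A. 0 < x a \<and> 1 / x a < q)"

type_synonym cseq = "(nat \<Rightarrow> real) \<Rightarrow> nat \<Rightarrow> real"

text \<open>Combinations of hyperlogarithms in the letters that remain after the collision. The
  empty word alone is held to K0 as well; this keeps track of the constants.\<close>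

inductive_set hspan :: "nat set \<Rightarrow> real set \<Rightarrow> real set \<Rightarrow> cseq set" for A K0 K where
  zero: "(\<lambda>x J. 0) \<in> hspan A K0 K"
| add: "\<lbrakk>f \<in> hspan A K0 K; k \<in> K; w = [] \<longrightarrow> k \<in> K0; ok_word w; set w \<subseteq> {0} \<union> A\<rbrakk>
    \<Longrightarrow> (\<lambda>x J. k * hcoef x w J + f x J) \<in> hspan A K0 K"

text \<open>The derivatives t d/dt of such combinations. Dividing by J leads back to
  \<open>hspan\<close>, with coefficient 0 at the empty word (\<open>cspan_div\<close>).\<close>

inductive_set cspan :: "nat set \<Rightarrow> real set \<Rightarrow> cseq set" for A K where
  zero: "(\<lambda>x J. 0) \<in> cspan A K"
| add: "\<lbrakk>f \<in> cspan A K; k \<in> K; w \<noteq> []; ok_word w; set w \<subseteq> {0} \<union> A\<rbrakk>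
    \<Longrightarrow> (\<lambda>x J. k * hcoef x w J + f x J) \<in> cspan A K"
| conv: "\<lbrakk>f \<in> cspan A K; k \<in> K; ok_word w; set w \<subseteq> {0} \<union> A; a \<in> A\<rbrakk>
    \<Longrightarrow> (\<lambda>x J. k * conv (x a) (hcoef x w) J + f x J) \<in> cspan A K"

lemma cspan_plus: "f \<in> cspan A K \<Longrightarrow> g \<in> cspan A K \<Longrightarrow> (\<lambda>x J. f x J + g x J) \<in> cspan A K"
  by (induction rule: cspan.induct) (auto simp: add.assoc intro: cspan.intros)

lemma cspan_scale: 
  assumes "f \<in> cspan A K" "\<And>k. k \<in> K \<Longrightarrow> c * k \<in> K"
  shows "(\<lambda>x J. c * f x J) \<in> cspan A K"
  using assms(1)
proof (induction rule: cspan.induct)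
  case (add f k w)
  have "(\<lambda>x J. (c * k) * hcoef x w J + c * f x J) \<in> cspan A K" using add assms by (intro cspan.add) auto
  then show ?case by (simp add: algebra_simps)
next
  case (conv f k w a)
  have "(\<lambda>x J. (c * k) * conv (x a) (hcoef x w) J + c * f x J) \<in> cspan A K" using conv assms by (intro cspan.conv) auto
  then show ?case by (simp add: algebra_simps)
qed (simp add: cspan.zero)

lemma conv_zero [simp]: "conv y (\<lambda>_. 0) = (\<lambda>_. 0)"
proof
  show "conv y (\<lambda>_. 0) n = 0" for n by (induction n) auto
qed

lemma hspan_conv: "f \<in> hspan A K0 K \<Longrightarrow> a \<in> A \<Longrightarrow> (\<lambda>x J. conv (x a) (f x) J) \<in> cspan A K"
proof (induction rule: hspan.induct)
  case (add f k w)
  have "(\<lambda>x J. k * conv (x a) (hcoef x w) J + conv (x a) (f x) J) \<in> cspan A K"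
    using add by (intro cspan.conv) auto
  then show ?case by (simp add: conv_diff conv_scale)
qed (simp add: cspan.zero)

lemma hspan_cspan: 
  assumes "f \<in> hspan A {0} K" shows "f \<in> cspan A K"
  using assms
proof (induction rule: hspan.induct)
  case (add f k w)
  then show ?case by (cases "w = []") (auto intro: cspan.intros)
qed (simp add: cspan.zero)

lemma cspan_div: 
  assumes "f \<in> cspan A K" "0 \<notin> A" shows "(\<lambda>x J. f x J / real J) \<in> hspan A {0} K"
  using assms
proof (induction rule: cspan.induct)
  case (add f k w)
  have "(\<lambda>x J. k * hcoef x (0 # w) J + f x J / real J) \<in> hspan A {0} K"
    using add by (intro hspan.add) (auto simp: ok_word_Cons)
  then show ?case by (simp add: add_divide_distrib)
next
  case (conv f k w a)
  then have "a \<noteq> 0" by metis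
  have "(\<lambda>x J. k * hcoef x (a # w) J + f x J / real J) \<in> hspan A {0} K"
    using conv \<open>a \<noteq> 0\<close> by (intro hspan.add) (auto simp: ok_word_Cons)
  then show ?case using \<open>a \<noteq> 0\<close> by (simp add: add_divide_distrib)
qed (simp add: hspan.zero)

lemma adm_wbnd: "adm A x q \<Longrightarrow> set w \<subseteq> {0} \<union> A \<Longrightarrow> wbnd x (set w) q"
  by (auto simp: adm_def wbnd_def less_imp_le)

lemma hspan_bound:
  assumes "f \<in> hspan A K0 K" "adm A x q"
  shows "\<exists>C\<ge>0. \<forall>J. \<bar>f x J\<bar> \<le> C * q ^ J"
  using assms
proof (induction rule: hspan.induct)
  case (add f k w)
  then obtain C where C: "C \<ge> 0" "\<And>J. \<bar>f x J\<bar> \<le> C * q ^ J" by blast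
  have "\<bar>k * hcoef x w J + f x J\<bar> \<le> (\<bar>k\<bar> + C) * q ^ J" for J
  proof -
    have "\<bar>k * hcoef x w J\<bar> \<le> \<bar>k\<bar> * (1 * q ^ J)"
      unfolding abs_mult using add by (intro mult_left_mono hcoef_bound adm_wbnd) auto
    then show ?thesis using C(2)[of J] by (simp add: algebra_simps)
  qed
  then show ?case using C by (intro exI[of _ "\<bar>k\<bar> + C"]) auto
qed auto

text \<open>The degree d and the coefficients \<Phi> are chosen once for all x; only the constant of
  the error depends on x and q. The error is uniform in J up to \<open>q ^ J\<close>, which later
  allows summation over J.\<close>

definition hasexp :: "nat set \<Rightarrow> cseq set \<Rightarrow> cseq set \<Rightarrow> ((nat \<Rightarrow> real) \<Rightarrow> real \<Rightarrow> nat \<Rightarrow> real) \<Rightarrow> bool" where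
  "hasexp A S0 S F \<longleftrightarrow> (\<exists>d \<Phi>. \<Phi> 0 \<in> S0 \<and> (\<forall>i. \<Phi> i \<in> S) \<and> (\<forall>x q. adm A x q \<longrightarrow>
     (\<exists>C\<ge>0. \<forall>u\<in>{0<..<1}. \<forall>J. \<bar>F x u J - (\<Sum>i\<le>d. ln (1 - u) ^ i * \<Phi> i x J)\<bar> \<le> C * errd d u * q ^ J)))"

text \<open>Padding with zero coefficients allows every larger degree, so that two expansions can be
  brought to a common one.\<close>

lemma hasexpE:
  assumes "hasexp A S0 S F" "(\<lambda>x J. 0) \<in> S"
  obtains d \<Phi> where "\<Phi> 0 \<in> S0" "\<And>i. \<Phi> i \<in> S"
    "\<And>x q e. adm A x q \<Longrightarrow> d \<le> e \<Longrightarrow> (\<exists>C\<ge>0. \<forall>u\<in>{0<..<1}. \<forall>J. \<bar>F x u J - (\<Sum>i\<le>e. ln (1 - u) ^ i * \<Phi> i x J)\<bar> \<le> C * errd e u * q ^ J)"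
proof -
  obtain d \<Phi> where d: "\<Phi> 0 \<in> S0" "\<And>i. \<Phi> i \<in> S" "\<And>x q. adm A x q \<Longrightarrow>
     (\<exists>C\<ge>0. \<forall>u\<in>{0<..<1}. \<forall>J. \<bar>F x u J - (\<Sum>i\<le>d. ln (1 - u) ^ i * \<Phi> i x J)\<bar> \<le> C * errd d u * q ^ J)"
    using assms(1) unfolding hasexp_def by blast
  define \<Psi> where "\<Psi> i = (if i \<le> d then \<Phi> i else (\<lambda>x J. 0))" for i
  show ?thesis
  proof (rule that[of \<Psi> d])
    show "\<Psi> 0 \<in> S0" "\<And>i. \<Psi> i \<in> S" using d assms(2) by (auto simp: \<Psi>_def)
    fix x q e assume a: "adm A x q" and e: "d \<le> e"
    obtain C where C: "C \<ge> 0" "\<And>u J. u \<in> {0<..<1} \<Longrightarrow> \<bar>F x u J - (\<Sum>i\<le>d. ln (1 - u) ^ i * \<Phi> i x J)\<bar> \<le> C * errd d u * q ^ J"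
      using d(3)[OF a] by blast
    have q: "0 < q" using a by (auto simp: adm_def)
    have "\<bar>F x u J - (\<Sum>i\<le>e. ln (1 - u) ^ i * \<Psi> i x J)\<bar> \<le> C * errd e u * q ^ J" if "u \<in> {0<..<1}" for u J
    proof -
      have "(\<Sum>i\<le>e. ln (1 - u) ^ i * \<Psi> i x J) = (\<Sum>i\<le>d. ln (1 - u) ^ i * \<Phi> i x J)"
        using e by (intro sum.mono_neutral_cong_right) (auto simp: \<Psi>_def)
      moreover have "C * errd d u * q ^ J \<le> C * errd e u * q ^ J"
        using C q errd_mono[OF e] by (intro mult_right_mono mult_left_mono) auto
      ultimately show ?thesis using C(2)[OF that, of J] by linarith
    qed
    then show "\<exists>C\<ge>0. \<forall>u\<in>{0<..<1}. \<forall>J. \<bar>F x u J - (\<Sum>i\<le>e. ln (1 - u) ^ i * \<Psi> i x J)\<bar> \<le> C * errd e u * q ^ J"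
      using C(1) by blast
  qed
qed

lemma hasexp_cong:
  assumes "hasexp A S0 S F" "\<And>x q u J. adm A x q \<Longrightarrow> 0 < u \<Longrightarrow> u < 1 \<Longrightarrow> F x u J = G x u J"
  shows "hasexp A S0 S G"
proof -
  obtain d \<Phi> where d: "\<Phi> 0 \<in> S0" "\<And>i. \<Phi> i \<in> S" "\<And>x q. adm A x q \<Longrightarrow>
     (\<exists>C\<ge>0. \<forall>u\<in>{0<..<1}. \<forall>J. \<bar>F x u J - (\<Sum>i\<le>d. ln (1 - u) ^ i * \<Phi> i x J)\<bar> \<le> C * errd d u * q ^ J)"
    using assms(1) unfolding hasexp_def by blast
  show ?thesis unfolding hasexp_def
  proof (intro exI[of _ d] exI[of _ \<Phi>] conjI allI impI d(1,2))
    fix x q assume a: "adm A x q"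
    show "\<exists>C\<ge>0. \<forall>u\<in>{0<..<1}. \<forall>J. \<bar>G x u J - (\<Sum>i\<le>d. ln (1 - u) ^ i * \<Phi> i x J)\<bar> \<le> C * errd d u * q ^ J"
      using d(3)[OF a] assms(2)[OF a] by simp
  qed
qed

lemma hasexp_zero: "(\<lambda>x J. 0) \<in> S0 \<Longrightarrow> (\<lambda>x J. 0) \<in> S \<Longrightarrow> hasexp A S0 S (\<lambda>x u J. 0)"
  unfolding hasexp_def by (intro exI[of _ 0] exI[of _ "\<lambda>i x J. 0"]) (auto intro!: exI[of _ 0])

lemma hasexp_lin:
  assumes "hasexp A S0 S F" "hasexp A S0 S G" "(\<lambda>x J. 0) \<in> S"
    "\<And>f g. f \<in> S0 \<Longrightarrow> g \<in> S0 \<Longrightarrow> (\<lambda>x J. c * f x J + g x J) \<in> S0"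
    "\<And>f g. f \<in> S \<Longrightarrow> g \<in> S \<Longrightarrow> (\<lambda>x J. c * f x J + g x J) \<in> S"
  shows "hasexp A S0 S (\<lambda>x u J. c * F x u J + G x u J)"
proof -
  obtain d \<Phi> where 1: "\<Phi> 0 \<in> S0" "\<And>i. \<Phi> i \<in> S"
    "\<And>x q e. adm A x q \<Longrightarrow> d \<le> e \<Longrightarrow> (\<exists>C\<ge>0. \<forall>u\<in>{0<..<1}. \<forall>J. \<bar>F x u J - (\<Sum>i\<le>e. ln (1 - u) ^ i * \<Phi> i x J)\<bar> \<le> C * errd e u * q ^ J)"
    by (rule hasexpE[OF assms(1,3)]) (rule that; assumption)
  obtain d' \<Psi> where 2: "\<Psi> 0 \<in> S0" "\<And>i. \<Psi> i \<in> S"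
    "\<And>x q e. adm A x q \<Longrightarrow> d' \<le> e \<Longrightarrow> (\<exists>C\<ge>0. \<forall>u\<in>{0<..<1}. \<forall>J. \<bar>G x u J - (\<Sum>i\<le>e. ln (1 - u) ^ i * \<Psi> i x J)\<bar> \<le> C * errd e u * q ^ J)"
    by (rule hasexpE[OF assms(2,3)]) (rule that; assumption)
  define e where "e = max d d'"
  show ?thesis unfolding hasexp_def
  proof (intro exI[of _ e] exI[of _ "\<lambda>i x J. c * \<Phi> i x J + \<Psi> i x J"] conjI allI impI)
    fix x q assume a: "adm A x q"
    obtain C where C: "C \<ge> 0" "\<And>u J. u \<in> {0<..<1} \<Longrightarrow> \<bar>F x u J - (\<Sum>i\<le>e. ln (1 - u) ^ i * \<Phi> i x J)\<bar> \<le> C * errd e u * q ^ J"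
      using 1(3)[OF a, of e] max.cobounded1[of d d'] unfolding e_def by blast
    obtain D where D: "D \<ge> 0" "\<And>u J. u \<in> {0<..<1} \<Longrightarrow> \<bar>G x u J - (\<Sum>i\<le>e. ln (1 - u) ^ i * \<Psi> i x J)\<bar> \<le> D * errd e u * q ^ J"
      using 2(3)[OF a, of e] max.cobounded2[of d' d] unfolding e_def by blast
    have "\<bar>c * F x u J + G x u J - (\<Sum>i\<le>e. ln (1 - u) ^ i * (c * \<Phi> i x J + \<Psi> i x J))\<bar> \<le> (\<bar>c\<bar> * C + D) * errd e u * q ^ J"
      if "u \<in> {0<..<1}" for u J
    proof -
      let ?X = "F x u J - (\<Sum>i\<le>e. ln (1 - u) ^ i * \<Phi> i x J)"
      let ?Y = "G x u J - (\<Sum>i\<le>e. ln (1 - u) ^ i * \<Psi> i x J)"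
      have "(\<Sum>i\<le>e. ln (1 - u) ^ i * (c * \<Phi> i x J + \<Psi> i x J)) = c * (\<Sum>i\<le>e. ln (1 - u) ^ i * \<Phi> i x J) + (\<Sum>i\<le>e. ln (1 - u) ^ i * \<Psi> i x J)"
        unfolding sum_distrib_left sum.distrib[symmetric] by (intro sum.cong) (auto simp: algebra_simps)
      then have "c * F x u J + G x u J - (\<Sum>i\<le>e. ln (1 - u) ^ i * (c * \<Phi> i x J + \<Psi> i x J)) = c * ?X + ?Y"
        by (simp only: ring_distribs)
      then have "\<bar>c * F x u J + G x u J - (\<Sum>i\<le>e. ln (1 - u) ^ i * (c * \<Phi> i x J + \<Psi> i x J))\<bar> \<le> \<bar>c\<bar> * \<bar>?X\<bar> + \<bar>?Y\<bar>"
        unfolding abs_mult[symmetric] by (simp only: abs_triangle_ineq)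
      also have "\<dots> \<le> \<bar>c\<bar> * (C * errd e u * q ^ J) + D * errd e u * q ^ J"
        using C(2)[OF that] D(2)[OF that] by (intro add_mono mult_left_mono) auto
      finally show ?thesis by (simp add: algebra_simps)
    qed
    then show "\<exists>C\<ge>0. \<forall>u\<in>{0<..<1}. \<forall>J. \<bar>c * F x u J + G x u J - (\<Sum>i\<le>e. ln (1 - u) ^ i * (c * \<Phi> i x J + \<Psi> i x J))\<bar> \<le> C * errd e u * q ^ J"
      using C(1) D(1) by (intro exI[of _ "\<bar>c\<bar> * C + D"]) auto
  qed (rule assms(4)[OF 1(1) 2(1)], rule assms(5)[OF 1(2) 2(2)])
qed

lemma hasexp_div:
  assumes "hasexp A S0 S F" "\<And>f. f \<in> S0 \<Longrightarrow> (\<lambda>x J. f x J / real J) \<in> S0'" "\<And>f. f \<in> S \<Longrightarrow> (\<lambda>x J. f x J / real J) \<in> S'"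
  shows "hasexp A S0' S' (\<lambda>x u J. F x u J / real J)"
proof -
  obtain d \<Phi> where d: "\<Phi> 0 \<in> S0" "\<And>i. \<Phi> i \<in> S" "\<And>x q. adm A x q \<Longrightarrow>
     (\<exists>C\<ge>0. \<forall>u\<in>{0<..<1}. \<forall>J. \<bar>F x u J - (\<Sum>i\<le>d. ln (1 - u) ^ i * \<Phi> i x J)\<bar> \<le> C * errd d u * q ^ J)"
    using assms(1) unfolding hasexp_def by blast
  show ?thesis unfolding hasexp_def
  proof (intro exI[of _ d] exI[of _ "\<lambda>i x J. \<Phi> i x J / real J"] conjI allI impI)
    fix x q assume a: "adm A x q"
    obtain C where C: "C \<ge> 0" "\<And>u J. u \<in> {0<..<1} \<Longrightarrow> \<bar>F x u J - (\<Sum>i\<le>d. ln (1 - u) ^ i * \<Phi> i x J)\<bar> \<le> C * errd d u * q ^ J"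
      using d(3)[OF a] by blast
    have q: "0 < q" using a by (auto simp: adm_def)
    have "\<bar>F x u J / real J - (\<Sum>i\<le>d. ln (1 - u) ^ i * (\<Phi> i x J / real J))\<bar> \<le> C * errd d u * q ^ J"
      if "u \<in> {0<..<1}" for u J
    proof (cases "J = 0")
      case False
      have "\<bar>F x u J / real J - (\<Sum>i\<le>d. ln (1 - u) ^ i * (\<Phi> i x J / real J))\<bar> = \<bar>F x u J - (\<Sum>i\<le>d. ln (1 - u) ^ i * \<Phi> i x J)\<bar> / real J"
        by (simp add: diff_divide_distrib[symmetric] sum_divide_distrib[symmetric] abs_divide)
      also have "\<dots> \<le> \<bar>F x u J - (\<Sum>i\<le>d. ln (1 - u) ^ i * \<Phi> i x J)\<bar> / 1"
        using False by (intro divide_left_mono) auto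
      finally show ?thesis using C(2)[OF that, of J] by simp
    qed (use C q errd_nonneg in auto)
    then show "\<exists>C\<ge>0. \<forall>u\<in>{0<..<1}. \<forall>J. \<bar>F x u J / real J - (\<Sum>i\<le>d. ln (1 - u) ^ i * (\<Phi> i x J / real J))\<bar> \<le> C * errd d u * q ^ J"
      using C(1) by blast
  qed (use d assms in auto)
qed

lemma conv_sum: "conv y (\<lambda>J. \<Sum>i\<in>I. c i * f i J) n = (\<Sum>i\<in>I. c i * conv y (f i) n)"
  by (induction I rule: infinite_finite_induct) (auto simp: conv_diff conv_scale)

lemma conv_minus: "conv y (\<lambda>J. f J - g J) n = conv y f n - conv y g n"
  using conv_diff[of y f "\<lambda>J. -1 * g J"] conv_scale[of y "-1" g] by simp

text \<open>The first part multiplies by t/(t - x a), the second by t/(t - x a/u) = ut/(ut - x a).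
  Both have the same expansion, because the shift of the pole costs only O(1 - u), and 1 - u times a
  power of the logarithm is absorbed by \<open>errd\<close>.\<close>

lemma hasexp_conv:
  assumes "hasexp A (hspan A K0' K') (hspan A K0 K) F" "a \<in> A" "K' \<subseteq> K"
  shows "hasexp A (cspan A K) (cspan A K) (\<lambda>x u J. conv (x a) (F x u) J)"
    and "hasexp A (cspan A K) (cspan A K) (\<lambda>x u J. conv (x a / u) (F x u) J)"
proof -
  obtain d \<Phi> where d: "\<Phi> 0 \<in> hspan A K0' K'" "\<And>i. \<Phi> i \<in> hspan A K0 K" "\<And>x q. adm A x q \<Longrightarrow>
     (\<exists>C\<ge>0. \<forall>u\<in>{0<..<1}. \<forall>J. \<bar>F x u J - (\<Sum>i\<le>d. ln (1 - u) ^ i * \<Phi> i x J)\<bar> \<le> C * errd d u * q ^ J)"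
    using assms(1) unfolding hasexp_def by blast
  define \<Psi> where "\<Psi> i = (\<lambda>x J. conv (x a) (\<Phi> i x) J)" for i
  have \<Psi>: "\<Psi> i \<in> cspan A K" for i unfolding \<Psi>_def by (rule hspan_conv[OF d(2) assms(2)])
  \<comment> \<open>The values v = 1 and v = u cover the two parts of the lemma.\<close>
  have main: "(\<exists>C\<ge>0. \<forall>u\<in>{0<..<1}. \<forall>v\<in>{1,u}. \<forall>J. \<bar>conv (x a / v) (F x u) J - (\<Sum>i\<le>d. ln (1 - u) ^ i * \<Psi> i x J)\<bar> \<le> C * errd d u * q ^ J)"
    if a: "adm A x q" for x q
  proof -
    obtain C where C: "C \<ge> 0" "\<And>u J. u \<in> {0<..<1} \<Longrightarrow> \<bar>F x u J - (\<Sum>i\<le>d. ln (1 - u) ^ i * \<Phi> i x J)\<bar> \<le> C * errd d u * q ^ J"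
      using d(3)[OF a] by blast
    have "\<forall>i. \<exists>C\<ge>0. \<forall>J. \<bar>\<Phi> i x J\<bar> \<le> C * q ^ J" using hspan_bound[OF d(2) a] by blast
    then obtain B where B: "\<And>i. B i \<ge> 0" "\<And>i J. \<bar>\<Phi> i x J\<bar> \<le> B i * q ^ J" by metis
    have xa: "0 < x a" "1 / x a < q" and q: "0 < q" using a assms(2) by (auto simp: adm_def)
    define p where "p = 1 / x a"
    have p: "0 < p" "p < q" using xa by (auto simp: p_def)
    define E where "E = C * (p / (q - p)) + (\<Sum>i\<le>d. B i * p * q / (q - p)\<^sup>2)"
    have E1: "0 \<le> C * (p / (q - p))" "\<And>i. 0 \<le> B i * p * q / (q - p)\<^sup>2" using C p q B by auto
    have "\<bar>conv (x a / v) (F x u) J - (\<Sum>i\<le>d. ln (1 - u) ^ i * \<Psi> i x J)\<bar> \<le> E * errd d u * q ^ J"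
      if u: "u \<in> {0<..<1}" and v: "v \<in> {1, u}" for u v J
    proof -
      define G where "G J = (\<Sum>i\<le>d. ln (1 - u) ^ i * \<Phi> i x J)" for J
      have vv: "0 < v" "v \<le> 1" "1 - v \<le> 1 - u" using u v by auto
      have "1 / (x a / v) \<le> p" using xa vv by (simp add: p_def divide_right_mono)
      then have 1: "\<bar>conv (x a / v) (\<lambda>J. F x u J - G J) J\<bar> \<le> (C * errd d u) * (p / (q - p)) * q ^ J"
        using C(2)[OF u] xa vv p by (intro conv_bound') (auto simp: G_def)
      have 2: "\<bar>conv (x a / v) (\<Phi> i x) J - conv (x a) (\<Phi> i x) J\<bar> \<le> (1 - v) * (B i * p * q / (q - p)\<^sup>2) * q ^ J" for i
        using B(2) xa vv p by (intro conv_dilate_bound) (auto simp: p_def)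
      have 3: "conv (x a / v) G J - (\<Sum>i\<le>d. ln (1 - u) ^ i * \<Psi> i x J) = (\<Sum>i\<le>d. ln (1 - u) ^ i * (conv (x a / v) (\<Phi> i x) J - conv (x a) (\<Phi> i x) J))"
        unfolding G_def[abs_def] conv_sum \<Psi>_def sum_subtractf[symmetric] right_diff_distrib by simp
      have "\<bar>conv (x a / v) G J - (\<Sum>i\<le>d. ln (1 - u) ^ i * \<Psi> i x J)\<bar> \<le> (\<Sum>i\<le>d. \<bar>ln (1 - u)\<bar> ^ i * ((1 - u) * (B i * p * q / (q - p)\<^sup>2) * q ^ J))"
        unfolding 3
      proof (rule order_trans[OF sum_abs], rule sum_mono, unfold abs_mult power_abs, rule mult_left_mono)
        fix i
        have "(1 - v) * (B i * p * q / (q - p)\<^sup>2) * q ^ J \<le> (1 - u) * (B i * p * q / (q - p)\<^sup>2) * q ^ J"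
          using vv E1(2) q by (intro mult_right_mono) auto
        then show "\<bar>conv (x a / v) (\<Phi> i x) J - conv (x a) (\<Phi> i x) J\<bar> \<le> (1 - u) * (B i * p * q / (q - p)\<^sup>2) * q ^ J"
          using 2[of i] by linarith
      qed auto
      also have "\<dots> \<le> (\<Sum>i\<le>d. errd d u * ((B i * p * q / (q - p)\<^sup>2) * q ^ J))"
      proof (rule sum_mono)
        fix i assume "i \<in> {..d}"
        then have "(1 - u) * \<bar>ln (1 - u)\<bar> ^ i \<le> errd d u" using one_minus_errd[of u i] errd_mono[of i d u] u by auto
        then have "((1 - u) * \<bar>ln (1 - u)\<bar> ^ i) * ((B i * p * q / (q - p)\<^sup>2) * q ^ J) \<le> errd d u * ((B i * p * q / (q - p)\<^sup>2) * q ^ J)"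
          using E1(2) q by (intro mult_right_mono mult_nonneg_nonneg) auto
        then show "\<bar>ln (1 - u)\<bar> ^ i * ((1 - u) * (B i * p * q / (q - p)\<^sup>2) * q ^ J) \<le> errd d u * ((B i * p * q / (q - p)\<^sup>2) * q ^ J)"
          by (simp only: mult_ac)
      qed
      finally have 4: "\<bar>conv (x a / v) G J - (\<Sum>i\<le>d. ln (1 - u) ^ i * \<Psi> i x J)\<bar> \<le> (\<Sum>i\<le>d. B i * p * q / (q - p)\<^sup>2) * errd d u * q ^ J"
        by (simp add: sum_distrib_left sum_distrib_right mult_ac)
      have "conv (x a / v) (F x u) J = conv (x a / v) (\<lambda>J. F x u J - G J) J + conv (x a / v) G J"
        unfolding conv_minus by simp
      then have "\<bar>conv (x a / v) (F x u) J - (\<Sum>i\<le>d. ln (1 - u) ^ i * \<Psi> i x J)\<bar> \<le> (C * errd d u) * (p / (q - p)) * q ^ J + (\<Sum>i\<le>d. B i * p * q / (q - p)\<^sup>2) * errd d u * q ^ J"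
        using 1 4 by linarith
      then show ?thesis by (simp add: E_def algebra_simps)
    qed
    moreover have "E \<ge> 0" unfolding E_def using E1 by (intro add_nonneg_nonneg sum_nonneg) auto
    ultimately show ?thesis by blast
  qed
  show "hasexp A (cspan A K) (cspan A K) (\<lambda>x u J. conv (x a) (F x u) J)" unfolding hasexp_def
  proof (intro exI[of _ d] exI[of _ \<Psi>] conjI allI impI \<Psi>)
    fix x q assume "adm A x q"
    from main[OF this] show "\<exists>C\<ge>0. \<forall>u\<in>{0<..<1}. \<forall>J. \<bar>conv (x a) (F x u) J - (\<Sum>i\<le>d. ln (1 - u) ^ i * \<Psi> i x J)\<bar> \<le> C * errd d u * q ^ J"
      by fastforce
  qed
  show "hasexp A (cspan A K) (cspan A K) (\<lambda>x u J. conv (x a / u) (F x u) J)" unfolding hasexp_def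
  proof (intro exI[of _ d] exI[of _ \<Psi>] conjI allI impI \<Psi>)
    fix x q assume "adm A x q"
    from main[OF this] show "\<exists>C\<ge>0. \<forall>u\<in>{0<..<1}. \<forall>J. \<bar>conv (x a / u) (F x u) J - (\<Sum>i\<le>d. ln (1 - u) ^ i * \<Psi> i x J)\<bar> \<le> C * errd d u * q ^ J"
      by blast
  qed
qed

lemma suminf_swap_geometric:
  fixes f :: "nat \<Rightarrow> nat \<Rightarrow> real"
  assumes f: "\<And>i j. \<bar>f i j\<bar> \<le> C * (a ^ i * b ^ j)" and ab: "0 \<le> a" "a < 1" "0 \<le> b" "b < 1"
  shows "(\<Sum>i. \<Sum>j. f i j) = (\<Sum>j. \<Sum>i. f i j)"
proof -
  have C: "0 \<le> C" using f[of 0 0] by simp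
  have ga: "(\<lambda>i. a ^ i) summable_on UNIV" and gb: "(\<lambda>i. b ^ i) summable_on UNIV"
    using ab by (auto intro!: norm_summable_imp_summable_on simp: summable_geometric)
  have "(\<lambda>(i, j). C * (a ^ i * b ^ j)) summable_on UNIV \<times> UNIV"
  proof (rule summable_on_SigmaI)
    show "((\<lambda>j. case (i, j) of (i, j) \<Rightarrow> C * (a ^ i * b ^ j)) has_sum C * a ^ i * (\<Sum>\<^sub>\<infinity>j. b ^ j)) UNIV" for i
      using has_sum_cmult_right[OF has_sum_infsum[OF gb], of "C * a ^ i"] by (simp add: mult_ac)
    show "(\<lambda>i. C * a ^ i * (\<Sum>\<^sub>\<infinity>j. b ^ j)) summable_on UNIV"
      using ga by (intro summable_on_cmult_left summable_on_cmult_right)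
  qed (use C ab in auto)
  then have "(\<lambda>p. norm (case p of (i, j) \<Rightarrow> f i j)) summable_on UNIV \<times> UNIV"
    by (rule summable_on_comparison_test) (use f in \<open>auto\<close>)
  then have "(\<lambda>(i, j). f i j) summable_on UNIV \<times> UNIV" by (rule abs_summable_summable)
  then have sw: "(\<Sum>\<^sub>\<infinity>i. \<Sum>\<^sub>\<infinity>j. f i j) = (\<Sum>\<^sub>\<infinity>j. \<Sum>\<^sub>\<infinity>i. f i j)" by (rule infsum_swap_banach)
  have isum: "infsum h UNIV = suminf h" if "\<And>n. \<bar>h n\<bar> \<le> D * c ^ n" "0 \<le> c" "c < 1" for h :: "nat \<Rightarrow> real" and D c
  proof -
    have "summable (\<lambda>n. norm (h n))"
      by (rule summable_comparison_test'[where g="\<lambda>n. D * c ^ n"]) (use that in \<open>auto intro!: summable_mult summable_geometric\<close>)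
    then have "(h has_sum suminf h) UNIV" by (rule norm_summable_imp_has_sum) (auto intro: summable_sums summable_norm_cancel \<open>summable (\<lambda>n. norm (h n))\<close>)
    then show ?thesis by (rule infsumI)
  qed
  have bnd: "\<bar>suminf h\<bar> \<le> D / (1 - c)" if "\<And>n. \<bar>h n\<bar> \<le> D * c ^ n" "0 \<le> c" "c < 1" for h :: "nat \<Rightarrow> real" and D c
  proof -
    have s: "summable (\<lambda>n. D * c ^ n)" using that by (auto intro!: summable_mult summable_geometric)
    then have "summable (\<lambda>n. \<bar>h n\<bar>)" by (rule summable_comparison_test'[where N=0]) (use that in auto)
    then have "\<bar>suminf h\<bar> \<le> (\<Sum>n. \<bar>h n\<bar>)" by (rule summable_rabs)
    also have "\<dots> \<le> (\<Sum>n. D * c ^ n)" using that \<open>summable (\<lambda>n. \<bar>h n\<bar>)\<close> s by (intro suminf_le) auto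
    also have "\<dots> = D / (1 - c)" using that by (simp add: suminf_mult suminf_geometric)
    finally show ?thesis .
  qed
  have 1: "(\<Sum>\<^sub>\<infinity>j. f i j) = (\<Sum>j. f i j)" "\<bar>\<Sum>j. f i j\<bar> \<le> (C * a ^ i) / (1 - b)" for i
    using isum[of "f i" "C * a ^ i" b] bnd[of "f i" "C * a ^ i" b] f ab by (auto simp: mult_ac)
  have 2: "(\<Sum>\<^sub>\<infinity>i. f i j) = (\<Sum>i. f i j)" "\<bar>\<Sum>i. f i j\<bar> \<le> (C * b ^ j) / (1 - a)" for j
    using isum[of "\<lambda>i. f i j" "C * b ^ j" a] bnd[of "\<lambda>i. f i j" "C * b ^ j" a] f ab by (auto simp: mult_ac)
  have "(\<Sum>\<^sub>\<infinity>i. \<Sum>j. f i j) = (\<Sum>i. \<Sum>j. f i j)" using 1(2) ab by (intro isum[of _ "C / (1 - b)" a]) auto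
  moreover have "(\<Sum>\<^sub>\<infinity>j. \<Sum>i. f i j) = (\<Sum>j. \<Sum>i. f i j)" using 2(2) ab by (intro isum[of _ "C / (1 - a)" b]) auto
  ultimately show ?thesis using sw 1(1) 2(1) by simp
qed

section \<open>Expansion of the coefficients of t^J at u = 1\<close>

definition gser :: "nat \<Rightarrow> nat list \<Rightarrow> (nat \<Rightarrow> real) \<Rightarrow> real \<Rightarrow> nat \<Rightarrow> real" where
  "gser m w x u J = (\<Sum>N. gam m x w N J * u ^ N)"

lemma uconv_bound: "(\<And>k. \<bar>g k J\<bar> \<le> C) \<Longrightarrow> \<bar>uconv g N J\<bar> \<le> real N * C"
proof (induction N)
  case (Suc N)
  have "\<bar>uconv g (Suc N) J\<bar> \<le> \<bar>uconv g N J\<bar> + \<bar>g N J\<bar>" by simp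
  also have "\<dots> \<le> real N * C + C" using Suc by (intro add_mono) auto
  finally show ?case by (simp add: algebra_simps)
qed simp

lemma dconv_bound:
  assumes "\<And>N J. \<bar>g N J\<bar> \<le> q ^ J" "0 < y" "1 / y \<le> q"
  shows "\<bar>dconv y g N J\<bar> \<le> real N * q ^ J"
proof (induction N arbitrary: J)
  case (Suc N)
  have q: "0 < q" using assms(2,3) by (smt (verit) divide_pos_pos)
  show ?case
  proof (cases J)
    case (Suc K)
    have "\<bar>dconv y g (Suc N) J\<bar> = \<bar>dconv y g N K - g N K\<bar> * (1 / y)" using assms Suc by (simp add: abs_divide)
    also have "\<dots> \<le> (real N * q ^ K + q ^ K) * q"
      using Suc.IH[of K] assms(1)[of N K] assms(2,3) q by (intro mult_mono) auto
    finally show ?thesis using Suc by (simp add: algebra_simps)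
  qed (use q in auto)
qed simp

text \<open>As in \<open>hcoef_bound\<close>, every factor N is cancelled by the division by N. The
  bound does not grow with N, so the series in u converges for u < 1.\<close>

lemma gam_bound:
  assumes "adm A x q" "set w \<subseteq> {0, m} \<union> A"
  shows "\<bar>gam m x w N J\<bar> \<le> q ^ J"
  using assms(2)
proof (induction w arbitrary: N J)
  case Nil then show ?case using assms by (auto simp: adm_def)
next
  case (Cons a w)
  have q: "0 < q" using assms by (auto simp: adm_def)
  have IH: "\<bar>gam m x w N J\<bar> \<le> q ^ J" for N J using Cons by auto
  show ?case
  proof (cases "N = 0")
    case False
    have "\<bar>gam m x w N J\<bar> \<le> 1 * q ^ J" using IH by simp
    also have "\<dots> \<le> real N * q ^ J" using False q by (intro mult_right_mono) (auto simp: Suc_le_eq)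
    finally have 1: "\<bar>gam m x w N J\<bar> \<le> real N * q ^ J" .
    have 2: "\<bar>uconv (gam m x w) N J\<bar> \<le> real N * q ^ J" by (intro uconv_bound IH)
    have 3: "\<bar>dconv (x a) (gam m x w) N J\<bar> \<le> real N * q ^ J" if "a \<noteq> 0" "a \<noteq> m"
      using that Cons.prems assms by (intro dconv_bound IH) (auto simp: adm_def less_imp_le)
    show ?thesis using 1 2 3 False by (auto simp: prefix_def abs_divide field_simps)
  qed (use q in \<open>auto simp: prefix_def\<close>)
qed

lemma gam_sums:
  assumes "adm A x q" "set w \<subseteq> {0, m} \<union> A" "0 \<le> u" "u < 1"
  shows "(\<lambda>N. gam m x w N J * u ^ N) sums gser m w x u J"
  unfolding gser_def using gam_bound[OF assms(1,2)] assms(3,4)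
  by (intro summable_sums summable_bounded[where C="q ^ J" and q=1]) auto

lemma tconv_sums:
  assumes "\<And>J. (\<lambda>N. g N J * u ^ N) sums G J"
  shows "(\<lambda>N. tconv y g N J * u ^ N) sums conv y G J"
proof (induction J)
  case (Suc J)
  have "(\<lambda>N. (1 / y) * (tconv y g N J * u ^ N - g N J * u ^ N)) sums ((1 / y) * (conv y G J - G J))"
    by (intro sums_mult sums_diff Suc assms)
  then show ?case by (simp add: algebra_simps diff_divide_distrib)
qed simp

text \<open>Since ut/(ut - y) = t/(t - y/u), multiplication by this kernel at fixed u acts on the
  powers of t with the letter y/u.\<close>

lemma dconv_sums:
  assumes "\<And>J. (\<lambda>N. g N J * u ^ N) sums G J"
  shows "(\<lambda>N. dconv y g N J * u ^ N) sums conv (y / u) G J"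
proof (induction J)
  case (Suc J)
  have "(\<lambda>N. (u / y) * (dconv y g N J * u ^ N - g N J * u ^ N)) sums ((u / y) * (conv (y / u) G J - G J))"
    by (intro sums_mult sums_diff Suc assms)
  then have "(\<lambda>N. dconv y g (Suc N) (Suc J) * u ^ Suc N) sums conv (y / u) G (Suc J)"
    by (simp add: algebra_simps diff_divide_distrib)
  then show ?case by (subst (asm) sums_Suc_iff) simp
qed simp

text \<open>The kernel ut/(ut - x a) of a letter outside {0, m} is divisible by t.\<close>

lemma gam_J0: "m \<noteq> 0 \<Longrightarrow> set w \<subseteq> {0, m} \<union> A \<Longrightarrow> wvars m w \<noteq> {} \<Longrightarrow> gam m x w N 0 = 0"
proof (induction w arbitrary: N)
  case (Cons a w)
  show ?case
  proof (cases "a = 0 \<or> a = m")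
    case True
    then have "gam m x w N 0 = 0" for N using Cons by (auto simp: wvars_def)
    then have "gam m x w N 0 = 0" "uconv (gam m x w) N 0 = 0" for N by (auto simp: uconv_def)
    then show ?thesis using True by (auto simp: prefix_def)
  qed (auto simp: prefix_def)
qed (auto simp: wvars_def)

text \<open>With only the letters 0 and t the integral up to ut is invariant under scaling, so it is
  the function of u that belongs to the letters 0 and 1.\<close>

lemma gam_novars: 
  assumes "set w \<subseteq> {0, m}" "m \<noteq> 0"
  shows "gam m x w N J = (if J = 0 then hcoef (\<lambda>_. 1) w N else 0)"
  using assms(1)
proof (induction w arbitrary: N)
  case (Cons a w)
  have "gam m x w N J = (if J = 0 then hcoef (\<lambda>_. 1) w N else 0)" for N using Cons by auto
  then show ?case using Cons.prems assms by (auto simp: prefix_def uconv_def)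
qed auto

lemma hspan_mono: "f \<in> hspan A K0 K \<Longrightarrow> K0 \<subseteq> K0' \<Longrightarrow> K \<subseteq> K' \<Longrightarrow> f \<in> hspan A K0' K'"
  by (induction rule: hspan.induct) (auto intro: hspan.intros)

lemma cspan_lin:
  assumes "f \<in> cspan A K" "g \<in> cspan A K" "\<And>k. k \<in> K \<Longrightarrow> c * k \<in> K"
  shows "(\<lambda>x J. c * f x J + g x J) \<in> cspan A K"
  by (intro cspan_plus assms cspan_scale)

lemma hasexp_mono: "hasexp A S0 S F \<Longrightarrow> S0 \<subseteq> S0' \<Longrightarrow> S \<subseteq> S' \<Longrightarrow> hasexp A S0' S' F"
proof -
  assume a: "hasexp A S0 S F" "S0 \<subseteq> S0'" "S \<subseteq> S'"
  obtain d \<Phi> where d: "\<Phi> 0 \<in> S0" "\<And>i. \<Phi> i \<in> S" "\<forall>x q. adm A x q \<longrightarrow>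
     (\<exists>C\<ge>0. \<forall>u\<in>{0<..<1}. \<forall>J. \<bar>F x u J - (\<Sum>i\<le>d. ln (1 - u) ^ i * \<Phi> i x J)\<bar> \<le> C * errd d u * q ^ J)"
    using a(1) unfolding hasexp_def by blast
  show "hasexp A S0' S' F" unfolding hasexp_def
    by (intro exI[of _ d] exI[of _ \<Phi>] conjI d(3)) (use a d in auto)
qed

text \<open>Words that stand alone contain a letter of A, so \<open>IH'\<close> rules out the empty
  word. Words with a factor t/(t - x a) may have any constants, since \<open>cspan\<close> admits
  the empty word below this factor; there \<open>IH\<close> is enough.\<close>

lemma dspan_hasexp:
  assumes "f \<in> dspan m A l" "\<And>(q::int) k. k \<in> K \<Longrightarrow> of_int q * k \<in> K"
    and IH: "\<And>v. ok_word v \<Longrightarrow> set v \<subseteq> {0, m} \<union> A \<Longrightarrow> length v = l \<Longrightarrow> hasexp A (hspan A K K) (hspan A K K) (gser m v)"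
    and IH': "\<And>v. ok_word v \<Longrightarrow> set v \<subseteq> {0, m} \<union> A \<Longrightarrow> length v = l \<Longrightarrow> wvars m v \<noteq> {} \<Longrightarrow> hasexp A (hspan A {0} K) (hspan A {0} K) (gser m v)"
  shows "\<exists>F. hasexp A (cspan A K) (cspan A K) F \<and> (\<forall>x q u J. adm A x q \<longrightarrow> 0 < u \<longrightarrow> u < 1 \<longrightarrow> (\<lambda>N. f x N J * u ^ N) sums F x u J)"
  using assms(1)
proof (induction rule: dspan.induct)
  case zero
  show ?case by (intro exI[of _ "\<lambda>x u J. 0"] conjI hasexp_zero) (auto intro: cspan.intros)
next
  case (gam f v r)
  then obtain F where F: "hasexp A (cspan A K) (cspan A K) F" "\<And>x q u J. adm A x q \<Longrightarrow> 0 < u \<Longrightarrow> u < 1 \<Longrightarrow> (\<lambda>N. f x N J * u ^ N) sums F x u J"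
    by blast
  have "hasexp A (cspan A K) (cspan A K) (gser m v)"
    by (rule hasexp_mono[OF IH']) (use gam in \<open>auto intro: hspan_cspan\<close>)
  then have "hasexp A (cspan A K) (cspan A K) (\<lambda>x u J. of_int r * gser m v x u J + F x u J)"
    using assms(2) F by (intro hasexp_lin cspan_lin cspan.zero) auto
  moreover have "(\<lambda>N. (of_int r * gam m x v N J + f x N J) * u ^ N) sums (of_int r * gser m v x u J + F x u J)"
    if "adm A x q" "0 < u" "u < 1" for x q u J
    unfolding distrib_right mult.assoc using that gam by (intro sums_add sums_mult gam_sums F(2)) auto
  ultimately show ?case by (intro exI[of _ "\<lambda>x u J. of_int r * gser m v x u J + F x u J"]) blast
next
  case (tconv f v a r)
  then obtain F where F: "hasexp A (cspan A K) (cspan A K) F" "\<And>x q u J. adm A x q \<Longrightarrow> 0 < u \<Longrightarrow> u < 1 \<Longrightarrow> (\<lambda>N. f x N J * u ^ N) sums F x u J"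
    by blast
  have "hasexp A (cspan A K) (cspan A K) (\<lambda>x u J. conv (x a) (gser m v x u) J)"
    by (rule hasexp_conv(1)[OF IH]) (use tconv in auto)
  then have "hasexp A (cspan A K) (cspan A K) (\<lambda>x u J. of_int r * conv (x a) (gser m v x u) J + F x u J)"
    using assms(2) F by (intro hasexp_lin cspan_lin cspan.zero) auto
  moreover have "(\<lambda>N. (of_int r * tconv (x a) (gam m x v) N J + f x N J) * u ^ N) sums (of_int r * conv (x a) (gser m v x u) J + F x u J)"
    if "adm A x q" "0 < u" "u < 1" for x q u J
    unfolding distrib_right mult.assoc using that tconv by (intro sums_add sums_mult tconv_sums gam_sums F(2)) auto
  ultimately show ?case by (intro exI[of _ "\<lambda>x u J. of_int r * conv (x a) (gser m v x u) J + F x u J"]) blast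
qed

definition hlog_exp :: "real set \<Rightarrow> real set \<Rightarrow> nat list \<Rightarrow> bool" where
  "hlog_exp K0 K w \<longleftrightarrow> (\<exists>d k. k 0 \<in> K0 \<and> (\<forall>i. k i \<in> K) \<and>
     (\<exists>C\<ge>0. \<forall>u\<in>{0<..<1}. \<bar>hlog (\<lambda>_. 1) w u - (\<Sum>i\<le>d. k i * ln (1 - u) ^ i)\<bar> \<le> C * errd d u))"

text \<open>A word with a letter of A is recovered from its derivative, which consists of shorter
  words. As its term with J = 0 vanishes, division by J determines it, and no empty word appears.
  Words in 0 and m are functions of u and are left to \<open>base\<close>. The empty word, the
  constant 1, is the only one whose constant term may lie outside K0.\<close>

lemma gser_hasexp:
  assumes m: "m \<noteq> 0" "0 \<notin> A" "m \<notin> A" and K: "\<And>(q::int) k. k \<in> K \<Longrightarrow> of_int q * k \<in> K" "0 \<in> K" "1 \<in> K" "K0 \<subseteq> K"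
    and base: "\<And>w. ok_word w \<Longrightarrow> set w \<subseteq> {0, m} \<Longrightarrow> w \<noteq> [] \<Longrightarrow> hlog_exp K0 K w"
    and w: "ok_word w" "set w \<subseteq> {0, m} \<union> A"
  shows "(wvars m w \<noteq> {} \<longrightarrow> hasexp A (hspan A {0} K) (hspan A {0} K) (gser m w)) \<and>
    (wvars m w = {} \<longrightarrow> hasexp A (hspan A (if w = [] then K else K0) K) (hspan A K K) (gser m w))"
  using w
proof (induction "length w" arbitrary: w rule: less_induct)
  case less
  have IH1: "hasexp A (hspan A K K) (hspan A K K) (gser m v)" if "ok_word v" "set v \<subseteq> {0, m} \<union> A" "length v < length w" for v
  proof (cases "wvars m v = {}")
    case True
    then have "hasexp A (hspan A (if v = [] then K else K0) K) (hspan A K K) (gser m v)" using less.hyps[OF that(3,1,2)] by blast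
    then show ?thesis by (rule hasexp_mono) (use K in \<open>auto intro: hspan_mono\<close>)
  next
    case False
    then have "hasexp A (hspan A {0} K) (hspan A {0} K) (gser m v)" using less.hyps[OF that(3,1,2)] by blast
    then show ?thesis by (rule hasexp_mono) (use K in \<open>auto intro: hspan_mono\<close>)
  qed
  have IH2: "hasexp A (hspan A {0} K) (hspan A {0} K) (gser m v)" if "ok_word v" "set v \<subseteq> {0, m} \<union> A" "length v < length w" "wvars m v \<noteq> {}" for v
    using less.hyps[OF that(3,1,2)] that(4) by blast
  show ?case
  proof (intro conjI impI)
    assume wv: "wvars m w \<noteq> {}"
    then obtain a w' where aw: "w = a # w'" by (cases w) (auto simp: wvars_def)
    define f where "f = (\<lambda>x N J. (real J - (if a \<in> A then real N else 0)) * gam m x (a # w') N J)"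
    have "f \<in> dspan m A (length w')" unfolding f_def using less.prems m by (intro gam_derivation) (auto simp: aw)
    then have "\<exists>F. hasexp A (cspan A K) (cspan A K) F \<and> (\<forall>x q u J. adm A x q \<longrightarrow> 0 < u \<longrightarrow> u < 1 \<longrightarrow> (\<lambda>N. f x N J * u ^ N) sums F x u J)"
      by (rule dspan_hasexp) (use K(1) IH1 IH2 aw in auto)
    then obtain F where F: "hasexp A (cspan A K) (cspan A K) F" 
       "\<And>x q u J. adm A x q \<Longrightarrow> 0 < u \<Longrightarrow> u < 1 \<Longrightarrow> (\<lambda>N. f x N J * u ^ N) sums F x u J"
      by blast
    have w': "ok_word w'" "set w' \<subseteq> {0, m} \<union> A" using less.prems by (auto simp: aw ok_word_Cons split: if_splits)
    \<comment> \<open>The contribution of u d/du to the derivation: the factor N removes the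
      outermost integration, and the remaining kernel becomes \<open>conv (x a / u)\<close> by
      \<open>dconv_sums\<close>.\<close>
    define G where "G = (\<lambda>x u J. if a \<in> A then conv (x a / u) (gser m w' x u) J else 0)"
    have G: "hasexp A (cspan A K) (cspan A K) G"
    proof (cases "a \<in> A")
      case True
      have "hasexp A (cspan A K) (cspan A K) (\<lambda>x u J. conv (x a / u) (gser m w' x u) J)"
        by (rule hasexp_conv(2)[OF IH1]) (use w' aw True in auto)
      then show ?thesis using True by (simp add: G_def)
    next
      case False
      then show ?thesis unfolding G_def by (auto intro!: hasexp_zero cspan.zero)
    qed
    have "hasexp A (cspan A K) (cspan A K) (\<lambda>x u J. 1 * F x u J + G x u J)"
      using K(1)[of _ 1] by (intro hasexp_lin cspan_lin F(1) G cspan.zero) auto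
    then have "hasexp A (hspan A {0} K) (hspan A {0} K) (\<lambda>x u J. (1 * F x u J + G x u J) / real J)"
      by (rule hasexp_div) (use m cspan_div in auto)
    then show "hasexp A (hspan A {0} K) (hspan A {0} K) (gser m w)"
    proof (rule hasexp_cong)
      fix x q u J assume a: "adm A x q" "0 < u" "u < (1::real)"
      have gs: "(\<lambda>N. gam m x w N J * u ^ N) sums gser m w x u J" by (rule gam_sums[OF a(1)]) (use a less.prems in auto)
      have "(\<lambda>N. real N * gam m x w N J * u ^ N) sums G x u J" if "a \<in> A"
      proof -
        have "a \<noteq> 0" "a \<noteq> m" using that m by metis+
        then have "real N * gam m x w N J = dconv (x a) (gam m x w') N J" for N
          by (cases "N = 0") (auto simp: aw prefix_def)
        moreover have "(\<lambda>N. dconv (x a) (gam m x w') N J * u ^ N) sums conv (x a / u) (gser m w' x u) J"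
          by (intro dconv_sums gam_sums[OF a(1) w'(2)]) (use a in auto)
        ultimately show ?thesis using that by (simp add: G_def)
      qed
      then have "(\<lambda>N. (if a \<in> A then real N else 0) * gam m x w N J * u ^ N) sums G x u J"
        by (cases "a \<in> A") (auto simp: G_def)
      moreover have "(\<lambda>N. f x N J * u ^ N) sums F x u J" by (rule F(2)[OF a])
      ultimately have "(\<lambda>N. f x N J * u ^ N + (if a \<in> A then real N else 0) * gam m x w N J * u ^ N) sums (F x u J + G x u J)"
        by (rule sums_add[rotated])
      then
      have "(\<lambda>N. real J * (gam m x w N J * u ^ N)) sums (F x u J + G x u J)"
        by (simp add: f_def aw algebra_simps del: gam.simps(2))
      then have "real J * gser m w x u J = F x u J + G x u J" using sums_mult[OF gs, of "real J"] sums_unique2 by blast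
      \<comment> \<open>The one coefficient that division by J cannot recover.\<close>
      moreover have "gser m w x u J = 0" if "J = 0"
        using that gam_J0[OF m(1) less.prems(2) wv] by (simp add: gser_def)
      ultimately show "(1 * F x u J + G x u J) / real J = gser m w x u J" by (cases "J = 0") (auto simp: field_simps)
    qed
  next
    assume wv: "wvars m w = {}"
    then have sw: "set w \<subseteq> {0, m}" by (auto simp: wvars_def)
    have gs: "gser m w x u J = hlog (\<lambda>_. 1) w u * hcoef x [] J" for x u J
      using gam_novars[OF sw m(1)] by (auto simp: gser_def hlog_def)
    have he: "hlog_exp (if w = [] then K else K0) K w"
    proof (cases "w = []")
      case True
      show ?thesis unfolding hlog_exp_def True
        by (intro exI[of _ 0] exI[of _ "\<lambda>i. if i = 0 then 1 else 0"]) (use K in \<open>auto intro!: exI[of _ 0]\<close>)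
    next
      case False
      then show ?thesis using base[OF less.prems(1) sw False] by simp
    qed
    then obtain d k C where k: "k 0 \<in> (if w = [] then K else K0)" "\<And>i. k i \<in> K" "C \<ge> 0"
      "\<And>u. u \<in> {0<..<1} \<Longrightarrow> \<bar>hlog (\<lambda>_. 1) w u - (\<Sum>i\<le>d. k i * ln (1 - u) ^ i)\<bar> \<le> C * errd d u"
      unfolding hlog_exp_def by blast
    have g: "(\<lambda>x J. c * hcoef x [] J) \<in> hspan A K0' K" if "c \<in> K0'" "c \<in> K" for c K0'
      using hspan.add[OF hspan.zero, of c K "[]" K0' A] that by (simp del: hcoef.simps)
    show "hasexp A (hspan A (if w = [] then K else K0) K) (hspan A K K) (gser m w)"
      unfolding hasexp_def
    proof (intro exI[of _ d] exI[of _ "\<lambda>i x J. k i * hcoef x [] J"] conjI allI impI g k(1,2))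
      fix x q assume a: "adm A x q"
      have "\<bar>gser m w x u J - (\<Sum>i\<le>d. ln (1 - u) ^ i * (k i * hcoef x [] J))\<bar> \<le> C * errd d u * q ^ J"
        if "u \<in> {0<..<1}" for u J
      proof (cases "J = 0")
        case True
        then show ?thesis using k(4)[OF that] by (simp add: gs mult.commute)
      next
        case False
        then show ?thesis using k(3) a errd_nonneg[of d u] by (simp add: gs adm_def)
      qed
      then show "\<exists>C\<ge>0. \<forall>u\<in>{0<..<1}. \<forall>J. \<bar>gser m w x u J - (\<Sum>i\<le>d. ln (1 - u) ^ i * (k i * hcoef x [] J))\<bar> \<le> C * errd d u * q ^ J"
        using k(3) by blast
    qed
  qed
qed


section \<open>Back from coefficients to functions\<close>

lemma conv_dilate: "t \<noteq> 0 \<Longrightarrow> conv y f n * t ^ n = conv (y / t) (\<lambda>k. f k * t ^ k) n"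
  by (induction n) (auto simp: algebra_simps diff_divide_distrib)

lemma conv_cong: "(\<And>k. k < n \<Longrightarrow> f k = g k) \<Longrightarrow> conv y f n = conv y g n"
  by (induction n) auto

lemma dconv_vanish: "(\<And>N J. N < J \<Longrightarrow> g N J = 0) \<Longrightarrow> N < J \<Longrightarrow> dconv y g N J = 0"
proof (induction N arbitrary: J)
  case (Suc N) then show ?case by (cases J) auto
qed simp

lemma gam_vanish: "N < J \<Longrightarrow> gam m x w N J = 0"
proof (induction w arbitrary: N J)
  case (Cons a w)
  have "uconv (gam m x w) N J = 0"
    using Cons.prems by (induction N) (auto simp: Cons.IH)
  then show ?case using Cons dconv_vanish[of "gam m x w" N J "x a"] by (auto simp: prefix_def)
qed auto

text \<open>\<open>conv\<close> mixes all indices below N, so the sums over J need a common bound M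
  instead of N. The additional terms with J > N are 0 by \<open>gam_vanish\<close>.\<close>

lemma hcoef_gam:
  assumes "x m = t" "t \<noteq> 0" "N \<le> M"
  shows "hcoef x w N * t ^ N = (\<Sum>J\<le>M. gam m x w N J * t ^ J)"
  using assms(3)
proof (induction w arbitrary: N)
  case Nil
  have "(\<Sum>J\<le>M. gam m x [] N J * t ^ J) = (\<Sum>J\<in>{0}. gam m x [] N J * t ^ J)"
    by (rule sum.mono_neutral_right) auto
  then show ?case by simp
next
  case (Cons a w)
  have cv: "conv y (hcoef x w) N * t ^ N = conv (y / t) (\<lambda>k. \<Sum>J\<le>M. gam m x w k J * t ^ J) N" for y
    unfolding conv_dilate[OF assms(2)] using Cons by (intro conv_cong) auto
  show ?case
  proof (cases "a = 0")
    case True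
    then show ?thesis using Cons by (simp add: prefix_def sum_divide_distrib)
  next
    case False
    have "conv (x a) (hcoef x w) N * t ^ N = (\<Sum>J\<le>M. (if a = m then uconv (gam m x w) N J else dconv (x a) (gam m x w) N J) * t ^ J)"
    proof (cases "a = m")
      case True
      have "conv 1 (\<lambda>k. \<Sum>J\<le>M. t ^ J * gam m x w k J) N = (\<Sum>J\<le>M. t ^ J * conv 1 (\<lambda>k. gam m x w k J) N)"
        by (rule conv_sum)
      then show ?thesis unfolding cv using True assms by (simp add: uconv_def mult.commute)
    next
      case False
      have "conv (x a / t) (\<lambda>k. \<Sum>J\<le>M. gam m x w k J * t ^ J) N = (\<Sum>J\<le>M. dconv (x a) (gam m x w) N J * t ^ J)"
        using Cons.prems
      proof (induction N)
        case (Suc N)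
        then obtain M' where M: "M = Suc M'" by (cases M) auto
        have "conv (x a / t) (\<lambda>k. \<Sum>J\<le>M. gam m x w k J * t ^ J) (Suc N)
           = t / x a * (\<Sum>J\<le>M. (dconv (x a) (gam m x w) N J - gam m x w N J) * t ^ J)"
          using Suc by (simp add: left_diff_distrib sum_subtractf) (simp add: algebra_simps)
        \<comment> \<open>The term J = M vanishes because N < M. This makes room for the shift of J
          by one in the next step.\<close>
        also have "(\<Sum>J\<le>M. (dconv (x a) (gam m x w) N J - gam m x w N J) * t ^ J) = (\<Sum>J\<le>M'. (dconv (x a) (gam m x w) N J - gam m x w N J) * t ^ J)"
          using Suc.prems by (simp add: M gam_vanish dconv_vanish)
        also have "t / x a * \<dots> = (\<Sum>J\<le>M. dconv (x a) (gam m x w) (Suc N) J * t ^ J)"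
          unfolding M sum.atMost_Suc_shift by (simp add: sum_distrib_left mult_ac)
        finally show ?case .
      qed auto
      then show ?thesis unfolding cv using False by simp
    qed
    then show ?thesis using False by (simp add: prefix_def sum_divide_distrib)
  qed
qed

lemma hlog_gser:
  assumes "adm A x q" "set w \<subseteq> {0, m} \<union> A" "x m = t" "0 < t" "q * t < 1" "0 < u" "u < 1"
  shows "hlog x w (u * t) = (\<Sum>J. gser m w x u J * t ^ J)"
proof -
  have q: "0 < q" using assms by (auto simp: adm_def)
  have "hcoef x w N * (u * t) ^ N = (\<Sum>J. gam m x w N J * u ^ N * t ^ J)" for N
  proof -
    have "(\<Sum>J. gam m x w N J * u ^ N * t ^ J) = (\<Sum>J\<le>N. gam m x w N J * u ^ N * t ^ J)"
      by (rule suminf_finite) (auto simp: gam_vanish)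
    also have "\<dots> = u ^ N * (hcoef x w N * t ^ N)" using hcoef_gam[of x m t N N w] assms
      by (simp add: sum_distrib_left mult_ac)
    finally show ?thesis by (simp add: power_mult_distrib mult_ac)
  qed
  then have "hlog x w (u * t) = (\<Sum>N. \<Sum>J. gam m x w N J * u ^ N * t ^ J)" by (simp add: hlog_def)
  also have "\<dots> = (\<Sum>J. \<Sum>N. gam m x w N J * u ^ N * t ^ J)"
  proof (rule suminf_swap_geometric[where C=1 and a=u and b="q * t"])
    show "\<bar>gam m x w i j * u ^ i * t ^ j\<bar> \<le> 1 * (u ^ i * (q * t) ^ j)" for i j
      using mult_right_mono[OF gam_bound[OF assms(1,2), of i j], of "u ^ i * t ^ j"] assms
      by (simp add: abs_mult power_mult_distrib mult_ac)
  qed (use assms q in auto)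
  also have "\<dots> = (\<Sum>J. gser m w x u J * t ^ J)"
  proof -
    have "(\<Sum>N. gam m x w N J * u ^ N * t ^ J) = gser m w x u J * t ^ J" for J
      using gam_sums[OF assms(1,2), of u J] assms by (intro sums_unique[symmetric] sums_mult2) auto
    then show ?thesis by simp
  qed
  finally show ?thesis .
qed

definition cser :: "cseq \<Rightarrow> (nat \<Rightarrow> real) \<Rightarrow> real \<Rightarrow> real" where "cser \<Phi> x t = (\<Sum>J. \<Phi> x J * t ^ J)"

text \<open>The expansions of the coefficients are summed over J. The condition
  \<open>q * x m < 1\<close> makes the errors a convergent geometric series, whose sum is again a
  multiple of \<open>errd d u\<close>.\<close>

lemma hlog_expansion:
  assumes m: "m \<noteq> 0" "0 \<notin> A" "m \<notin> A" and K: "\<And>(q::int) k. k \<in> K \<Longrightarrow> of_int q * k \<in> K" "0 \<in> K" "1 \<in> K" "K0 \<subseteq> K" "0 \<in> K0"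
    and base: "\<And>w. ok_word w \<Longrightarrow> set w \<subseteq> {0, m} \<Longrightarrow> w \<noteq> [] \<Longrightarrow> hlog_exp K0 K w"
    and w: "ok_word w" "set w \<subseteq> {0, m} \<union> A" "w \<noteq> []"
  shows "\<exists>d \<Phi>. \<Phi> 0 \<in> hspan A K0 K \<and> (\<forall>x q. adm A x q \<longrightarrow> 0 < x m \<longrightarrow> q * x m < 1 \<longrightarrow>
     ((\<lambda>u. hlog x w (u * x m) - (\<Sum>i\<le>d. ln (1 - u) ^ i * cser (\<Phi> i) x (x m))) \<longlongrightarrow> 0) (at_left 1))"
proof -
  have "hasexp A (hspan A K0 K) (hspan A K K) (gser m w)"
  proof (cases "wvars m w = {}")
    case True
    then have "hasexp A (hspan A K0 K) (hspan A K K) (gser m w)"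
      using gser_hasexp[OF m K(1-4) base w(1,2)] w(3) by auto
    then show ?thesis .
  next
    case False
    then have "hasexp A (hspan A {0} K) (hspan A {0} K) (gser m w)"
      using gser_hasexp[OF m K(1-4) base w(1,2)] w(3) by auto
    then show ?thesis by (rule hasexp_mono) (use K in \<open>auto intro: hspan_mono\<close>)
  qed
  then obtain d \<Phi> where d: "\<Phi> 0 \<in> hspan A K0 K" "\<And>i. \<Phi> i \<in> hspan A K K" "\<And>x q. adm A x q \<Longrightarrow>
     (\<exists>C\<ge>0. \<forall>u\<in>{0<..<1}. \<forall>J. \<bar>gser m w x u J - (\<Sum>i\<le>d. ln (1 - u) ^ i * \<Phi> i x J)\<bar> \<le> C * errd d u * q ^ J)"
    unfolding hasexp_def by blast
  show ?thesis
  proof (intro exI[of _ d] exI[of _ \<Phi>] conjI allI impI d(1))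
    fix x q assume a: "adm A x q" "0 < x m" "q * x m < 1"
    have q: "0 < q" using a by (auto simp: adm_def)
    let ?t = "x m"
    obtain C where C: "C \<ge> 0" "\<And>u J. u \<in> {0<..<1} \<Longrightarrow> \<bar>gser m w x u J - (\<Sum>i\<le>d. ln (1 - u) ^ i * \<Phi> i x J)\<bar> \<le> C * errd d u * q ^ J"
      using d(3)[OF a(1)] by blast
    have main: "\<bar>hlog x w (u * ?t) - (\<Sum>i\<le>d. ln (1 - u) ^ i * cser (\<Phi> i) x ?t)\<bar> \<le> C / (1 - q * ?t) * errd d u"
      if u: "u \<in> {0<..<1}" for u
    proof -
      have s1: "summable (\<lambda>J. \<Phi> i x J * ?t ^ J)" for i
      proof -
        obtain B where "\<And>J. \<bar>\<Phi> i x J\<bar> \<le> B * q ^ J" using hspan_bound[OF d(2) a(1)] by blast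
        then show ?thesis using a q by (intro summable_bounded[where C=B and q=q]) auto
      qed
      define E where "E J = (gser m w x u J - (\<Sum>i\<le>d. ln (1 - u) ^ i * \<Phi> i x J)) * ?t ^ J" for J
      have E: "\<bar>E J\<bar> \<le> (C * errd d u) * (q * ?t) ^ J" for J
        using mult_right_mono[OF C(2)[OF u, of J], of "?t ^ J"] a by (simp add: E_def abs_mult power_mult_distrib mult_ac)
      have sg: "summable (\<lambda>J. (C * errd d u) * (q * ?t) ^ J)" using a q by (intro summable_mult summable_geometric) auto
      have sE: "summable (\<lambda>J. \<bar>E J\<bar>)" by (rule summable_comparison_test'[OF sg, of 0]) (use E in auto)
      have sE': "summable E" by (rule summable_rabs_cancel[OF sE])
      have sP: "summable (\<lambda>J. \<Sum>i\<le>d. ln (1 - u) ^ i * (\<Phi> i x J * ?t ^ J))" by (intro summable_sum summable_mult s1)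
      have "(\<Sum>J. gser m w x u J * ?t ^ J) = (\<Sum>J. E J + (\<Sum>i\<le>d. ln (1 - u) ^ i * (\<Phi> i x J * ?t ^ J)))"
        by (rule suminf_cong) (simp add: E_def left_diff_distrib sum_distrib_right mult.assoc)
      also have "\<dots> = suminf E + (\<Sum>J. \<Sum>i\<le>d. ln (1 - u) ^ i * (\<Phi> i x J * ?t ^ J))"
        by (rule suminf_add[OF sE' sP, symmetric])
      also have "(\<Sum>J. \<Sum>i\<le>d. ln (1 - u) ^ i * (\<Phi> i x J * ?t ^ J)) = (\<Sum>i\<le>d. ln (1 - u) ^ i * cser (\<Phi> i) x ?t)"
        unfolding cser_def by (subst suminf_sum) (auto intro!: summable_mult s1 simp: suminf_mult[OF s1])
      finally have "hlog x w (u * ?t) - (\<Sum>i\<le>d. ln (1 - u) ^ i * cser (\<Phi> i) x ?t) = suminf E"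
        using hlog_gser[OF a(1) w(2) refl a(2,3)] u by simp
      moreover have "\<bar>suminf E\<bar> \<le> (\<Sum>J. \<bar>E J\<bar>)" by (rule summable_rabs[OF sE])
      moreover have "(\<Sum>J. \<bar>E J\<bar>) \<le> (\<Sum>J. (C * errd d u) * (q * ?t) ^ J)" using E sE sg by (intro suminf_le) auto
      moreover have "(\<Sum>J. (C * errd d u) * (q * ?t) ^ J) = C / (1 - q * ?t) * errd d u"
        using a q by (subst suminf_mult) (auto simp: suminf_geometric summable_geometric)
      ultimately show ?thesis by linarith
    qed
    show "((\<lambda>u. hlog x w (u * ?t) - (\<Sum>i\<le>d. ln (1 - u) ^ i * cser (\<Phi> i) x ?t)) \<longlongrightarrow> 0) (at_left 1)"
    proof (rule Lim_null_comparison)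
      show "\<forall>\<^sub>F u in at_left 1. norm (hlog x w (u * ?t) - (\<Sum>i\<le>d. ln (1 - u) ^ i * cser (\<Phi> i) x ?t)) \<le> C / (1 - q * ?t) * errd d u"
        using main eventually_at_left_real[of 0 1] by (auto elim!: eventually_mono)
      show "((\<lambda>u. C / (1 - q * ?t) * errd d u) \<longlongrightarrow> 0) (at_left 1)"
        using tendsto_mult_left[OF errd_tendsto[of d], of "C / (1 - q * ?t)"] by simp
    qed
  qed
qed


section \<open>Hyperlogarithms in the letters 0 and 1\<close>

abbreviation "hl \<equiv> hlog (\<lambda>_. 1)"

lemma wbnd_1: "wbnd (\<lambda>_. 1) A 1" by (auto simp: wbnd_def)

lemma hl_deriv:
  assumes "0 < s" "s < 1" "ok_word (a # w)"
  shows "(hl (a # w) has_real_derivative hl w s / (s - (if a = 0 then 0 else 1))) (at s)"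
  using assms by (intro hlog_deriv[OF wbnd_1]) auto

lemma hl_cont: "0 \<le> s \<Longrightarrow> s < 1 \<Longrightarrow> isCont (hl w) s"
  by (rule hlog_continuous[OF wbnd_1]) auto

section \<open>Shuffle products\<close>

fun shuf :: "'a list \<Rightarrow> 'a list \<Rightarrow> 'a list list" where
  "shuf [] v = [v]"
| "shuf (a # u) [] = [a # u]"
| "shuf (a # u) (b # v) = map ((#) a) (shuf u (b # v)) @ map ((#) b) (shuf (a # u) v)"

lemma shuf_Nil2 [simp]: "shuf u [] = [u]" by (cases u) auto

lemma shuf_props:
  "ok_word u \<Longrightarrow> ok_word v \<Longrightarrow> z \<in> set (shuf u v) \<Longrightarrow> ok_word z \<and> set z \<subseteq> set u \<union> set v \<and> length z = length u + length v"
proof (induction u v arbitrary: z rule: shuf.induct)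
  case (3 a u b v)
  have "ok_word u" "ok_word v" using "3.prems"(1,2) by (auto simp: ok_word_Cons split: if_splits)
  note ok = this
  consider z' where "z = a # z'" "z' \<in> set (shuf u (b # v))" | z' where "z = b # z'" "z' \<in> set (shuf (a # u) v)"
    using "3.prems"(3) by auto
  then show ?case
  proof cases
    case 1
    have "ok_word z' \<and> set z' \<subseteq> set u \<union> set (b # v) \<and> length z' = length u + length (b # v)"
      by (rule "3.IH"(1)[OF ok(1) "3.prems"(2) 1(2)])
    then show ?thesis using 1(1) by (auto simp: ok_word_Cons)
  next
    case 2
    have "ok_word z' \<and> set z' \<subseteq> set (a # u) \<union> set v \<and> length z' = length (a # u) + length v"
      by (rule "3.IH"(2)[OF "3.prems"(1) ok(2) 2(2)])
    then show ?thesis using 2(1) by (auto simp: ok_word_Cons)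
  qed
qed auto

lemma DERIV_sum_list:
  assumes "\<And>z. z \<in> set zs \<Longrightarrow> (f z has_real_derivative f' z) (at s)"
  shows "((\<lambda>s. \<Sum>z\<leftarrow>zs. f z s) has_real_derivative (\<Sum>z\<leftarrow>zs. f' z)) (at s)"
  using assms by (induction zs) (auto intro!: derivative_eq_intros)

lemma isCont_sum_list:
  fixes f :: "'a \<Rightarrow> real \<Rightarrow> real"
  shows "(\<And>z. z \<in> set zs \<Longrightarrow> isCont (f z) s) \<Longrightarrow> isCont (\<lambda>s. \<Sum>z\<leftarrow>zs. f z s) s"
  by (induction zs) (auto intro!: continuous_intros)

text \<open>A shuffle begins with the first letter of one of the two words, which is the product
  rule for the derivative. For nonempty words both sides vanish at 0, so equal derivatives
  suffice.\<close>

lemma hl_shuffle: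
  assumes "ok_word u" "ok_word v" "0 \<le> s" "s < 1"
  shows "hl u s * hl v s = (\<Sum>z\<leftarrow>shuf u v. hl z s)"
  using assms
proof (induction u v arbitrary: s rule: shuf.induct)
  case (3 a u b v)
  define k where "k c s = 1 / (s - (if c = 0 then 0 else 1))" for c :: nat and s :: real
  define f where "f s = hl (a # u) s * hl (b # v) s - (\<Sum>z\<leftarrow>shuf (a # u) (b # v). hl z s)" for s
  have ok: "ok_word u" "ok_word v" "ok_word (a # u)" "ok_word (b # v)" using "3.prems" by (auto simp: ok_word_Cons split: if_splits)
  have okz: "ok_word (a # z)" if "z \<in> set (shuf u (b # v))" for z
  proof -
    have "ok_word z" "length z = length u + length (b # v)" using shuf_props[OF ok(1,4) that] by auto
    then show ?thesis by (auto simp: ok_word_Cons)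
  qed
  have okz': "ok_word (b # z)" if "z \<in> set (shuf (a # u) v)" for z
  proof -
    have "ok_word z" "length z = length (a # u) + length v" using shuf_props[OF ok(3,2) that] by auto
    then show ?thesis by (auto simp: ok_word_Cons)
  qed
  have D: "(hl (c # w) has_real_derivative k c t * hl w t) (at t)" if "ok_word (c # w)" "0 < t" "t < 1" for c w t
    using hl_deriv[OF that(2,3,1)] by (simp add: k_def)
  have df: "(f has_real_derivative 0) (at t)" if t: "0 < t" "t < 1" for t
  proof -
    have 1: "((\<lambda>s. \<Sum>z\<leftarrow>shuf u (b # v). hl (a # z) s) has_real_derivative (\<Sum>z\<leftarrow>shuf u (b # v). k a t * hl z t)) (at t)"
      using D[OF _ t] okz by (intro DERIV_sum_list) auto
    have 2: "((\<lambda>s. \<Sum>z\<leftarrow>shuf (a # u) v. hl (b # z) s) has_real_derivative (\<Sum>z\<leftarrow>shuf (a # u) v. k b t * hl z t)) (at t)"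
      using D[OF _ t] okz' by (intro DERIV_sum_list) auto
    have e1: "(\<Sum>z\<leftarrow>shuf u (b # v). k a t * hl z t) = k a t * (hl u t * hl (b # v) t)"
      using "3.IH"(1)[OF ok(1,4), of t] t by (simp add: sum_list_const_mult)
    have e2: "(\<Sum>z\<leftarrow>shuf (a # u) v. k b t * hl z t) = k b t * (hl (a # u) t * hl v t)"
      using "3.IH"(2)[OF ok(3,2), of t] t by (simp add: sum_list_const_mult)
    have "(f has_real_derivative ((k a t * hl u t) * hl (b # v) t + (k b t * hl v t) * hl (a # u) t)
        - ((\<Sum>z\<leftarrow>shuf u (b # v). k a t * hl z t) + (\<Sum>z\<leftarrow>shuf (a # u) v. k b t * hl z t))) (at t)"
      unfolding f_def shuf.simps map_append map_map o_def sum_list_append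
      by (intro DERIV_diff DERIV_mult D ok t DERIV_add 1 2)
    then show ?thesis unfolding e1 e2 by (simp add: algebra_simps)
  qed
  have f0: "f 0 = 0"
  proof -
    have "(\<Sum>z\<leftarrow>shuf (a # u) (b # v). hl z 0) = 0" by (simp add: hlog_at_0 o_def)
    then show ?thesis unfolding f_def by (simp add: hlog_at_0)
  qed
  have "f s = 0"
  proof (cases "s = 0")
    case False
    have ct: "isCont f t" if "0 \<le> t" "t < 1" for t
      unfolding f_def by (intro continuous_intros isCont_sum_list hl_cont that)
    have "f s = f 0"
    proof (rule DERIV_isconst_end[of 0 s f])
      show "continuous_on {0..s} f" using ct "3.prems" by (auto intro!: continuous_at_imp_continuous_on)
    qed (use df False "3.prems" in auto)
    then show ?thesis using f0 by simp
  qed (use f0 in auto)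
  then show ?case by (simp add: f_def)
qed auto

lemma hl_single:
  assumes "m \<noteq> 0" "0 \<le> s" "s < 1"
  shows "hl [m] s = ln (1 - s)"
proof (cases "s = 0")
  case False
  have "hl [m] s - ln (1 - s) = hl [m] 0 - ln (1 - 0)"
  proof (rule DERIV_isconst_end[of 0 s "\<lambda>s. hl [m] s - ln (1 - s)"])
    show "continuous_on {0..s} (\<lambda>s. hl [m] s - ln (1 - s))"
      using hl_cont assms by (intro continuous_intros continuous_at_imp_continuous_on) (auto intro: continuous_at_imp_continuous_on)
    fix t assume t: "0 < t" "t < s"
    have "((\<lambda>s. hl [m] s - ln (1 - s)) has_real_derivative hl [] t / (t - 1) - (- 1) / (1 - t)) (at t)"
      using t assms hl_deriv[of t m "[]"] by (auto intro!: derivative_eq_intros simp: ok_word_Cons)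
    moreover have "hl [] t / (t - 1) - (- 1) / (1 - t) = 0" using t assms by (simp add: divide_simps)
    ultimately show "((\<lambda>s. hl [m] s - ln (1 - s)) has_real_derivative 0) (at t)" by simp
  qed (use assms False in auto)
  then show ?thesis by (simp add: hlog_at_0)
qed (simp add: hlog_at_0)

text \<open>Inserting m anywhere into the leading block produces one and the same word, j + 1 times;
  every other insertion takes place behind b.\<close>

lemma shuf_single:
  fixes F :: "'a list \<Rightarrow> real"
  shows "(\<Sum>z\<leftarrow>shuf [m] (replicate j m @ b # v). F z) = real (Suc j) * F (replicate (Suc j) m @ b # v) + (\<Sum>z\<leftarrow>shuf [m] v. F (replicate j m @ b # z))"
proof (induction j arbitrary: F)
  case 0 show ?case by (simp add: o_def)
next
  case (Suc j)
  show ?case using Suc[of "\<lambda>z. F (m # z)"] by (simp add: o_def algebra_simps)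
qed

lemma shuf_single': "(\<Sum>z\<leftarrow>shuf [m] (replicate j m). F z) = real (Suc j) * F (replicate (Suc j) m)"
proof (induction j arbitrary: F)
  case (Suc j)
  show ?case using Suc[of "\<lambda>z. F (m # z)"] by (simp add: o_def algebra_simps)
qed simp

section \<open>Size of the coefficients and values at 1\<close>

lemma sum_inverse_sqrt: "(\<Sum>k\<le>N. 1 / sqrt (real k)) \<le> 2 * sqrt (real N)"
proof (induction N)
  case (Suc N)
  have "1 / sqrt (real (Suc N)) \<le> 2 * (sqrt (real (Suc N)) - sqrt (real N))"
  proof -
    have "2 * sqrt (real (Suc N)) * sqrt (real N) \<le> (real (Suc N)) + real N"
      using sum_squares_bound[of "sqrt (real (Suc N))" "sqrt (real N)"] by simp
    then have "1 \<le> 2 * (sqrt (real (Suc N)) - sqrt (real N)) * sqrt (real (Suc N))"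
      by (simp add: algebra_simps)
    then show ?thesis by (simp add: field_simps)
  qed
  then show ?case using Suc by simp
qed simp

lemma conv_1: "conv 1 f n = - (\<Sum>k<n. f k)" by (induction n) auto

text \<open>The coefficients are at most a power of log N divided by N. The weaker order 1/sqrt N
  absorbs the logarithms and reproduces itself under summation over k < N followed by division by N.
  For N = 0 both sides are 0.\<close>

lemma hcoef_1_bound:
  assumes "ok_word w" "w \<noteq> []"
  shows "\<exists>C\<ge>0. \<forall>N. \<bar>hcoef (\<lambda>_. 1) w N\<bar> \<le> C / sqrt (real N)"
  using assms
proof (induction w)
  case (Cons a w)
  show ?case
  proof (cases "w = []")
    case True
    then have a: "a \<noteq> 0" using Cons by (auto simp: ok_word_Cons)
    have "\<bar>hcoef (\<lambda>_. 1) (a # w) N\<bar> \<le> 1 / sqrt (real N)" for N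
    proof (cases "N = 0")
      case False
      then have "(\<Sum>k<N. if k = 0 then 1 else 0::real) = 1" by simp
      then have "\<bar>hcoef (\<lambda>_. 1) (a # w) N\<bar> = 1 / real N" using True a by (simp add: conv_1)
      moreover have "sqrt (real N) \<le> real N" using False by (intro real_le_lsqrt) (auto simp: power2_eq_square)
      ultimately show ?thesis using False by (simp add: frac_le)
    qed auto
    then show ?thesis by (intro exI[of _ 1]) auto
  next
    case False
    then obtain C where C: "C \<ge> 0" "\<And>N. \<bar>hcoef (\<lambda>_. 1) w N\<bar> \<le> C / sqrt (real N)" using Cons by (auto simp: ok_word_Cons)
    have "\<bar>hcoef (\<lambda>_. 1) (a # w) N\<bar> \<le> 2 * C / sqrt (real N)" for N
    proof (cases "N = 0")
      case N: False
      have s: "sqrt (real N) * sqrt (real N) = real N" by simp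
      show ?thesis
      proof (cases "a = 0")
        case True
        then have "\<bar>hcoef (\<lambda>_. 1) (a # w) N\<bar> = \<bar>hcoef (\<lambda>_. 1) w N\<bar> / real N" by (simp add: abs_divide)
        also have "\<dots> \<le> \<bar>hcoef (\<lambda>_. 1) w N\<bar> / 1" using N by (intro divide_left_mono) auto
        also have "\<dots> \<le> 2 * C / sqrt (real N)" using C(1) C(2)[of N] by (simp add: divide_simps split: if_splits)
        finally show ?thesis .
      next
        case a: False
        have "\<bar>\<Sum>k<N. hcoef (\<lambda>_. 1) w k\<bar> \<le> (\<Sum>k<N. C * (1 / sqrt (real k)))"
          using C(2) by (intro order_trans[OF sum_abs] sum_mono) auto
        also have "\<dots> \<le> C * (\<Sum>k\<le>N. 1 / sqrt (real k))"
          unfolding sum_distrib_left[symmetric] using C(1) by (intro mult_left_mono sum_mono2) auto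
        also have "\<dots> \<le> C * (2 * sqrt (real N))" using C(1) by (intro mult_left_mono sum_inverse_sqrt)
        finally have "\<bar>hcoef (\<lambda>_. 1) (a # w) N\<bar> \<le> C * (2 * sqrt (real N)) / real N"
          using a N by (simp add: conv_1 abs_divide divide_right_mono)
        also have "\<dots> = 2 * C / sqrt (real N)" using N s by (simp add: divide_simps mult.assoc)
        finally show ?thesis .
      qed
    qed auto
    then show ?thesis using C(1) by (intro exI[of _ "2 * C"]) auto
  qed
qed auto

text \<open>The words in 0 and 1 whose iterated integral converges at 0 and at 1.\<close>

definition zword :: "nat list \<Rightarrow> bool" where "zword w \<longleftrightarrow> ok_word w \<and> w \<noteq> [] \<and> hd w = 0"

definition zval :: "nat list \<Rightarrow> real" where "zval w = (\<Sum>N. hcoef (\<lambda>_. 1) w N)"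

lemma zword_bound:
  assumes "zword w"
  shows "\<exists>C\<ge>0. \<forall>N. \<bar>hcoef (\<lambda>_. 1) w N\<bar> \<le> C * real N powr (-3/2)"
proof -
  obtain v where w: "w = 0 # v" using assms by (cases w) (auto simp: zword_def)
  then have "v \<noteq> []" "ok_word v" using assms by (auto simp: zword_def ok_word_Cons split: if_splits)
  then obtain C where C: "C \<ge> 0" "\<And>N. \<bar>hcoef (\<lambda>_. 1) v N\<bar> \<le> C / sqrt (real N)" using hcoef_1_bound by blast
  have "\<bar>hcoef (\<lambda>_. 1) w N\<bar> \<le> C * real N powr (-3/2)" for N
  proof (cases "N = 0")
    case False
    have "\<bar>hcoef (\<lambda>_. 1) w N\<bar> \<le> C / sqrt (real N) / real N"
      using divide_right_mono[OF C(2)[of N], of "real N"] by (simp add: w abs_divide)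
    also have "\<dots> = C * (real N powr (-1/2) * real N powr (-1))"
      using False by (simp add: powr_half_sqrt[symmetric] powr_minus divide_simps)
    also have "real N powr (-1/2) * real N powr (-1) = real N powr (-3/2)" unfolding powr_add[symmetric] by simp
    finally show ?thesis .
  qed (simp add: w)
  then show ?thesis using C by blast
qed

lemma zword_summable:
  assumes "zword w" shows "summable (\<lambda>N. \<bar>hcoef (\<lambda>_. 1) w N\<bar>)"
proof -
  obtain C where C: "\<And>N. \<bar>hcoef (\<lambda>_. 1) w N\<bar> \<le> C * real N powr (-3/2)" using zword_bound[OF assms] by blast
  have "summable (\<lambda>N. C * real N powr (-3/2))" by (intro summable_mult) (simp add: summable_real_powr_iff)
  then show ?thesis by (rule summable_comparison_test'[where N=0]) (use C in auto)
qed

text \<open>Bernoulli's inequality and 0 <= 1 - u^N <= 1 give 1 - u^N <= (N (1 - u))^(1/4). The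
  factor N^(1/4) turns the decay N^(-3/2) into N^(-5/4), which is still summable.\<close>

lemma zword_rate:
  assumes "zword w"
  shows "\<exists>C\<ge>0. \<forall>u\<in>{0<..<1}. \<bar>hl w u - zval w\<bar> \<le> C * (1 - u) powr (1/4)"
proof -
  obtain C where C: "C \<ge> 0" "\<And>N. \<bar>hcoef (\<lambda>_. 1) w N\<bar> \<le> C * real N powr (-3/2)" using zword_bound[OF assms] by blast
  have sp: "summable (\<lambda>N. C * real N powr (-5/4))" by (intro summable_mult) (simp add: summable_real_powr_iff)
  define D where "D = (\<Sum>N. C * real N powr (-5/4))"
  have "\<bar>hl w u - zval w\<bar> \<le> D * (1 - u) powr (1/4)" if u: "u \<in> {0<..<1}" for u
  proof -
    have s1: "summable (\<lambda>N. hcoef (\<lambda>_. 1) w N * u ^ N)" using u by (intro hlog_summable[OF wbnd_1]) auto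
    have s2: "summable (\<lambda>N. hcoef (\<lambda>_. 1) w N)" by (rule summable_rabs_cancel[OF zword_summable[OF assms]])
    have b: "norm (hcoef (\<lambda>_. 1) w N * u ^ N - hcoef (\<lambda>_. 1) w N) \<le> C * real N powr (-5/4) * (1 - u) powr (1/4)" for N
    proof (cases "N = 0")
      case False
      have un: "0 \<le> 1 - u ^ N" "1 - u ^ N \<le> 1" using u by (auto simp: power_le_one)
      have bern: "1 - u ^ N \<le> real N * (1 - u)" using Bernoulli_inequality[of "u - 1" N] u by (simp add: algebra_simps)
      have "1 - u ^ N = (1 - u ^ N) powr 1" using un by simp
      also have "\<dots> \<le> (1 - u ^ N) powr (1/4)" using un by (intro powr_mono') auto
      also have "\<dots> \<le> (real N * (1 - u)) powr (1/4)" using un bern by (intro powr_mono2) auto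
      also have "\<dots> = real N powr (1/4) * (1 - u) powr (1/4)" by (simp add: powr_mult)
      finally have p: "1 - u ^ N \<le> real N powr (1/4) * (1 - u) powr (1/4)" .
      have "norm (hcoef (\<lambda>_. 1) w N * u ^ N - hcoef (\<lambda>_. 1) w N) = \<bar>hcoef (\<lambda>_. 1) w N\<bar> * (1 - u ^ N)"
      proof -
        have "hcoef (\<lambda>_. 1) w N * u ^ N - hcoef (\<lambda>_. 1) w N = - (hcoef (\<lambda>_. 1) w N * (1 - u ^ N))" by (simp add: algebra_simps)
        then show ?thesis using un by (simp add: abs_mult)
      qed
      also have "\<dots> \<le> C * real N powr (-3/2) * (real N powr (1/4) * (1 - u) powr (1/4))"
        using C p un by (intro mult_mono) auto
      also have "\<dots> = C * (real N powr (-3/2) * real N powr (1/4)) * (1 - u) powr (1/4)" by simp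
      also have "real N powr (-3/2) * real N powr (1/4) = real N powr (-5/4)" unfolding powr_add[symmetric] by simp
      finally show ?thesis .
    qed simp
    have sp': "summable (\<lambda>N. C * real N powr (-5/4) * (1 - u) powr (1/4))" by (rule summable_mult2[OF sp])
    have "hl w u - zval w = (\<Sum>N. hcoef (\<lambda>_. 1) w N * u ^ N - hcoef (\<lambda>_. 1) w N)"
      unfolding hlog_def zval_def by (rule suminf_diff[OF s1 s2])
    also have "norm \<dots> \<le> (\<Sum>N. C * real N powr (-5/4) * (1 - u) powr (1/4))" by (rule norm_suminf_le[OF b sp'])
    also have "\<dots> = D * (1 - u) powr (1/4)" unfolding D_def by (rule suminf_mult2[OF sp, symmetric])
    finally show ?thesis by simp
  qed
  moreover have "D \<ge> 0" unfolding D_def using C by (intro suminf_nonneg sp) auto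
  ultimately show ?thesis by blast
qed

lemma zword_tendsto: 
  assumes "zword w" shows "(hl w \<longlongrightarrow> zval w) (at_left 1)"
proof -
  obtain C where C: "\<And>u. u \<in> {0<..<1} \<Longrightarrow> \<bar>hl w u - zval w\<bar> \<le> C * (1 - u) powr (1/4)" using zword_rate[OF assms] by blast
  have "((\<lambda>u. hl w u - zval w) \<longlongrightarrow> 0) (at_left 1)"
  proof (rule Lim_null_comparison)
    show "\<forall>\<^sub>F u in at_left 1. norm (hl w u - zval w) \<le> C * (1 - u) powr (1/4)"
      using C eventually_at_left_real[of 0 1] by (auto elim!: eventually_mono)
    show "((\<lambda>u. C * (1 - u) powr (1/4)) \<longlongrightarrow> 0) (at_left 1)" by real_asymp
  qed
  then show ?thesis by (simp add: LIM_zero_iff)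
qed


section \<open>Multizeta values\<close>

text \<open>An exponent n becomes n - 1 letters 0 followed by one letter 1. As words begin with the
  outermost integration, the exponents run from the largest summation index to the smallest, the
  reverse of the order in \<open>mzv\<close>.\<close>

fun wd :: "nat list \<Rightarrow> nat list" where
  "wd [] = []"
| "wd (n # ns) = replicate (n - 1) 0 @ 1 # wd ns"

lemma wd_ok: "ok_word (wd ns)" 
  by (induction ns) (auto simp: ok_word_def)

lemma wd_zword: "2 \<le> n \<Longrightarrow> zword (wd (n # ns))"
  using wd_ok[of "n # ns"] by (cases "n - 1") (auto simp: zword_def)

text \<open>With every nonzero letter placed at 1 its label is irrelevant, so the coefficients agree
  although the words need not.\<close>

lemma wd_cover:
  assumes "ok_word w"
  shows "\<exists>ns. (\<forall>n\<in>set ns. 1 \<le> n) \<and> hcoef (\<lambda>_. 1) w = hcoef (\<lambda>_. 1) (wd ns) \<and>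
    (w \<noteq> [] \<longrightarrow> ns \<noteq> [] \<and> (hd w = 0 \<longrightarrow> 2 \<le> hd ns))"
  using assms
proof (induction w)
  case (Cons a w)
  then have "ok_word w" by (auto simp: ok_word_Cons split: if_splits)
  from Cons.IH[OF this] obtain ns where ns: "\<forall>n\<in>set ns. 1 \<le> n" "hcoef (\<lambda>_. 1) w = hcoef (\<lambda>_. 1) (wd ns)" "w \<noteq> [] \<Longrightarrow> ns \<noteq> []"
    by blast
  show ?case
  proof (cases "a = 0")
    case True
    then have "w \<noteq> []" using Cons by (auto simp: ok_word_Cons)
    then obtain n ns' where n: "ns = n # ns'" using ns by (cases ns) auto
    then obtain k where "n = Suc k" using ns by (cases n) auto
    then have "wd (Suc n # ns') = 0 # wd ns" by (simp add: n)
    then show ?thesis using ns True n by (intro exI[of _ "Suc n # ns'"]) (auto simp: fun_eq_iff)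
  next
    case False
    then show ?thesis using ns by (intro exI[of _ "1 # ns"]) (auto simp: fun_eq_iff[of "hcoef _ (_ # _)"])
  qed
qed (auto intro: exI[of _ "[]"])

fun zterm :: "nat list \<Rightarrow> nat list \<Rightarrow> real" where
  "zterm (n # ns) (k # ks) = 1 / real k ^ n * zterm ns ks"
| "zterm _ _ = 1"

definition dec_lists :: "nat \<Rightarrow> nat list set" where
  "dec_lists r = {ks. length ks = r \<and> sorted_wrt (>) ks \<and> (\<forall>k\<in>set ks. 0 < k)}"

definition dec_below :: "nat \<Rightarrow> nat \<Rightarrow> nat list set" where
  "dec_below r N = {ks \<in> dec_lists r. \<forall>k\<in>set ks. k < N}"

lemma finite_dec_below: "finite (dec_below r N)"
  by (rule finite_subset[OF _ finite_lists_length_eq[of "{..<N}" r]]) (auto simp: dec_below_def dec_lists_def)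

lemma dec_lists_Suc: "dec_lists (Suc r) = (\<lambda>(N, ks). N # ks) ` (SIGMA N:{1..}. dec_below r N)"
  by (auto simp: dec_lists_def dec_below_def length_Suc_conv image_iff Suc_le_eq)

lemma dec_below_Suc: "dec_below (Suc r) M = (\<lambda>(N, ks). N # ks) ` (SIGMA N:{1..<M}. dec_below r N)"
  by (fastforce simp: dec_lists_def dec_below_def length_Suc_conv image_iff Suc_le_eq)

definition zsum :: "nat list \<Rightarrow> nat \<Rightarrow> real" where
  "zsum ns N = (\<Sum>ks\<in>dec_below (length ns) N. zterm ns ks)"

lemma zsum_Nil: "zsum [] N = 1"
proof -
  have "dec_below 0 N = {[]}" by (auto simp: dec_below_def dec_lists_def)
  then show ?thesis by (simp add: zsum_def)
qed

lemma zsum_Cons: "zsum (n # ns) M = (\<Sum>N\<in>{1..<M}. 1 / real N ^ n * zsum ns N)"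
proof -
  have "zsum (n # ns) M = (\<Sum>(N, ks)\<in>(SIGMA N:{1..<M}. dec_below (length ns) N). zterm (n # ns) (N # ks))"
    unfolding zsum_def length_Cons dec_below_Suc
    by (subst sum.reindex) (auto simp: inj_on_def case_prod_unfold)
  also have "\<dots> = (\<Sum>N\<in>{1..<M}. \<Sum>ks\<in>dec_below (length ns) N. zterm (n # ns) (N # ks))"
    by (rule sum.Sigma[symmetric]) (auto simp: finite_dec_below)
  finally show ?thesis by (simp add: zsum_def sum_distrib_left)
qed

lemma hcoef_zeros: "N > 0 \<Longrightarrow> hcoef x (replicate j 0 @ w) N = hcoef x w N / real N ^ j"
  by (induction j) auto

text \<open>Multiplication by s/(s - 1) is minus summation over strictly smaller indices. This is
  the source of the signs and of the strict inequalities between the summation indices.\<close>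

lemma hcoef_wd_Cons:
  assumes "\<And>N. (\<Sum>k<Suc N. hcoef (\<lambda>_. 1) (wd ns) k) = (- 1) ^ length ns * zsum ns (Suc N)" "1 \<le> n" "0 < M"
  shows "hcoef (\<lambda>_. 1) (wd (n # ns)) M = (- 1) ^ Suc (length ns) * (1 / real M ^ n * zsum ns M)"
proof -
  obtain M' where M: "M = Suc M'" using assms(3) by (cases M) auto
  have "hcoef (\<lambda>_. 1) (wd (n # ns)) M = - (\<Sum>k<M. hcoef (\<lambda>_. 1) (wd ns) k) / real M / real M ^ (n - 1)"
    using assms(3) by (simp add: hcoef_zeros conv_1)
  also have "\<dots> = - ((- 1) ^ length ns * zsum ns M) / (real M * real M ^ (n - 1))"
    unfolding M assms(1) by simp
  also have "real M * real M ^ (n - 1) = real M ^ n" using assms(2) by (simp add: power_eq_if)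
  finally show ?thesis by simp
qed

text \<open>Partial sums are compared instead of coefficients because the empty word, concentrated
  at k = 0, then fits in. The bound \<open>Suc N\<close> excludes the empty range, for which the
  claim would fail when \<open>ns = []\<close>.\<close>

lemma hcoef_wd_sum:
  assumes "\<forall>n\<in>set ns. 1 \<le> n"
  shows "(\<Sum>k<Suc N. hcoef (\<lambda>_. 1) (wd ns) k) = (- 1) ^ length ns * zsum ns (Suc N)"
  using assms
proof (induction ns arbitrary: N)
  case Nil
  show ?case by (simp add: zsum_Nil sum.lessThan_Suc_shift del: sum.lessThan_Suc)
next
  case (Cons l ns)
  have c: "hcoef (\<lambda>_. 1) (wd (l # ns)) k = (- 1) ^ Suc (length ns) * (1 / real k ^ l * zsum ns k)" if "0 < k" for k
    using Cons.prems by (intro hcoef_wd_Cons Cons.IH that) auto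
  have ne: "wd (l # ns) \<noteq> []" by simp
  have "(\<Sum>k<Suc N. hcoef (\<lambda>_. 1) (wd (l # ns)) k) = (\<Sum>k\<in>{1..<Suc N}. hcoef (\<lambda>_. 1) (wd (l # ns)) k)"
    by (rule sum.mono_neutral_right) (auto simp: hcoef_0[OF ne] not_less_eq_eq[symmetric] Suc_le_eq simp del: wd.simps)
  also have "\<dots> = (\<Sum>k\<in>{1..<Suc N}. (- 1) ^ Suc (length ns) * (1 / real k ^ l * zsum ns k))"
    by (intro sum.cong refl c) auto
  finally show ?case by (simp only: zsum_Cons sum_distrib_left length_Cons)
qed

lemma zterm_nonneg: "0 \<le> zterm ns ks"
  by (induction ns ks rule: zterm.induct) auto

lemma zterm_eq: "length ks = length ns \<Longrightarrow> zterm ns ks = 1 / (\<Prod>i<length ns. real (ks ! i) ^ (ns ! i))"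
  by (induction ns ks rule: list_induct2') (auto simp: prod.lessThan_Suc_shift simp del: prod.lessThan_Suc)

lemma mzv_zval:
  assumes "\<forall>m\<in>set ns. 1 \<le> m" "2 \<le> n"
  shows "zval (wd (n # ns)) = (- 1) ^ Suc (length ns) * mzv (rev (n # ns))"
proof -
  define r where "r = length ns"
  define c where "c N = 1 / real N ^ n * zsum ns N" for N
  have hc: "hcoef (\<lambda>_. 1) (wd (n # ns)) N = (- 1) ^ Suc (length ns) * (if N = 0 then 0 else c N)" for N
    using hcoef_wd_Cons[OF hcoef_wd_sum[OF assms(1)], of n N] assms by (cases "N = 0") (auto simp: hcoef_0 c_def)
  have c0: "0 \<le> c N" for N unfolding c_def zsum_def by (intro mult_nonneg_nonneg sum_nonneg zterm_nonneg) auto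
  have "\<bar>hcoef (\<lambda>_. 1) (wd (n # ns)) N\<bar> = (if N = 0 then 0 else c N)" for N
    unfolding hc abs_mult power_abs using c0 by simp
  then have sm: "summable (\<lambda>N. if N = 0 then 0 else c N)"
    using zword_summable[OF wd_zword[OF assms(2)], of ns] by simp
  define S where "S = (\<Sum>N. if N = 0 then 0 else c N)"
  have zv: "zval (wd (n # ns)) = (- 1) ^ Suc (length ns) * S"
    unfolding zval_def hc S_def by (rule suminf_mult[OF sm])
  have "((\<lambda>N. if N = 0 then 0 else c N) has_sum S) UNIV"
    using sm c0 by (intro sums_nonneg_imp_has_sum) (auto simp: S_def summable_sums)
  moreover have "((\<lambda>N. if N = 0 then 0 else c N) has_sum S) UNIV \<longleftrightarrow> (c has_sum S) {1..}"
    by (rule has_sum_cong_neutral) auto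
  ultimately have cs: "(c has_sum S) {1..}" by simp
  have inner: "((\<lambda>ks. zterm (n # ns) (N # ks)) has_sum c N) (dec_below r N)" for N
    using has_sum_finite[OF finite_dec_below, of "\<lambda>ks. zterm (n # ns) (N # ks)" r N]
    by (simp add: c_def zsum_def r_def sum_distrib_left)
  \<comment> \<open>All terms are nonnegative, so the iterated sum is also the sum over the set of
    index lists.\<close>
  have "((\<lambda>(N, ks). zterm (n # ns) (N # ks)) has_sum S) (SIGMA N:{1..}. dec_below r N)"
  proof (rule has_sum_SigmaI)
    show "(\<lambda>(N, ks). zterm (n # ns) (N # ks)) summable_on (SIGMA N:{1..}. dec_below r N)"
      by (rule summable_on_SigmaI[where g=c]) (use inner cs zterm_nonneg in \<open>auto simp: has_sum_imp_summable\<close>)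
  qed (use inner cs in auto)
  then have "(zterm (n # ns) has_sum S) (dec_lists (Suc r))"
    unfolding dec_lists_Suc by (subst has_sum_reindex) (auto simp: inj_on_def o_def case_prod_unfold)
  then have hs: "((\<lambda>ks. zterm (n # ns) (rev ks)) has_sum S) (rev ` dec_lists (Suc r))"
    by (subst has_sum_reindex) (auto simp: o_def)
  have re: "rev ` dec_lists (Suc r) = {ks. length ks = length (rev (n # ns)) \<and> sorted_wrt (<) ks \<and> (\<forall>k\<in>set ks. 0 < k)}"
  proof -
    have "ks \<in> rev ` dec_lists (Suc r) \<longleftrightarrow> rev ks \<in> dec_lists (Suc r)" for ks by (metis image_iff rev_rev_ident)
    then show ?thesis by (auto simp: dec_lists_def r_def sorted_wrt_rev)
  qed
  have "mzv (rev (n # ns)) = (\<Sum>\<^sub>\<infinity>ks\<in>rev ` dec_lists (Suc r). zterm (n # ns) (rev ks))"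
    unfolding mzv_def re[symmetric]
  proof (rule infsum_cong)
    fix ks assume "ks \<in> rev ` dec_lists (Suc r)"
    then have l: "length ks = Suc r" by (auto simp: dec_lists_def)
    have "zterm (n # ns) (rev ks) = 1 / (\<Prod>i<Suc r. real (rev ks ! i) ^ ((n # ns) ! i))"
      using l by (subst zterm_eq) (auto simp: r_def)
    also have "(\<Prod>i<Suc r. real (rev ks ! i) ^ ((n # ns) ! i)) = (\<Prod>i<Suc r. real (rev ks ! (Suc r - Suc i)) ^ ((n # ns) ! (Suc r - Suc i)))"
      by (rule prod.nat_diff_reindex[symmetric])
    also have "\<dots> = (\<Prod>i<Suc r. real (ks ! i) ^ (rev (n # ns) ! i))"
      using l by (intro prod.cong refl) (auto simp: rev_nth r_def nth_append nth_Cons' simp del: rev.simps)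
    finally show "1 / (\<Prod>i<length (rev (n # ns)). real (ks ! i) ^ (rev (n # ns) ! i)) = zterm (n # ns) (rev ks)"
      by (simp add: r_def)
  qed
  also have "\<dots> = S" by (rule infsumI[OF hs])
  finally show ?thesis using zv by simp
qed

section \<open>The multizeta algebra and its extension by the rationals\<close>

lemma mzv_algebra_scale: "z \<in> mzv_algebra \<Longrightarrow> of_rat q * z \<in> mzv_algebra"
  unfolding mzv_algebra_def by (rule rat_real.span_scale)
lemma mzv_algebra_add: "z \<in> mzv_algebra \<Longrightarrow> y \<in> mzv_algebra \<Longrightarrow> z + y \<in> mzv_algebra"
  unfolding mzv_algebra_def by (rule rat_real.span_add)
lemma mzv_algebra_0: "0 \<in> mzv_algebra"
  unfolding mzv_algebra_def by (rule rat_real.span_zero)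

lemma mzv_algebra_sum_list: "(\<And>z. z \<in> set zs \<Longrightarrow> f z \<in> mzv_algebra) \<Longrightarrow> (\<Sum>z\<leftarrow>zs. f z) \<in> mzv_algebra"
  by (induction zs) (auto intro: mzv_algebra_add mzv_algebra_0)

lemma zval_in:
  assumes "zword w" shows "zval w \<in> mzv_algebra"
proof -
  obtain ns where ns: "\<forall>n\<in>set ns. 1 \<le> n" "hcoef (\<lambda>_. 1) w = hcoef (\<lambda>_. 1) (wd ns)" "ns \<noteq> []" "2 \<le> hd ns"
    using wd_cover[of w] assms by (auto simp: zword_def)
  then obtain n ms where nm: "ns = n # ms" "2 \<le> n" by (cases ns) auto
  have "zval w = zval (wd (n # ms))" using ns nm by (simp add: zval_def del: wd.simps)
  also have "\<dots> = of_rat ((- 1) ^ Suc (length ms)) * mzv (rev (n # ms))"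
    using mzv_zval[of ms n] ns nm by (simp add: of_rat_power of_rat_minus)
  also have "\<dots> \<in> mzv_algebra"
    unfolding mzv_algebra_def using ns nm by (intro rat_real.span_scale rat_real.span_base) (auto intro!: exI[of _ "rev (n # ms)"])
  finally show ?thesis .
qed

lemma shuf_zword:
  assumes "zword u" "zword v" "z \<in> set (shuf u v)" shows "zword z"
proof -
  obtain u' v' where uv: "u = 0 # u'" "v = 0 # v'" using assms by (cases u; cases v) (auto simp: zword_def)
  have "ok_word z \<and> length z = length u + length v" using shuf_props[of u v z] assms by (auto simp: zword_def)
  moreover have "hd z = 0" using assms(3) by (auto simp: uv)
  ultimately show ?thesis using uv by (auto simp: zword_def)
qed

text \<open>All words in the shuffle product of two words that begin with 0 begin with 0 themselves.
  They converge at 1, so the relation between functions passes to the limit.\<close>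

lemma zval_mult:
  assumes "zword u" "zword v"
  shows "zval u * zval v = (\<Sum>z\<leftarrow>shuf u v. zval z)"
proof -
  have "((\<lambda>s. hl u s * hl v s) \<longlongrightarrow> zval u * zval v) (at_left 1)"
    by (intro tendsto_mult zword_tendsto assms)
  moreover have "((\<lambda>s. \<Sum>z\<leftarrow>zs. hl z s) \<longlongrightarrow> (\<Sum>z\<leftarrow>zs. zval z)) (at_left 1)" if "\<And>z. z \<in> set zs \<Longrightarrow> zword z" for zs
    using that by (induction zs) (auto intro!: tendsto_add zword_tendsto)
  then have "((\<lambda>s. \<Sum>z\<leftarrow>shuf u v. hl z s) \<longlongrightarrow> (\<Sum>z\<leftarrow>shuf u v. zval z)) (at_left 1)"
    using shuf_zword[OF assms] by blast
  moreover have "\<forall>\<^sub>F s in at_left 1. hl u s * hl v s = (\<Sum>z\<leftarrow>shuf u v. hl z s)"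
    using eventually_at_left_real[of 0 1] assms by (auto elim!: eventually_mono intro!: hl_shuffle simp: zword_def)
  then have "((\<lambda>s. hl u s * hl v s) \<longlongrightarrow> (\<Sum>z\<leftarrow>shuf u v. zval z)) (at_left 1) \<longleftrightarrow> ((\<lambda>s. \<Sum>z\<leftarrow>shuf u v. hl z s) \<longlongrightarrow> (\<Sum>z\<leftarrow>shuf u v. zval z)) (at_left 1)"
    by (rule tendsto_cong)
  ultimately show ?thesis
    using tendsto_unique[OF trivial_limit_at_left_real] by blast
qed

lemma mzv_is_zval:
  assumes "ns \<noteq> []" "\<forall>m\<in>set ns. 1 \<le> m" "2 \<le> last ns"
  obtains w where "zword w" "w = wd (rev ns)" "zval w = (- 1) ^ length ns * mzv ns"
proof -
  obtain n ms where nm: "rev ns = n # ms" using assms(1) by (cases "rev ns") auto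
  then have ns: "ns = rev (n # ms)" by (metis rev_rev_ident)
  have "2 \<le> n" "\<forall>m\<in>set ms. 1 \<le> m" using assms by (auto simp: ns)
  then show ?thesis using that[of "wd (n # ms)"] wd_zword mzv_zval[of ms n] by (auto simp: ns)
qed

text \<open>Up to sign the generators are values \<open>zval\<close> of words, and these multiply by
  the shuffle product. The rest is bilinear extension, one factor at a time.\<close>

lemma mzv_algebra_mult:
  assumes "x \<in> mzv_algebra" "y \<in> mzv_algebra" shows "x * y \<in> mzv_algebra"
proof -
  let ?B = "{mzv ns | ns. ns \<noteq> [] \<and> (\<forall>m\<in>set ns. 1 \<le> m) \<and> 2 \<le> last ns}"
  have gen: "x * y \<in> mzv_algebra" if x: "x \<in> ?B" and y: "y \<in> ?B" for x y
  proof -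
    have pm: "\<exists>w. zword w \<and> (x = of_rat 1 * zval w \<or> x = of_rat (- 1) * zval w)" if xB: "x \<in> ?B" for x
    proof -
      obtain ns where ns: "x = mzv ns" "ns \<noteq> []" "\<forall>m\<in>set ns. 1 \<le> m" "2 \<le> last ns" using xB by blast
      obtain w where w: "zword w" "zval w = (- 1) ^ length ns * mzv ns" by (rule mzv_is_zval[OF ns(2-4)])
      then show ?thesis using ns(1) by (cases "even (length ns)") (auto simp: of_rat_minus)
    qed
    obtain u v where u: "zword u" "x = of_rat 1 * zval u \<or> x = of_rat (- 1) * zval u"
      and v: "zword v" "y = of_rat 1 * zval v \<or> y = of_rat (- 1) * zval v" using pm[OF x] pm[OF y] by blast
    have "zval u * zval v \<in> mzv_algebra" unfolding zval_mult[OF u(1) v(1)]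
      by (intro mzv_algebra_sum_list zval_in shuf_zword[OF u(1) v(1)])
    then have "of_rat 1 * (zval u * zval v) \<in> mzv_algebra" "of_rat (- 1) * (zval u * zval v) \<in> mzv_algebra"
      by (simp_all only: mzv_algebra_scale)
    then show ?thesis using u(2) v(2) by (auto simp: of_rat_minus)
  qed
  have 1: "x * y \<in> mzv_algebra" if x: "x \<in> ?B" and y: "y \<in> mzv_algebra" for x y
    using y unfolding mzv_algebra_def
  proof (induction rule: rat_real.span_induct_alt)
    case base then show ?case using mzv_algebra_0 by (simp add: mzv_algebra_def)
  next
    case (step c a b)
    have "of_rat c * (x * a) + x * b \<in> mzv_algebra"
      using step gen[OF x, of a] by (intro mzv_algebra_add mzv_algebra_scale) (auto simp: mzv_algebra_def)
    then show ?case by (simp add: mzv_algebra_def algebra_simps)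
  qed
  show ?thesis using assms(1) unfolding mzv_algebra_def
  proof (induction rule: rat_real.span_induct_alt)
    case base then show ?case using mzv_algebra_0 by (simp add: mzv_algebra_def)
  next
    case (step c a b)
    have "of_rat c * (a * y) + b * y \<in> mzv_algebra"
      using step 1[OF _ assms(2), of a] by (intro mzv_algebra_add mzv_algebra_scale) (auto simp: mzv_algebra_def)
    then show ?case by (simp add: mzv_algebra_def algebra_simps)
  qed
qed

text \<open>The unital algebra Q + Z, in which Z is an ideal (\<open>mzv1_mult_mzv\<close>).\<close>

definition mzv1 :: "real set" where "mzv1 = {of_rat r + z | r z. z \<in> mzv_algebra}"

lemma mzv1_I: "z \<in> mzv_algebra \<Longrightarrow> of_rat r + z \<in> mzv1" by (auto simp: mzv1_def)
lemma mzv_sub_mzv1: "mzv_algebra \<subseteq> mzv1" using mzv1_I[of _ 0] by auto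
lemma rat_mzv1: "of_rat r \<in> mzv1" using mzv1_I[OF mzv_algebra_0, of r] by simp
lemma mzv1_add: "x \<in> mzv1 \<Longrightarrow> y \<in> mzv1 \<Longrightarrow> x + y \<in> mzv1"
  unfolding mzv1_def
proof clarify
  fix r s z z' assume "z \<in> mzv_algebra" "z' \<in> mzv_algebra"
  then show "\<exists>r' w. of_rat r + z + (of_rat s + z') = of_rat r' + w \<and> w \<in> mzv_algebra"
    by (intro exI[of _ "r + s"] exI[of _ "z + z'"]) (auto simp: of_rat_add mzv_algebra_add)
qed
lemma mzv1_mult: "x \<in> mzv1 \<Longrightarrow> y \<in> mzv1 \<Longrightarrow> x * y \<in> mzv1"
  unfolding mzv1_def
proof clarify
  fix r s z z' assume z: "z \<in> mzv_algebra" "z' \<in> mzv_algebra"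
  have "of_rat r * z' + (of_rat s * z + z * z') \<in> mzv_algebra"
    by (intro mzv_algebra_add mzv_algebra_scale mzv_algebra_mult z)
  then show "\<exists>r' w. (of_rat r + z) * (of_rat s + z') = of_rat r' + w \<and> w \<in> mzv_algebra"
    by (intro exI[of _ "r * s"] exI[of _ "of_rat r * z' + (of_rat s * z + z * z')"]) (auto simp: of_rat_mult algebra_simps)
qed
lemma mzv1_mult_mzv: "x \<in> mzv1 \<Longrightarrow> y \<in> mzv_algebra \<Longrightarrow> x * y \<in> mzv_algebra"
  unfolding mzv1_def by (auto simp: distrib_right intro!: mzv_algebra_add intro: mzv_algebra_scale mzv_algebra_mult)


section \<open>Shuffle regularisation at 1\<close>

text \<open>The property \<open>hlog_exp\<close> for arbitrary functions, as needed for the products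
  and sums in a shuffle relation.\<close>

definition fexp :: "real set \<Rightarrow> real set \<Rightarrow> (real \<Rightarrow> real) \<Rightarrow> bool" where
  "fexp K0 K h \<longleftrightarrow> (\<exists>d k. k 0 \<in> K0 \<and> (\<forall>i. k i \<in> K) \<and>
     (\<exists>C\<ge>0. \<forall>u\<in>{0<..<1}. \<bar>h u - (\<Sum>i\<le>d. k i * ln (1 - u) ^ i)\<bar> \<le> C * errd d u))"

lemma fexpE:
  assumes "fexp K0 K h" "(0::real) \<in> K"
  shows "\<exists>d k. k 0 \<in> K0 \<and> (\<forall>i. k i \<in> K) \<and> (\<forall>i>d. k i = 0) \<and> (\<forall>e\<ge>d.
     (\<exists>C\<ge>0. \<forall>u\<in>{0<..<1}. \<bar>h u - (\<Sum>i\<le>e. k i * ln (1 - u) ^ i)\<bar> \<le> C * errd e u))"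
proof -
  obtain d k C where d: "k 0 \<in> K0" "\<And>i. k i \<in> K" "C \<ge> 0"
    "\<And>u. u \<in> {0<..<1} \<Longrightarrow> \<bar>h u - (\<Sum>i\<le>d. k i * ln (1 - u) ^ i)\<bar> \<le> C * errd d u"
    using assms(1) unfolding fexp_def by blast
  define l where "l i = (if i \<le> d then k i else 0)" for i
  have "\<bar>h u - (\<Sum>i\<le>e. l i * ln (1 - u) ^ i)\<bar> \<le> C * errd e u" if "d \<le> e" "u \<in> {0<..<1}" for e u
  proof -
    have "(\<Sum>i\<le>e. l i * ln (1 - u) ^ i) = (\<Sum>i\<le>d. k i * ln (1 - u) ^ i)"
      using that by (intro sum.mono_neutral_cong_right) (auto simp: l_def)
    moreover have "C * errd d u \<le> C * errd e u" using d(3) errd_mono[OF that(1)] by (intro mult_left_mono) auto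
    ultimately show ?thesis using d(4)[OF that(2)] by linarith
  qed
  then show ?thesis using d(1-3) assms(2) by (intro exI[of _ d] exI[of _ l]) (auto simp: l_def)
qed

lemma fexp_lin:
  assumes "fexp K0 K f" "fexp K0 K g" "0 \<in> K"
    "\<And>x y. x \<in> K0 \<Longrightarrow> y \<in> K0 \<Longrightarrow> c * x + d * y \<in> K0" "\<And>x y. x \<in> K \<Longrightarrow> y \<in> K \<Longrightarrow> c * x + d * y \<in> K"
  shows "fexp K0 K (\<lambda>u. c * f u + d * g u)"
proof -
  obtain p k where k: "k 0 \<in> K0" "\<And>i. k i \<in> K"
    "\<And>e. e \<ge> p \<Longrightarrow> \<exists>C\<ge>0. \<forall>u\<in>{0<..<1}. \<bar>f u - (\<Sum>i\<le>e. k i * ln (1 - u) ^ i)\<bar> \<le> C * errd e u"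
    using fexpE[OF assms(1,3)] by blast
  obtain q l where l: "l 0 \<in> K0" "\<And>i. l i \<in> K"
    "\<And>e. e \<ge> q \<Longrightarrow> \<exists>C\<ge>0. \<forall>u\<in>{0<..<1}. \<bar>g u - (\<Sum>i\<le>e. l i * ln (1 - u) ^ i)\<bar> \<le> C * errd e u"
    using fexpE[OF assms(2,3)] by blast
  define e where "e = max p q"
  obtain C where C: "C \<ge> 0" "\<And>u. u \<in> {0<..<1} \<Longrightarrow> \<bar>f u - (\<Sum>i\<le>e. k i * ln (1 - u) ^ i)\<bar> \<le> C * errd e u"
    using k(3)[of e] unfolding e_def by (meson max.cobounded1)
  obtain D where D: "D \<ge> 0" "\<And>u. u \<in> {0<..<1} \<Longrightarrow> \<bar>g u - (\<Sum>i\<le>e. l i * ln (1 - u) ^ i)\<bar> \<le> D * errd e u"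
    using l(3)[of e] unfolding e_def by (meson max.cobounded2)
  have "\<bar>(c * f u + d * g u) - (\<Sum>i\<le>e. (c * k i + d * l i) * ln (1 - u) ^ i)\<bar> \<le> (\<bar>c\<bar> * C + \<bar>d\<bar> * D) * errd e u" if u: "u \<in> {0<..<1}" for u
  proof -
    let ?X = "f u - (\<Sum>i\<le>e. k i * ln (1 - u) ^ i)" and ?Y = "g u - (\<Sum>i\<le>e. l i * ln (1 - u) ^ i)"
    have "(\<Sum>i\<le>e. (c * k i + d * l i) * ln (1 - u) ^ i) = c * (\<Sum>i\<le>e. k i * ln (1 - u) ^ i) + d * (\<Sum>i\<le>e. l i * ln (1 - u) ^ i)"
      unfolding sum_distrib_left sum.distrib[symmetric] by (intro sum.cong) (auto simp: algebra_simps)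
    then have "(c * f u + d * g u) - (\<Sum>i\<le>e. (c * k i + d * l i) * ln (1 - u) ^ i) = c * ?X + d * ?Y"
      by (simp only: right_diff_distrib)
    also have "\<bar>\<dots>\<bar> \<le> \<bar>c\<bar> * \<bar>?X\<bar> + \<bar>d\<bar> * \<bar>?Y\<bar>" unfolding abs_mult[symmetric] by (rule abs_triangle_ineq)
    also have "\<dots> \<le> \<bar>c\<bar> * (C * errd e u) + \<bar>d\<bar> * (D * errd e u)" using C(2)[OF u] D(2)[OF u] by (intro add_mono mult_left_mono) auto
    finally show ?thesis by (simp add: algebra_simps)
  qed
  moreover have "0 \<le> \<bar>c\<bar> * C + \<bar>d\<bar> * D" using C D by simp
  ultimately show ?thesis unfolding fexp_def using k(1,2) l(1,2) assms(4,5)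
    by (intro exI[of _ e] exI[of _ "\<lambda>i. c * k i + d * l i"]) blast
qed

text \<open>All powers of the logarithm move up by one, so the constant term becomes 0, whatever it
  was before.\<close>

lemma fexp_ln:
  assumes "fexp K0 K f" "0 \<in> K"
  shows "fexp {0} K (\<lambda>u. ln (1 - u) * f u)"
proof -
  obtain d k C where d: "\<And>i. k i \<in> K" "C \<ge> 0"
    "\<And>u. u \<in> {0<..<1} \<Longrightarrow> \<bar>f u - (\<Sum>i\<le>d. k i * ln (1 - u) ^ i)\<bar> \<le> C * errd d u"
    using assms(1) unfolding fexp_def by blast
  define l where "l i = (case i of 0 \<Rightarrow> 0 | Suc j \<Rightarrow> k j)" for i
  have "\<bar>ln (1 - u) * f u - (\<Sum>i\<le>Suc d. l i * ln (1 - u) ^ i)\<bar> \<le> C * errd (Suc d) u" if u: "u \<in> {0<..<1}" for u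
  proof -
    have "(\<Sum>i\<le>Suc d. l i * ln (1 - u) ^ i) = ln (1 - u) * (\<Sum>i\<le>d. k i * ln (1 - u) ^ i)"
      unfolding sum.atMost_Suc_shift by (simp add: l_def sum_distrib_left mult_ac)
    then have "\<bar>ln (1 - u) * f u - (\<Sum>i\<le>Suc d. l i * ln (1 - u) ^ i)\<bar> = \<bar>ln (1 - u)\<bar> * \<bar>f u - (\<Sum>i\<le>d. k i * ln (1 - u) ^ i)\<bar>"
      by (simp only: abs_mult[symmetric] right_diff_distrib)
    also have "\<dots> \<le> \<bar>ln (1 - u)\<bar> * (C * errd d u)" using d(3)[OF u] by (intro mult_left_mono) auto
    also have "\<dots> = C * (\<bar>ln (1 - u)\<bar> * errd d u)" by simp
    also have "\<dots> \<le> C * errd (Suc d) u" using d(2) ln_errd by (intro mult_left_mono) auto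
    finally show ?thesis .
  qed
  moreover have "l 0 \<in> {0}" "\<And>i. l i \<in> K" using d(1) assms(2) by (auto simp: l_def split: nat.splits)
  ultimately show ?thesis unfolding fexp_def using d(2) by (intro exI[of _ "Suc d"] exI[of _ l]) blast
qed

lemma fexp_mono: "fexp K0 K f \<Longrightarrow> K0 \<subseteq> K0' \<Longrightarrow> K \<subseteq> K' \<Longrightarrow> fexp K0' K' f"
  unfolding fexp_def by (meson subsetD)

lemma fexp_cong: 
  assumes "fexp K0 K f" "\<And>u. u \<in> {0<..<1} \<Longrightarrow> f u = g u" shows "fexp K0 K g"
proof -
  obtain d k C where d: "k 0 \<in> K0" "\<And>i. k i \<in> K" "C \<ge> 0"
    "\<And>u. u \<in> {0<..<1} \<Longrightarrow> \<bar>f u - (\<Sum>i\<le>d. k i * ln (1 - u) ^ i)\<bar> \<le> C * errd d u"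
    using assms(1) unfolding fexp_def by blast
  then have "\<And>u. u \<in> {0<..<1} \<Longrightarrow> \<bar>g u - (\<Sum>i\<le>d. k i * ln (1 - u) ^ i)\<bar> \<le> C * errd d u" using assms(2) by simp
  then show ?thesis unfolding fexp_def using d(1-3) by blast
qed

lemma mzv_lin: "x \<in> mzv_algebra \<Longrightarrow> y \<in> mzv_algebra \<Longrightarrow> of_rat p * x + of_rat q * y \<in> mzv_algebra"
  by (intro mzv_algebra_add mzv_algebra_scale)
lemma mzv1_lin: "x \<in> mzv1 \<Longrightarrow> y \<in> mzv1 \<Longrightarrow> of_rat p * x + of_rat q * y \<in> mzv1"
  by (intro mzv1_add mzv1_mult rat_mzv1)
lemma mzv1_0: "0 \<in> mzv1" using rat_mzv1[of 0] by simp

lemma ok_word_append: "ok_word v \<Longrightarrow> m \<noteq> 0 \<Longrightarrow> ok_word (replicate j m @ v)"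
  by (cases "v = []"; cases j) (auto simp: ok_word_def)

text \<open>By the shuffle product, \<open>ln (1 - u)\<close> times the function of m^j v is j + 1
  times that of m^(j+1) v plus functions of words with only j leading letters m; this is solved for
  m^(j+1) v. The constant terms stay in Z, and not merely in Q + Z: the product with the logarithm
  contributes none, and the convergent words at the start contribute their values.\<close>

lemma fexp_hl:
  assumes "m \<noteq> 0" "ok_word v" "v = [] \<or> hd v = 0" "replicate j m @ v \<noteq> []"
  shows "fexp mzv_algebra mzv1 (hl (replicate j m @ v))"
  using assms(2-4)
proof (induction j arbitrary: v)
  case 0
  then have z: "zword v" by (auto simp: zword_def)
  obtain C where C: "C \<ge> 0" "\<And>u. u \<in> {0<..<1} \<Longrightarrow> \<bar>hl v u - zval v\<bar> \<le> C * (1 - u) powr (1/4)" using zword_rate[OF z] by blast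
  have "zval v \<in> mzv_algebra" "zval v \<in> mzv1" using zval_in[OF z] mzv_sub_mzv1 by auto
  then show ?case unfolding fexp_def using C
    by (intro exI[of _ 0] exI[of _ "\<lambda>i. zval v"]) (auto simp: errd_def)
next
  case (Suc j)
  note okj = ok_word_append[OF Suc.prems(1) assms(1)]
  \<comment> \<open>The empty word has constant term 1, which need not lie in Z, hence the larger
    set here. The multiplication by the logarithm removes this term.\<close>
  have f0: "fexp mzv1 mzv1 (hl (replicate j m @ v))"
  proof (cases "replicate j m @ v = []")
    case True
    have "fexp mzv1 mzv1 (\<lambda>u. 1)" unfolding fexp_def
      by (intro exI[of _ 0] exI[of _ "\<lambda>i. 1"]) (use rat_mzv1[of 1] in \<open>auto intro!: exI[of _ 0]\<close>)
    then show ?thesis unfolding True by (rule fexp_cong) simp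
  next
    case False
    then have "fexp mzv_algebra mzv1 (hl (replicate j m @ v))" using Suc by blast
    then show ?thesis by (rule fexp_mono) (use mzv_sub_mzv1 in auto)
  qed
  then have f1: "fexp mzv_algebra mzv1 (\<lambda>u. ln (1 - u) * hl (replicate j m @ v) u)"
    using fexp_mono[OF fexp_ln[OF f0 mzv1_0]] mzv_algebra_0 by simp
  \<comment> \<open>For \<open>v = []\<close> every insertion of m gives the same word, and there is
    no remainder.\<close>
  define zs where "zs = (if v = [] then [] else map (\<lambda>z. replicate j m @ 0 # z) (shuf [m] (tl v)))"
  have sh: "ln (1 - u) * hl (replicate j m @ v) u = real (Suc j) * hl (replicate (Suc j) m @ v) u + (\<Sum>z\<leftarrow>zs. hl z u)"
    if "u \<in> {0<..<1}" for u
  proof -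
    have "ln (1 - u) * hl (replicate j m @ v) u = (\<Sum>z\<leftarrow>shuf [m] (replicate j m @ v). hl z u)"
      using hl_shuffle[of "[m]" "replicate j m @ v" u] hl_single[OF assms(1), of u] okj that assms(1) by (simp add: ok_word_Cons)
    also have "\<dots> = real (Suc j) * hl (replicate (Suc j) m @ v) u + (\<Sum>z\<leftarrow>zs. hl z u)"
    proof (cases v)
      case Nil
      then show ?thesis using shuf_single'[of "\<lambda>z. hl z u" m j] by (simp add: zs_def)
    next
      case (Cons b v')
      then have "b = 0" using Suc.prems by auto
      then show ?thesis using shuf_single[of "\<lambda>z. hl z u" m j 0 v'] Cons by (simp add: zs_def o_def)
    qed
    finally show ?thesis .
  qed
  have zs: "fexp mzv_algebra mzv1 (hl z)" if "z \<in> set zs" for z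
  proof -
    from that obtain z' where z': "v \<noteq> []" "z = replicate j m @ 0 # z'" "z' \<in> set (shuf [m] (tl v))"
      by (auto simp: zs_def split: if_splits)
    then obtain v' where v: "v = 0 # v'" using Suc.prems by (cases v) auto
    have "ok_word v'" using Suc.prems v by (auto simp: ok_word_Cons split: if_splits)
    then have "ok_word z'" "z' \<noteq> []" using shuf_props[of "[m]" v' z'] z' v assms(1) by (auto simp: ok_word_Cons)
    then show ?thesis unfolding z'(2) by (intro Suc.IH) (auto simp: ok_word_Cons)
  qed
  have fs: "fexp mzv_algebra mzv1 (\<lambda>u. \<Sum>z\<leftarrow>zs. hl z u)"
    using zs
  proof (induction zs)
    case Nil
    show ?case unfolding fexp_def
      by (intro exI[of _ 0] exI[of _ "\<lambda>i. 0"]) (use mzv1_0 mzv_algebra_0 in \<open>auto intro!: exI[of _ 0]\<close>)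
  next
    case (Cons z zs)
    have "fexp mzv_algebra mzv1 (\<lambda>u. of_rat 1 * hl z u + of_rat 1 * (\<Sum>z\<leftarrow>zs. hl z u))"
      by (rule fexp_lin[OF _ _ mzv1_0 mzv_lin mzv1_lin]) (use Cons in auto)
    then show ?case by simp
  qed
  have "fexp mzv_algebra mzv1 (\<lambda>u. of_rat (1 / rat_of_nat (Suc j)) * (ln (1 - u) * hl (replicate j m @ v) u) + of_rat (- (1 / rat_of_nat (Suc j))) * (\<Sum>z\<leftarrow>zs. hl z u))"
    by (rule fexp_lin[OF f1 fs mzv1_0 mzv_lin mzv1_lin])
  then show ?case
  proof (rule fexp_cong)
    fix u :: real assume u: "u \<in> {0<..<1}"
    have r: "of_rat (1 / rat_of_nat (Suc j)) = 1 / real (Suc j)" "of_rat (- (1 / rat_of_nat (Suc j))) = - (1 / real (Suc j))"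
      by (simp_all add: of_rat_divide of_rat_minus del: of_nat_Suc)
    show "of_rat (1 / rat_of_nat (Suc j)) * (ln (1 - u) * hl (replicate j m @ v) u) + of_rat (- (1 / rat_of_nat (Suc j))) * (\<Sum>z\<leftarrow>zs. hl z u) = hl (replicate (Suc j) m @ v) u"
      unfolding r sh[OF u] by (simp add: field_simps del: of_nat_Suc)
  qed
qed

lemma word_split: 
  assumes "set w \<subseteq> {0, m}" shows "\<exists>j v. w = replicate j m @ v \<and> (v = [] \<or> hd v = 0)"
  using assms
proof (induction w)
  case (Cons a w)
  show ?case
  proof (cases "a = 0")
    case True then show ?thesis by (intro exI[of _ 0] exI[of _ "a # w"]) auto
  next
    case False
    then have "a = m" using Cons by auto
    moreover obtain j v where "w = replicate j m @ v" "v = [] \<or> hd v = 0" using Cons by auto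
    ultimately show ?thesis by (intro exI[of _ "Suc j"] exI[of _ v]) auto
  qed
qed auto

lemma hlog_exp_mzv:
  assumes "m \<noteq> 0" "ok_word w" "set w \<subseteq> {0, m}" "w \<noteq> []"
  shows "hlog_exp mzv_algebra mzv1 w"
proof -
  obtain j v where w: "w = replicate j m @ v" "v = [] \<or> hd v = 0" using word_split[OF assms(3)] by blast
  have "ok_word v" using assms(2) w by (cases "v = []") (auto simp: ok_word_def)
  then have "fexp mzv_algebra mzv1 (hl w)" unfolding w(1) using assms w by (intro fexp_hl) auto
  then show ?thesis by (simp add: fexp_def hlog_exp_def)
qed

lemma hlog_expansion_mzv:
  assumes m: "m \<noteq> 0" "0 \<notin> A" "m \<notin> A" and w: "ok_word w" "set w \<subseteq> {0, m} \<union> A" "w \<noteq> []"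
  shows "\<exists>d \<Phi>. \<Phi> 0 \<in> hspan A mzv_algebra mzv1 \<and> (\<forall>x q. adm A x q \<longrightarrow> 0 < x m \<longrightarrow> q * x m < 1 \<longrightarrow>
     ((\<lambda>u. hlog x w (u * x m) - (\<Sum>i\<le>d. ln (1 - u) ^ i * cser (\<Phi> i) x (x m))) \<longlongrightarrow> 0) (at_left 1))"
proof (rule hlog_expansion[OF m _ mzv1_0 _ mzv_sub_mzv1 mzv_algebra_0 _ w])
  show "of_int q * k \<in> mzv1" if "k \<in> mzv1" for q :: int and k
    using mzv1_mult[OF rat_mzv1[of "of_int q"] that] by simp
  show "1 \<in> mzv1" using rat_mzv1[of 1] by simp
qed (use hlog_exp_mzv m in auto)


section \<open>Partial fractions of regular functions\<close>

text \<open>The labels of the finite points that remain once t 1, ..., t (m - 1) have been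
  eliminated.\<close>

definition Lab :: "nat \<Rightarrow> nat \<Rightarrow> nat set" where "Lab n m = {0} \<union> {m..n - 2}"

text \<open>The remaining points are distinct. Because 1/0 = 0, rational identities are available
  only under this condition.\<close>

definition valid :: "nat \<Rightarrow> nat \<Rightarrow> (nat \<Rightarrow> 'a::zero_neq_one) \<Rightarrow> bool" where
  "valid n m t \<longleftrightarrow> inj_on (marked n t) (Lab n m)"

inductive_set reg :: "nat \<Rightarrow> nat \<Rightarrow> ((nat \<Rightarrow> complex) \<Rightarrow> complex) set" for n m where
  const: "(\<lambda>t. of_rat q) \<in> reg n m"
| coord: "m \<le> i \<Longrightarrow> i \<le> n - 3 \<Longrightarrow> (\<lambda>t. t i) \<in> reg n m"
| inv_diff: "i < j \<Longrightarrow> i \<in> Lab n m \<Longrightarrow> j \<in> Lab n m \<Longrightarrow> (\<lambda>t. 1 / (marked n t j - marked n t i)) \<in> reg n m"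
| add: "f \<in> reg n m \<Longrightarrow> g \<in> reg n m \<Longrightarrow> (\<lambda>t. f t + g t) \<in> reg n m"
| mult: "f \<in> reg n m \<Longrightarrow> g \<in> reg n m \<Longrightarrow> (\<lambda>t. f t * g t) \<in> reg n m"

lemma regular_functions_reg: "f \<in> regular_functions n \<Longrightarrow> f \<in> reg n 1"
proof (induction rule: regular_functions.induct)
  case (inv_diff i j)
  then show ?case by (intro reg.inv_diff) (auto simp: Lab_def)
qed (auto intro: reg.intros)

lemma marked_cong: "i \<in> Lab n m \<Longrightarrow> (\<And>i. m \<le> i \<Longrightarrow> t i = t' i) \<Longrightarrow> marked n t i = marked n t' i"
  by (auto simp: marked_def Lab_def)

lemma reg_cong: "f \<in> reg n m \<Longrightarrow> (\<And>i. m \<le> i \<Longrightarrow> t i = t' i) \<Longrightarrow> f t = f t'"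
proof (induction rule: reg.induct)
  case (inv_diff i j)
  then show ?case using marked_cong[of i n m t t'] marked_cong[of j n m t t'] by simp
qed auto

lemma reg_uminus: "f \<in> reg n m \<Longrightarrow> (\<lambda>t. - f t) \<in> reg n m"
  using reg.mult[OF reg.const[of "-1"]] by (simp add: of_rat_minus)

lemma reg_zero: "(\<lambda>t. 0) \<in> reg n m" using reg.const[of 0] by simp

lemma Lab_Suc: "m \<le> n - 2 \<Longrightarrow> Lab n m = insert m (Lab n (Suc m))" by (auto simp: Lab_def)

lemma marked_reg: "j \<in> Lab n m \<Longrightarrow> (\<lambda>t. marked n t j) \<in> reg n m"
proof -
  assume j: "j \<in> Lab n m"
  have "j = 0 \<or> (m \<le> j \<and> j \<le> n - 2)" using j by (auto simp: Lab_def)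
  then consider "j = 0" | "j \<noteq> 0" "j = n - 2" | "j \<noteq> 0" "j \<noteq> n - 2" "m \<le> j" "j \<le> n - 3" by linarith
  then show ?thesis
  proof cases
    case 1 then show ?thesis using reg.const[of 0] by (simp add: marked_def)
  next
    case 2 then show ?thesis using reg.const[of 1] by (simp add: marked_def)
  next
    case 3 then show ?thesis using reg.coord[of m j n] by (simp add: marked_def)
  qed
qed

lemma reg_inv:
  assumes "i \<in> Lab n m" "j \<in> Lab n m" "i \<noteq> j"
  shows "(\<lambda>t. 1 / (marked n t j - marked n t i)) \<in> reg n m"
proof (cases "i < j")
  case True then show ?thesis using assms by (intro reg.inv_diff) auto
next
  case False
  then have "(\<lambda>t. - (1 / (marked n t i - marked n t j))) \<in> reg n m"
    using assms by (intro reg_uminus reg.inv_diff) auto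
  moreover have "(\<lambda>t :: nat \<Rightarrow> complex. - (1 / (marked n t i - marked n t j))) = (\<lambda>t. 1 / (marked n t j - marked n t i))"
    by (rule ext) (simp only: minus_divide_right minus_diff_eq)
  ultimately show ?thesis by simp
qed

section \<open>Partial fractions in one coordinate\<close>

inductive_set pf :: "nat \<Rightarrow> nat \<Rightarrow> ((nat \<Rightarrow> complex) \<Rightarrow> complex) set" for n m where
  zero: "(\<lambda>t. 0) \<in> pf n m"
| poly: "f \<in> pf n m \<Longrightarrow> p \<in> reg n (Suc m) \<Longrightarrow> (\<lambda>t. p t * t m ^ k + f t) \<in> pf n m"
| pole: "f \<in> pf n m \<Longrightarrow> p \<in> reg n (Suc m) \<Longrightarrow> j \<in> Lab n (Suc m) \<Longrightarrow>
    (\<lambda>t. p t / (t m - marked n t j) ^ Suc k + f t) \<in> pf n m"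

lemma pf_add: "f \<in> pf n m \<Longrightarrow> g \<in> pf n m \<Longrightarrow> (\<lambda>t. f t + g t) \<in> pf n m"
proof (induction rule: pf.induct)
  case (poly f p k)
  have "(\<lambda>t. p t * t m ^ k + (f t + g t)) \<in> pf n m" using poly by (intro pf.poly) auto
  then show ?case by (simp only: add.assoc)
next
  case (pole f p j k)
  have "(\<lambda>t. p t / (t m - marked n t j) ^ Suc k + (f t + g t)) \<in> pf n m" using pole by (intro pf.pole) auto
  then show ?case by (simp only: add.assoc)
qed simp

lemma pf_scale: "f \<in> pf n m \<Longrightarrow> c \<in> reg n (Suc m) \<Longrightarrow> (\<lambda>t. c t * f t) \<in> pf n m"
proof (induction rule: pf.induct)
  case (poly f p k)
  have "(\<lambda>t. (c t * p t) * t m ^ k + c t * f t) \<in> pf n m" using poly by (intro pf.poly reg.mult)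
  then show ?case by (simp add: algebra_simps)
next
  case (pole f p j k)
  have "(\<lambda>t. (c t * p t) / (t m - marked n t j) ^ Suc k + c t * f t) \<in> pf n m" using pole by (intro pf.pole reg.mult)
  then show ?case by (simp add: algebra_simps)
qed (simp add: pf.zero)

definition rpf :: "nat \<Rightarrow> nat \<Rightarrow> ((nat \<Rightarrow> complex) \<Rightarrow> complex) \<Rightarrow> bool" where
  "rpf n m f \<longleftrightarrow> (\<exists>g\<in>pf n m. \<forall>t. valid n m t \<longrightarrow> f t = g t)"

lemma rpf_pf: "f \<in> pf n m \<Longrightarrow> rpf n m f" by (auto simp: rpf_def)
lemma rpf_add: "rpf n m f \<Longrightarrow> rpf n m g \<Longrightarrow> rpf n m (\<lambda>t. f t + g t)"
  unfolding rpf_def by (metis (no_types, lifting) pf_add)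
lemma rpf_scale: "rpf n m f \<Longrightarrow> c \<in> reg n (Suc m) \<Longrightarrow> rpf n m (\<lambda>t. c t * f t)"
  unfolding rpf_def by (metis (no_types, lifting) pf_scale)
lemma rpf_cong: "rpf n m f \<Longrightarrow> (\<And>t. valid n m t \<Longrightarrow> f t = g t) \<Longrightarrow> rpf n m g"
  unfolding rpf_def by simp

lemma rpf_poly: "p \<in> reg n (Suc m) \<Longrightarrow> rpf n m (\<lambda>t. p t * t m ^ k)"
  using rpf_pf[OF pf.poly[OF pf.zero]] by simp
lemma rpf_pole: "p \<in> reg n (Suc m) \<Longrightarrow> j \<in> Lab n (Suc m) \<Longrightarrow> rpf n m (\<lambda>t. p t / (t m - marked n t j) ^ Suc k)"
  using rpf_pf[OF pf.pole[OF pf.zero]] by simp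

lemma valid_neq:
  assumes "valid n m t" "1 \<le> m" "m \<le> n - 3" "3 \<le> n" "j \<in> Lab n (Suc m)"
  shows "t m \<noteq> marked n t j"
proof -
  have "m \<in> Lab n m" "j \<in> Lab n m" "j \<noteq> m" using assms by (auto simp: Lab_def)
  then have "marked n t m \<noteq> marked n t j" using assms(1) by (auto simp: valid_def inj_on_def)
  moreover have "marked n t m = t m" using assms by (auto simp: marked_def)
  ultimately show ?thesis by simp
qed

lemma rpf_mult_coord:
  assumes m: "1 \<le> m" "m \<le> n - 3" "3 \<le> n" and f: "rpf n m f"
  shows "rpf n m (\<lambda>t. t m * f t)"
proof -
  have "rpf n m (\<lambda>t. t m * g t)" if "g \<in> pf n m" for g
    using that
  proof (induction rule: pf.induct)
    case zero then show ?case using rpf_pf[OF pf.zero] by simp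
  next
    case (poly f p k)
    have "rpf n m (\<lambda>t. p t * t m ^ Suc k + t m * f t)" using poly by (intro rpf_add rpf_poly) auto
    then show ?case by (simp add: algebra_simps)
  next
    case (pole f p j k)
    have a: "rpf n m (\<lambda>t. (case k of 0 \<Rightarrow> p t * t m ^ 0 | Suc k' \<Rightarrow> p t / (t m - marked n t j) ^ Suc k'))"
      using pole rpf_poly[of p n m 0] rpf_pole[of p n m j] by (cases k) auto
    have b: "rpf n m (\<lambda>t. (marked n t j * p t) / (t m - marked n t j) ^ Suc k)"
      using pole by (intro rpf_pole reg.mult marked_reg) auto
    have "rpf n m (\<lambda>t. (case k of 0 \<Rightarrow> p t * t m ^ 0 | Suc k' \<Rightarrow> p t / (t m - marked n t j) ^ Suc k') + ((marked n t j * p t) / (t m - marked n t j) ^ Suc k + t m * f t))"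
      by (intro rpf_add a b pole)
    then show ?case
    proof (rule rpf_cong)
      fix t :: "nat \<Rightarrow> complex" assume v: "valid n m t"
      define z where "z = t m - marked n t j"
      have z: "z \<noteq> 0" using valid_neq[OF v m, of j] pole by (simp add: z_def)
      have "t m = z + marked n t j" by (simp add: z_def)
      then have e: "t m * (p t / z ^ Suc k) = p t / z ^ k + marked n t j * p t / z ^ Suc k" using z by (simp add: field_simps)
      show "(case k of 0 \<Rightarrow> p t * t m ^ 0 | Suc k' \<Rightarrow> p t / (t m - marked n t j) ^ Suc k') + ((marked n t j * p t) / (t m - marked n t j) ^ Suc k + t m * f t)
         = t m * (p t / (t m - marked n t j) ^ Suc k + f t)"
        unfolding z_def[symmetric] distrib_left e by (cases k) auto
    qed
  qed
  then show ?thesis using f unfolding rpf_def by (metis (no_types, lifting))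
qed

text \<open>\<open>A\<close> treats powers of t m, and \<open>B\<close> a pole at another point b,
  by 1/((T - a)(T - b)) = (1/(T - a) - 1/(T - b))/(a - b). The division by a - b is possible because
  1/(a - b) is a regular function of the later coordinates.\<close>

lemma rpf_mult_inv:
  assumes m: "1 \<le> m" "m \<le> n - 3" "3 \<le> n" and f: "rpf n m f" and i: "i \<in> Lab n (Suc m)"
  shows "rpf n m (\<lambda>t. 1 / (t m - marked n t i) * f t)"
proof -
  have one: "(\<lambda>t. 1) \<in> reg n (Suc m)" using reg.const[of 1] by simp
  have A: "rpf n m (\<lambda>t. t m ^ k / (t m - marked n t i))" for k
  proof (induction k)
    case 0 then show ?case using rpf_pole[OF one i, of 0] by simp
  next
    case (Suc k)
    have "rpf n m (\<lambda>t. 1 * t m ^ k + marked n t i * (t m ^ k / (t m - marked n t i)))"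
      using one i by (intro rpf_add rpf_poly rpf_scale Suc marked_reg)
    then show ?case
    proof (rule rpf_cong)
      fix t :: "nat \<Rightarrow> complex" assume "valid n m t"
      from valid_neq[OF this m i] show "1 * t m ^ k + marked n t i * (t m ^ k / (t m - marked n t i)) = t m ^ Suc k / (t m - marked n t i)"
        by (simp add: field_simps)
    qed
  qed
  have B: "rpf n m (\<lambda>t. 1 / (t m - marked n t i) * (1 / (t m - marked n t j) ^ k))" if j: "j \<in> Lab n (Suc m)" for j k
  proof (cases "i = j")
    case True
    then show ?thesis using rpf_pole[OF one j, of k] by (simp add: divide_divide_eq_left)
  next
    case False
    show ?thesis
    proof (induction k)
      case 0 then show ?case using A[of 0] by simp
    next
      case (Suc k)
      have "rpf n m (\<lambda>t. 1 / (marked n t i - marked n t j) * (1 / (t m - marked n t i) * (1 / (t m - marked n t j) ^ k) + (- 1) / (t m - marked n t j) ^ Suc k))"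
        using False i j reg.const[of "-1"] by (intro rpf_add rpf_scale Suc reg_inv rpf_pole) (auto simp: of_rat_minus)
      then show ?case
      proof (rule rpf_cong)
        fix t :: "nat \<Rightarrow> complex" assume v: "valid n m t"
        have n1: "t m \<noteq> marked n t i" by (rule valid_neq[OF v m i])
        have n2: "t m \<noteq> marked n t j" by (rule valid_neq[OF v m j])
        have "i \<in> Lab n m" "j \<in> Lab n m" using i j by (auto simp: Lab_def)
        then have n3: "marked n t i \<noteq> marked n t j" using v False by (simp add: valid_def inj_on_eq_iff)
        have alg: "1 / (a - b) * (1 / (T - a) * (1 / (T - b) ^ k) + (- 1) / (T - b) ^ Suc k) = 1 / (T - a) * (1 / (T - b) ^ Suc k)"
          if "T \<noteq> a" "T \<noteq> b" "a \<noteq> b" for T a b :: complex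
        proof -
          define x y Y where "x = T - a" and "y = T - b" and "Y = (T - b) ^ k"
          have nz: "x \<noteq> 0" "y \<noteq> 0" "Y \<noteq> 0" "y - x \<noteq> 0" using that by (auto simp: x_def y_def Y_def)
          have Yy: "Y = y ^ k" by (simp add: Y_def y_def)
          have e: "a - b = y - x" by (simp add: x_def y_def)
          have "1 / x * (1 / Y) + (- 1) / (y * Y) = (y - x) * (1 / x * (1 / (y * Y)))" using nz(1-3) by (simp add: divide_simps)
          then show ?thesis unfolding e power_Suc x_def[symmetric] y_def[symmetric] Yy[symmetric] using nz(4) by simp
        qed
        show "1 / (marked n t i - marked n t j) * (1 / (t m - marked n t i) * (1 / (t m - marked n t j) ^ k) + (- 1) / (t m - marked n t j) ^ Suc k)
           = 1 / (t m - marked n t i) * (1 / (t m - marked n t j) ^ Suc k)"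
          by (rule alg[OF n1 n2 n3])
      qed
    qed
  qed
  have "rpf n m (\<lambda>t. 1 / (t m - marked n t i) * g t)" if "g \<in> pf n m" for g
    using that
  proof (induction rule: pf.induct)
    case zero then show ?case using rpf_pf[OF pf.zero] by simp
  next
    case (poly f p k)
    have "rpf n m (\<lambda>t. p t * (t m ^ k / (t m - marked n t i)) + 1 / (t m - marked n t i) * f t)" by (rule rpf_add[OF rpf_scale[OF A poly(2)] poly(3)])
    then show ?case by (simp add: algebra_simps)
  next
    case (pole f p j k)
    have "rpf n m (\<lambda>t. p t * (1 / (t m - marked n t i) * (1 / (t m - marked n t j) ^ Suc k)) + 1 / (t m - marked n t i) * f t)" by (rule rpf_add[OF rpf_scale[OF B[OF pole(3)] pole(2)] pole(4)])
    then show ?case by (simp add: algebra_simps)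
  qed
  then show ?thesis using f unfolding rpf_def by (metis (no_types, lifting))
qed

text \<open>Formulated as an action of regular functions on partial fractions: the induction then
  only has to multiply by a generator, never two expansions with each other.\<close>

lemma reg_rpf_mult:
  assumes m: "1 \<le> m" "m \<le> n - 3" "3 \<le> n"
  shows "f \<in> reg n m \<Longrightarrow> rpf n m h \<Longrightarrow> rpf n m (\<lambda>t. f t * h t)"
proof (induction arbitrary: h rule: reg.induct)
  case (const q) then show ?case by (intro rpf_scale reg.const)
next
  case (coord i)
  show ?case
  proof (cases "i = m")
    case True then show ?thesis using rpf_mult_coord[OF m] coord by simp
  next
    case False then show ?thesis using coord by (intro rpf_scale reg.coord) auto
  qed
next
  case (inv_diff i j)
  have mm: "marked n t m = t m" for t :: "nat \<Rightarrow> complex" using m by (auto simp: marked_def)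
  have L: "Lab n m = insert m (Lab n (Suc m))" using m by (intro Lab_Suc) auto
  consider "j = m" "i \<in> Lab n (Suc m)" | "i = m" "j \<in> Lab n (Suc m)" | "i \<in> Lab n (Suc m)" "j \<in> Lab n (Suc m)"
    using inv_diff L by auto
  then show ?case
  proof cases
    case 1 then show ?thesis using rpf_mult_inv[OF m inv_diff(4), of i] by (simp add: mm)
  next
    case 2
    have "rpf n m (\<lambda>t. of_rat (-1) * (1 / (t m - marked n t j) * h t))"
      by (intro rpf_scale reg.const rpf_mult_inv[OF m inv_diff(4)] 2)
    moreover have "of_rat (-1) * (1 / (t m - marked n t j) * h t) = 1 / (marked n t j - marked n t i) * h t" for t
    proof -
      have "1 / (marked n t j - marked n t i) = - (1 / (t m - marked n t j))"
        using 2 mm[of t] by (simp only: minus_divide_right minus_diff_eq)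
      then show ?thesis by (simp add: of_rat_minus)
    qed
    ultimately show ?thesis by simp
  next
    case 3 then show ?thesis using inv_diff by (intro rpf_scale reg_inv) auto
  qed
next
  case (add f g)
  then have "rpf n m (\<lambda>t. f t * h t + g t * h t)" by (intro rpf_add) auto
  then show ?case by (simp add: algebra_simps)
next
  case (mult f g)
  have "rpf n m (\<lambda>t. f t * (g t * h t))" by (intro mult)
  then show ?case by (simp add: mult.assoc)
qed

text \<open>\<open>c j k\<close> belongs to a pole of order k + 1. The argument T is separate from t
  so that it can move while the coefficients and poles stay fixed.\<close>

definition pfsum :: "nat \<Rightarrow> nat \<Rightarrow> (nat \<Rightarrow> complex) \<Rightarrow> (nat \<Rightarrow> nat \<Rightarrow> complex) \<Rightarrow> nat \<Rightarrow> (nat \<Rightarrow> complex) \<Rightarrow> complex \<Rightarrow> complex" where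
  "pfsum n m p c M t T = (\<Sum>k\<le>M. p k * T ^ k) + (\<Sum>j\<in>Lab n (Suc m). \<Sum>k\<le>M. c j k / (T - marked n t j) ^ Suc k)"

lemma finite_Lab: "finite (Lab n m)" by (simp add: Lab_def)

text \<open>All bounds beyond M are allowed, so that the range can be enlarged whenever a further
  term is added.\<close>

lemma pf_canonical:
  assumes "f \<in> pf n m"
  shows "\<exists>M p c. (\<forall>k. p k \<in> reg n (Suc m)) \<and> (\<forall>j k. c j k \<in> reg n (Suc m)) \<and>
    (\<forall>M'\<ge>M. \<forall>t. f t = pfsum n m (\<lambda>k. p k t) (\<lambda>j k. c j k t) M' t (t m))"
  using assms
proof (induction rule: pf.induct)
  case zero
  show ?case by (intro exI[of _ 0] exI[of _ "\<lambda>k t. 0"] exI[of _ "\<lambda>j k t. 0"]) (auto simp: pfsum_def reg_zero)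
next
  case (poly f q l)
  then obtain M p c where IH: "\<And>k. p k \<in> reg n (Suc m)" "\<And>j k. c j k \<in> reg n (Suc m)"
    "\<And>M' t. M' \<ge> M \<Longrightarrow> f t = pfsum n m (\<lambda>k. p k t) (\<lambda>j k. c j k t) M' t (t m)" by blast
  define p' where "p' k = (if k = l then (\<lambda>t. q t + p k t) else p k)" for k
  show ?case
  proof (intro exI[of _ "max M l"] exI[of _ p'] exI[of _ c] conjI allI impI)
    show "p' k \<in> reg n (Suc m)" for k using IH poly by (auto simp: p'_def intro: reg.add)
    fix M' and t :: "nat \<Rightarrow> complex" assume M': "max M l \<le> M'"
    have "(\<Sum>k\<le>M'. p' k t * t m ^ k) = (\<Sum>k\<le>M'. (if k = l then q t * t m ^ k else 0) + p k t * t m ^ k)"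
      by (intro sum.cong) (auto simp: p'_def algebra_simps)
    also have "\<dots> = q t * t m ^ l + (\<Sum>k\<le>M'. p k t * t m ^ k)" using M' by (simp add: sum.distrib)
    finally show "q t * t m ^ l + f t = pfsum n m (\<lambda>k. p' k t) (\<lambda>j k. c j k t) M' t (t m)"
      using IH(3)[of M' t] M' by (simp add: pfsum_def)
  qed (use IH in auto)
next
  case (pole f q i l)
  then obtain M p c where IH: "\<And>k. p k \<in> reg n (Suc m)" "\<And>j k. c j k \<in> reg n (Suc m)"
    "\<And>M' t. M' \<ge> M \<Longrightarrow> f t = pfsum n m (\<lambda>k. p k t) (\<lambda>j k. c j k t) M' t (t m)" by blast
  define c' where "c' j k = (if j = i \<and> k = l then (\<lambda>t. q t + c j k t) else c j k)" for j k
  show ?case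
  proof (intro exI[of _ "max M l"] exI[of _ p] exI[of _ c'] conjI allI impI)
    show "c' j k \<in> reg n (Suc m)" for j k using IH pole by (auto simp: c'_def intro: reg.add)
    fix M' and t :: "nat \<Rightarrow> complex" assume M': "max M l \<le> M'"
    define Z where "Z j k = (t m - marked n t j) ^ Suc k" for j k
    have "(\<Sum>j\<in>Lab n (Suc m). \<Sum>k\<le>M'. c' j k t / Z j k) = (\<Sum>j\<in>Lab n (Suc m). \<Sum>k\<le>M'. (if k = l then if j = i then q t / Z j k else 0 else 0) + c j k t / Z j k)"
      by (intro sum.cong) (auto simp: c'_def add_divide_distrib)
    also have "\<dots> = q t / Z i l + (\<Sum>j\<in>Lab n (Suc m). \<Sum>k\<le>M'. c j k t / Z j k)"
      using M' pole finite_Lab by (simp add: sum.distrib)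
    finally show "q t / (t m - marked n t i) ^ Suc l + f t = pfsum n m (\<lambda>k. p k t) (\<lambda>j k. c' j k t) M' t (t m)"
      using IH(3)[of M' t] M' by (simp add: pfsum_def Z_def)
  qed (use IH in auto)
qed

lemma reg_canonical:
  assumes m: "1 \<le> m" "m \<le> n - 3" "3 \<le> n" and f: "f \<in> reg n m"
  shows "\<exists>M p c. (\<forall>k. p k \<in> reg n (Suc m)) \<and> (\<forall>j k. c j k \<in> reg n (Suc m)) \<and>
    (\<forall>t. valid n m t \<longrightarrow> f t = pfsum n m (\<lambda>k. p k t) (\<lambda>j k. c j k t) M t (t m))"
proof -
  have "rpf n m (\<lambda>t. 1 * t m ^ 0)" using reg.const[of 1 n "Suc m"] by (intro rpf_poly) simp
  from reg_rpf_mult[OF m f this] obtain g where "g \<in> pf n m" "\<And>t. valid n m t \<Longrightarrow> f t = g t" by (auto simp: rpf_def)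
  then show ?thesis using pf_canonical[of g n m] by (metis order_refl)
qed


section \<open>Pole orders and residues\<close>

lemma bigo_1_tendsto_0:
  fixes f g :: "complex \<Rightarrow> complex"
  assumes "f \<in> O[at 0](\<lambda>_. 1)" "(g \<longlongrightarrow> 0) (at 0)"
  shows "((\<lambda>e. g e * f e) \<longlongrightarrow> 0) (at 0)"
proof -
  obtain C where C: "\<forall>\<^sub>F e in at 0. norm (f e) \<le> C * norm (1::complex)" using assms(1) by (rule landau_o.bigE)
  have "((\<lambda>e. norm (g e) * C) \<longlongrightarrow> 0) (at 0)" by (intro tendsto_mult_left_zero tendsto_norm_zero assms(2))
  then show ?thesis
    by (rule Lim_null_comparison[rotated]) (use C in \<open>auto elim!: eventually_mono simp: norm_mult intro!: mult_left_mono\<close>)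
qed

text \<open>Multiplying by the highest power of e isolates the most singular coefficient in the
  limit. Boundedness makes this limit 0, and the next lower power follows in the same way.\<close>

lemma singular_part_zero:
  fixes a :: "nat \<Rightarrow> complex"
  assumes "(\<lambda>e. (\<Sum>k\<le>M. a k / e ^ k) + h e) \<in> O[at 0](\<lambda>_. 1)" "(\<lambda>e. h e) \<in> O[at 0](\<lambda>_. 1)"
  shows "\<forall>k. 1 \<le> k \<and> k \<le> M \<longrightarrow> a k = 0"
  using assms
proof (induction M)
  case (Suc M)
  have S: "(\<lambda>e. \<Sum>k\<le>Suc M. a k / e ^ k) \<in> O[at 0](\<lambda>_. 1)" using sum_in_bigo(2)[OF Suc.prems] by (simp only: add_diff_cancel)
  have "((\<lambda>e. e ^ Suc M * (\<Sum>k\<le>Suc M. a k / e ^ k)) \<longlongrightarrow> 0) (at 0)"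
    by (rule bigo_1_tendsto_0[OF S]) (auto intro!: tendsto_eq_intros)
  moreover have "((\<lambda>e. e ^ Suc M * (\<Sum>k\<le>Suc M. a k / e ^ k)) \<longlongrightarrow> a (Suc M)) (at 0)"
  proof (rule Lim_transform_eventually)
    show "((\<lambda>e::complex. (\<Sum>k\<le>M. a k * e ^ (Suc M - k)) + a (Suc M)) \<longlongrightarrow> a (Suc M)) (at 0)"
    proof -
      have "((\<lambda>e::complex. (\<Sum>k\<le>M. a k * e ^ (Suc M - k)) + a (Suc M)) \<longlongrightarrow> (\<Sum>k\<le>M. a k * 0 ^ (Suc M - k)) + a (Suc M)) (at 0)"
        by (intro tendsto_intros)
      moreover have "(\<Sum>k\<le>M. a k * 0 ^ (Suc M - k)) = (0::complex)"
        by (intro sum.neutral) (auto simp: power_0_left)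
      ultimately show ?thesis by (simp only: add_0)
    qed
    have "(\<Sum>k\<le>M. a k * e ^ (Suc M - k)) + a (Suc M) = e ^ Suc M * (\<Sum>k\<le>Suc M. a k / e ^ k)" if "e \<noteq> 0" for e
    proof -
      have "e ^ Suc M * (\<Sum>k\<le>M. a k / e ^ k) = (\<Sum>k\<le>M. a k * e ^ (Suc M - k))"
        unfolding sum_distrib_left using that by (intro sum.cong) (auto simp: power_diff)
      moreover have "e ^ Suc M * (a (Suc M) / e ^ Suc M) = a (Suc M)" using that by simp
      ultimately show ?thesis by (simp only: sum.atMost_Suc distrib_left)
    qed
    then show "\<forall>\<^sub>F e in at 0. (\<Sum>k\<le>M. a k * e ^ (Suc M - k)) + a (Suc M) = e ^ Suc M * (\<Sum>k\<le>Suc M. a k / e ^ k)"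
      by (auto simp: eventually_at intro!: exI[of _ 1])
  qed
  ultimately have z: "a (Suc M) = 0" by (rule LIM_unique[symmetric])
  have "\<forall>k. 1 \<le> k \<and> k \<le> M \<longrightarrow> a k = 0"
  proof (rule Suc.IH)
    have "(\<lambda>e. (\<Sum>k\<le>M. a k / e ^ k) + h e) = (\<lambda>e. (\<Sum>k\<le>Suc M. a k / e ^ k) + h e)" by (simp add: z)
    then show "(\<lambda>e. (\<Sum>k\<le>M. a k / e ^ k) + h e) \<in> O[at 0](\<lambda>_. 1)" using Suc.prems(1) by simp
  qed (rule Suc.prems(2))
  then show ?case using z by (metis le_Suc_eq)
qed auto

lemma tendsto_bigo_1: "(f \<longlongrightarrow> (c::complex)) (at (0::complex)) \<Longrightarrow> f \<in> O[at 0](\<lambda>_. 1)"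
  by (rule bigoI_tendsto[where c=c]) auto

text \<open>Lagrange interpolation. The weights l are independent of p, so bounds at the nodes carry
  over to x for a whole family of polynomials.\<close>

lemma interpolation:
  fixes x :: complex and A :: "complex set"
  assumes "finite A"
  shows "\<exists>l. \<forall>p. degree p < card A \<longrightarrow> poly p x = (\<Sum>a\<in>A. l a * poly p a)"
proof -
  define L where "L a = (\<Prod>b\<in>A - {a}. smult (1 / (a - b)) [:-b, 1:])" for a
  have Lp: "poly (L a) y = (\<Prod>b\<in>A - {a}. (y - b) / (a - b))" for a y
    by (simp add: L_def poly_prod diff_divide_distrib)
  have deg: "degree (L a) < card A" if "a \<in> A" for a
  proof -
    have "degree (L a) \<le> (\<Sum>b\<in>A - {a}. degree (smult (1 / (a - b)) [:-b, 1:]))"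
      unfolding L_def using degree_prod_sum_le[of "A - {a}" "\<lambda>b. smult (1 / (a - b)) [:-b, 1:]"] assms by (simp add: o_def)
    also have "\<dots> \<le> (\<Sum>b\<in>A - {a}. 1)"
      by (intro sum_mono order_trans[OF degree_smult_le]) simp
    also have "\<dots> < card A" using card_Diff1_less[OF assms that] by simp
    finally show ?thesis .
  qed
  have L1: "poly (L a) a = 1" for a
  proof -
    have "(a - b) / (a - b) = 1" if "b \<in> A - {a}" for b
      using that by (intro divide_self) auto
    then show ?thesis unfolding Lp by (rule prod.neutral[OF ballI])
  qed
  have L0: "poly (L a) y = 0" if "y \<in> A" "a \<noteq> y" for a y
    unfolding Lp using that assms by (subst prod_zero_iff) auto
  have "poly p x = (\<Sum>a\<in>A. poly (L a) x * poly p a)" if "degree p < card A" for p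
  proof -
    define q where "q = (\<Sum>a\<in>A. smult (poly p a) (L a))"
    have "degree q < card A" unfolding q_def
    proof (rule degree_sum_less)
      show "degree (smult (poly p a) (L a)) < card A" if "a \<in> A" for a
        by (rule le_less_trans[OF degree_smult_le deg[OF that]])
    qed (use that in linarith)
    moreover have "poly q y = poly p y" if y: "y \<in> A" for y
    proof -
      have "poly q y = (\<Sum>a\<in>A. if a = y then poly p a else 0)"
        unfolding q_def poly_sum using L1 L0[OF y] by (intro sum.cong) auto
      then show ?thesis using y assms by simp
    qed
    ultimately have "q = p" using that by (intro poly_eqI_degree[of A]) auto
    then have "poly p x = poly q x" by simp
    then show ?thesis unfolding q_def poly_sum by (simp add: mult.commute)
  qed
  then show ?thesis by (intro exI[of _ "\<lambda>a. poly (L a) x"] allI impI)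
qed

lemma infinite_avoid: "finite B \<Longrightarrow> \<exists>A::complex set. finite A \<and> card A = N \<and> A \<inter> B = {}"
proof -
  assume "finite B"
  then have "infinite (UNIV - B :: complex set)" by (simp add: infinite_UNIV_char_0 Diff_infinite_finite)
  from infinite_arbitrarily_large[OF this, of N] show ?thesis by auto
qed

lemma bigo_prod_1:
  fixes f :: "nat \<Rightarrow> complex \<Rightarrow> complex"
  shows "(\<And>i. i \<in> I \<Longrightarrow> f i \<in> O[at 0](\<lambda>_. 1)) \<Longrightarrow> (\<lambda>e. \<Prod>i\<in>I. f i e) \<in> O[at 0](\<lambda>_. 1)"
proof (induction I rule: infinite_finite_induct)
  case (insert i I)
  have "(\<lambda>e. f i e * (\<Prod>i\<in>I. f i e)) \<in> O[at 0](\<lambda>e. 1 * 1)" using insert by (intro landau_o.big.mult) auto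
  then show ?case using insert by simp
qed auto

text \<open>After clearing denominators the sum is a polynomial in X of bounded degree, so a growth
  bound at enough generic points X transfers by interpolation to the pole X = x, where only the
  residue c j survives.\<close>
lemma residue_bigo:
  fixes c \<nu> a b :: "nat \<Rightarrow> complex \<Rightarrow> complex" and g :: "complex \<Rightarrow> complex"
  assumes L: "finite L" "j \<in> L" and B: "finite B"
    and a: "\<And>k. k \<in> L \<Longrightarrow> a k \<in> O[at 0](\<lambda>_. 1)" and b: "\<And>k. k \<in> L \<Longrightarrow> b k \<in> O[at 0](\<lambda>_. 1)"
    and O: "\<And>X. X \<notin> B \<Longrightarrow> (\<lambda>e. \<Sum>k\<in>L. c k e * \<nu> k e / (a k e * X - b k e)) \<in> O[at 0](g)"
    and nz: "\<And>X k. X \<notin> B \<Longrightarrow> k \<in> L \<Longrightarrow> \<forall>\<^sub>F e in at 0. a k e * X - b k e \<noteq> 0"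
    and j: "\<forall>\<^sub>F e in at 0. a j e * x = b j e" "\<forall>\<^sub>F e in at 0. \<nu> j e = 1"
    and lim: "\<And>k. k \<in> L \<Longrightarrow> k \<noteq> j \<Longrightarrow> \<exists>l. l \<noteq> 0 \<and> ((\<lambda>e. a k e * x - b k e) \<longlongrightarrow> l) (at 0)"
  shows "c j \<in> O[at 0](g)"
proof -
  define P where "P e = (\<Sum>k\<in>L. smult (c k e * \<nu> k e) (\<Prod>l\<in>L - {k}. [:- b l e, a l e:]))" for e
  have P: "poly (P e) X = (\<Sum>k\<in>L. c k e * \<nu> k e * (\<Prod>l\<in>L - {k}. a l e * X - b l e))" for e X
    by (simp add: P_def poly_sum poly_prod mult.commute)
  have deg: "degree (P e) < card L" for e
  proof -
    have "degree (\<Prod>l\<in>L - {k}. [:- b l e, a l e:]) < card L" if "k \<in> L" for k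
    proof -
      have "degree (\<Prod>l\<in>L - {k}. [:- b l e, a l e:]) \<le> (\<Sum>l\<in>L - {k}. degree [:- b l e, a l e:])"
        using degree_prod_sum_le[of "L - {k}" "\<lambda>l. [:- b l e, a l e:]"] L by (simp add: o_def)
      also have "\<dots> \<le> (\<Sum>l\<in>L - {k}. 1)" by (intro sum_mono) auto
      also have "\<dots> < card L" using card_Diff1_less[OF L(1) that] by simp
      finally show ?thesis .
    qed
    moreover have "0 < card L" using L by (auto simp: card_gt_0_iff)
    ultimately show ?thesis unfolding P_def by (intro degree_sum_less) (auto intro: le_less_trans[OF degree_smult_le])
  qed
  obtain A where A: "finite A" "card A = card L" "A \<inter> B = {}" using infinite_avoid[OF B] by blast
  obtain l where l: "\<And>p. degree p < card A \<Longrightarrow> poly p x = (\<Sum>y\<in>A. l y * poly p y)" using interpolation[OF A(1)] by blast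
  have OP: "(\<lambda>e. poly (P e) X) \<in> O[at 0](g)" if "X \<notin> B" for X
  proof -
    have "(\<lambda>e. (\<Sum>k\<in>L. c k e * \<nu> k e / (a k e * X - b k e)) * (\<Prod>l\<in>L. a l e * X - b l e)) \<in> O[at 0](\<lambda>e. g e * 1)"
    proof (intro landau_o.big.mult O that bigo_prod_1)
      fix i assume "i \<in> L"
      have "(\<lambda>e. X * a i e - b i e) \<in> O[at 0](\<lambda>_. 1)"
        using a[OF \<open>i \<in> L\<close>] b[OF \<open>i \<in> L\<close>] by (cases "X = 0") (auto intro!: sum_in_bigo)
      then show "(\<lambda>e. a i e * X - b i e) \<in> O[at 0](\<lambda>_. 1)" by (simp add: mult.commute)
    qed
    moreover have "\<forall>\<^sub>F e in at 0. \<forall>k\<in>L. a k e * X - b k e \<noteq> 0"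
      using nz[OF that] L by (simp add: eventually_ball_finite)
    then have "\<forall>\<^sub>F e in at 0. (\<Sum>k\<in>L. c k e * \<nu> k e / (a k e * X - b k e)) * (\<Prod>l\<in>L. a l e * X - b l e) = poly (P e) X"
    proof eventually_elim
      case (elim e)
      have "c k e * \<nu> k e / (a k e * X - b k e) * (\<Prod>l\<in>L. a l e * X - b l e) = c k e * \<nu> k e * (\<Prod>l\<in>L - {k}. a l e * X - b l e)" if "k \<in> L" for k
        using elim that L by (simp add: prod.remove[of L k])
      then show ?case unfolding P sum_distrib_right by (intro sum.cong) auto
    qed
    ultimately show ?thesis using landau_o.big.in_cong by fastforce
  qed
  have "(\<lambda>e. \<Sum>y\<in>A. l y * poly (P e) y) \<in> O[at 0](g)"
    using A OP by (intro big_sum_in_bigo) (auto simp: disjoint_iff)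
  then have Ox: "(\<lambda>e. poly (P e) x) \<in> O[at 0](g)" using l deg A by simp
  define Q where "Q e = (\<Prod>k\<in>L - {j}. a k e * x - b k e)" for e
  have ev: "\<forall>\<^sub>F e in at 0. poly (P e) x = c j e * Q e"
    using j
  proof eventually_elim
    case (elim e)
    \<comment> \<open>Every product that does not omit j contains the factor of j, which vanishes at
      x.\<close>
    have "(\<Prod>l\<in>L - {k}. a l e * x - b l e) = 0" if "k \<in> L" "k \<noteq> j" for k
      using that L elim by (intro prod_zero) auto
    then have "poly (P e) x = (\<Sum>k\<in>L. if k = j then c j e * Q e else 0)"
      unfolding P using elim by (intro sum.cong) (auto simp: Q_def)
    then show ?case using L by simp
  qed
  have "\<forall>k. \<exists>l. k \<in> L - {j} \<longrightarrow> l \<noteq> 0 \<and> ((\<lambda>e. a k e * x - b k e) \<longlongrightarrow> l) (at 0)" using lim by blast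
  then obtain m where m: "\<And>k. k \<in> L - {j} \<Longrightarrow> m k \<noteq> 0 \<and> ((\<lambda>e. a k e * x - b k e) \<longlongrightarrow> m k) (at 0)" by metis
  have Q: "(Q \<longlongrightarrow> (\<Prod>k\<in>L - {j}. m k)) (at 0)" unfolding Q_def[abs_def] using m by (intro tendsto_prod) auto
  have mz: "(\<Prod>k\<in>L - {j}. m k) \<noteq> 0" using m L by auto
  have "(\<lambda>e. inverse (Q e)) \<in> O[at 0](\<lambda>_. 1)" by (rule tendsto_bigo_1[OF tendsto_inverse[OF Q mz]])
  then have "(\<lambda>e. poly (P e) x * inverse (Q e)) \<in> O[at 0](\<lambda>e. g e * 1)" by (intro landau_o.big.mult Ox)
  moreover have "\<forall>\<^sub>F e in at 0. Q e \<noteq> 0" using tendsto_imp_eventually_ne[OF Q mz] .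
  then have "\<forall>\<^sub>F e in at 0. poly (P e) x * inverse (Q e) = c j e" using ev by eventually_elim simp
  ultimately show ?thesis using landau_o.big.in_cong by fastforce
qed

section \<open>Orders along divisors in the remaining coordinates\<close>

text \<open>The boundary divisors for the points labelled by \<open>Lab n m\<close> together with
  infinity.\<close>

definition divs :: "nat \<Rightarrow> nat \<Rightarrow> nat set set" where
  "divs n m = {S. S \<subseteq> Lab n m \<and> 2 \<le> card S \<and> S \<noteq> Lab n m}"

definition strat :: "nat \<Rightarrow> nat \<Rightarrow> nat set \<Rightarrow> (nat \<Rightarrow> complex) set" where
  "strat n m S = {x. inj_on x S \<and> inj_on x (Lab n m - S) \<and> (\<forall>k\<in>Lab n m - S. x k \<noteq> 0)}"

text \<open>\<open>volume_order\<close> with n replaced by the number of remaining points,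
  \<open>card (Lab n m) + 1\<close> when infinity is counted.\<close>

definition vol :: "nat \<Rightarrow> nat \<Rightarrow> nat set \<Rightarrow> int" where
  "vol n m S = (if 0 \<in> S \<and> n - 2 \<in> S then int (card S) - int (card (Lab n m)) - 1 else int (card S) - 2)"

definition logf :: "nat \<Rightarrow> nat \<Rightarrow> ((nat \<Rightarrow> complex) \<Rightarrow> complex) \<Rightarrow> bool" where
  "logf n m f \<longleftrightarrow> f \<in> reg n m \<and> (\<forall>S\<in>divs n m. \<forall>x\<in>strat n m S.
     (\<lambda>\<epsilon>. f (smoothing n S x \<epsilon>)) \<in> O[at 0](\<lambda>\<epsilon>. \<epsilon> powi (- 1 - vol n m S)))"

lemma log_forms_logf:
  assumes "5 \<le> n" "f \<in> log_forms n" shows "logf n 1 f"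
  unfolding logf_def
proof (intro conjI ballI)
  show "f \<in> reg n 1" using regular_functions_reg[of f n] assms by (simp add: log_forms_def)
  fix S x assume S: "S \<in> divs n 1" and x: "x \<in> strat n 1 S"
  have L: "Lab n 1 = {..n - 2}" by (auto simp: Lab_def)
  have Sn: "S \<subseteq> {..n - 2}" "S \<noteq> {..n - 2}" "2 \<le> card S" using S L by (auto simp: divs_def)
  have fin: "finite S" using Sn(1) finite_subset by blast
  have "card S < card {..n - 2}" using Sn by (intro psubset_card_mono) auto
  then have "2 \<le> card ({..<n} - S)" using Sn assms
    by (subst card_Diff_subset) (auto simp: fin)
  then have "S \<in> boundary_divisors n" using Sn assms by (auto simp: boundary_divisors_def)
  moreover have "x \<in> open_stratum n S" using x L by (auto simp: strat_def open_stratum_def)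
  moreover have "vol n 1 S = volume_order n S" unfolding vol_def volume_order_def L using assms by auto
  ultimately show "(\<lambda>\<epsilon>. f (smoothing n S x \<epsilon>)) \<in> O[at 0](\<lambda>\<epsilon>. \<epsilon> powi (- 1 - vol n 1 S))"
    using assms by (auto simp: log_forms_def pole_order_le_def)
qed

text \<open>The positions of the marked points on the smoothing before they are normalised by an
  affine map.\<close>

definition wpos :: "nat set \<Rightarrow> (nat \<Rightarrow> complex) \<Rightarrow> complex \<Rightarrow> nat \<Rightarrow> complex" where
  "wpos S x e k = (if k \<in> S then e * x k else x k)"

lemma smoothing_eq: "smoothing n S x e i = (wpos S x e i - wpos S x e 0) / (wpos S x e (n - 2) - wpos S x e 0)"
  by (simp add: smoothing_def wpos_def Let_def)

lemma eventually_nz_lim: "(f \<longlongrightarrow> (l::complex)) (at (0::complex)) \<Longrightarrow> l \<noteq> 0 \<Longrightarrow> \<forall>\<^sub>F e in at 0. f e \<noteq> 0"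
  by (rule tendsto_imp_eventually_ne)

text \<open>Points of the same component stay apart as long as e is nonzero. Points of different
  components are apart already in the limit, since those outside S avoid the node at 0.\<close>

lemma wpos_inj:
  assumes "x \<in> strat n m S" "finite (Lab n m)" "S \<subseteq> Lab n m"
  shows "\<forall>\<^sub>F e in at 0. inj_on (wpos S x e) (Lab n m)"
proof -
  have ne: "\<forall>\<^sub>F e::complex in at 0. e \<noteq> 0" by (simp add: eventually_at_filter)
  have "\<forall>\<^sub>F e in at 0. wpos S x e i \<noteq> wpos S x e j" if ij: "i \<in> Lab n m" "j \<in> Lab n m" "i \<noteq> j" for i j
  proof -
    consider "i \<in> S" "j \<in> S" | "i \<in> S" "j \<notin> S" | "i \<notin> S" "j \<in> S" | "i \<notin> S" "j \<notin> S" by blast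
    then show ?thesis
    proof cases
      case 1
      then have "x i \<noteq> x j" using assms ij by (auto simp: strat_def inj_on_def)
      then show ?thesis using 1 ne by (auto simp: wpos_def elim!: eventually_mono)
    next
      case 2
      then have "x j \<noteq> 0" using assms ij by (auto simp: strat_def)
      moreover have "((\<lambda>e. e * x i - x j) \<longlongrightarrow> 0 * x i - x j) (at 0)" by (intro tendsto_intros)
      ultimately have "\<forall>\<^sub>F e in at 0. e * x i - x j \<noteq> 0" by (intro eventually_nz_lim[where l="0 * x i - x j"]) auto
      then show ?thesis using 2 by (auto simp: wpos_def elim!: eventually_mono)
    next
      case 3
      then have "x i \<noteq> 0" using assms ij by (auto simp: strat_def)
      moreover have "((\<lambda>e. e * x j - x i) \<longlongrightarrow> 0 * x j - x i) (at 0)" by (intro tendsto_intros)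
      ultimately have "\<forall>\<^sub>F e in at 0. e * x j - x i \<noteq> 0" by (intro eventually_nz_lim[where l="0 * x j - x i"]) auto
      then show ?thesis using 3 by (auto simp: wpos_def elim!: eventually_mono)
    next
      case 4
      then have "x i \<noteq> x j" using assms ij by (auto simp: strat_def inj_on_def)
      then show ?thesis using 4 by (simp add: wpos_def)
    qed
  qed
  then have "\<forall>\<^sub>F e in at 0. \<forall>i\<in>Lab n m. \<forall>j\<in>Lab n m. i \<noteq> j \<longrightarrow> wpos S x e i \<noteq> wpos S x e j"
    using assms(2) by (auto intro!: eventually_ball_finite)
  then show ?thesis by (auto simp: inj_on_def elim!: eventually_mono)
qed

lemma marked_smoothing:
  assumes "inj_on (wpos S x e) (Lab n m)" "m \<le> n - 2" "3 \<le> n" "k \<in> Lab n m"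
  shows "marked n (smoothing n S x e) k = (wpos S x e k - wpos S x e 0) / (wpos S x e (n - 2) - wpos S x e 0)"
proof -
  have "0 \<in> Lab n m" "n - 2 \<in> Lab n m" "n - 2 \<noteq> 0" using assms by (auto simp: Lab_def)
  then have "wpos S x e (n - 2) \<noteq> wpos S x e 0" by (simp add: inj_on_eq_iff[OF assms(1)])
  then show ?thesis by (simp add: marked_def smoothing_eq)
qed

lemma valid_smoothing:
  assumes "inj_on (wpos S x e) (Lab n m)" "m \<le> n - 2" "3 \<le> n"
  shows "valid n m (smoothing n S x e)"
proof -
  have "0 \<in> Lab n m" "n - 2 \<in> Lab n m" "n - 2 \<noteq> 0" using assms by (auto simp: Lab_def)
  then have "wpos S x e (n - 2) - wpos S x e 0 \<noteq> 0" by (simp add: inj_on_eq_iff[OF assms(1)])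
  moreover have "marked n (smoothing n S x e) k = (wpos S x e k - wpos S x e 0) / (wpos S x e (n - 2) - wpos S x e 0)" if "k \<in> Lab n m" for k
    by (rule marked_smoothing[OF assms that])
  ultimately show ?thesis using assms(1) unfolding valid_def inj_on_def by auto
qed

lemma valid_upd: 
  assumes "valid n (Suc m) t" "1 \<le> m" "m \<le> n - 3" "3 \<le> n" "\<And>k. k \<in> Lab n (Suc m) \<Longrightarrow> T \<noteq> marked n t k"
  shows "valid n m (t(m := T))"
proof -
  have L: "Lab n m = insert m (Lab n (Suc m))" "m \<notin> Lab n (Suc m)" using assms by (auto simp: Lab_def)
  have k: "marked n (t(m := T)) k = marked n t k" if "k \<in> Lab n (Suc m)" for k
    using that by (intro marked_cong) auto
  have "marked n (t(m := T)) m = T" using assms by (auto simp: marked_def)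
  then show ?thesis unfolding valid_def L(1) using assms(1,5) k L(2)
    by (auto simp: inj_on_def valid_def)
qed

text \<open>Near the divisor {j, m} the point t m approaches the point j alone, and the logarithmic
  condition forbids a pole of order above 1. Near the divisor formed by all labels but m, t m tends
  to infinity, where dt has a double pole: a simple pole of the form means that f is O(e), and this
  excludes the polynomial part including its constant.\<close>

lemma log_partial_fraction:
  assumes m: "1 \<le> m" "m \<le> n - 3" "4 \<le> n" and f: "logf n m f"
  shows "\<exists>c. (\<forall>j. c j \<in> reg n (Suc m)) \<and> (\<forall>t. valid n m t \<longrightarrow> f t = (\<Sum>j\<in>Lab n (Suc m). c j t / (t m - marked n t j)))"
proof -
  have n3: "3 \<le> n" and m2: "m \<le> n - 2" using m by auto
  define L where "L = Lab n (Suc m)"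
  have LL: "Lab n m = insert m L" "m \<notin> L" "finite L" "0 \<in> L" "n - 2 \<in> L" "m \<noteq> 0" "m \<noteq> n - 2" "n - 2 \<noteq> 0" using m by (auto simp: Lab_def L_def)
  obtain M p c where pc: "\<And>k. p k \<in> reg n (Suc m)" "\<And>j k. c j k \<in> reg n (Suc m)"
    "\<And>t. valid n m t \<Longrightarrow> f t = pfsum n m (\<lambda>k. p k t) (\<lambda>j k. c j k t) M t (t m)"
    using reg_canonical[OF m(1,2) n3, of f] f by (auto simp: logf_def)
  have van: "(\<forall>j\<in>L. \<forall>k. 1 \<le> k \<and> k \<le> M \<longrightarrow> c j k t = 0) \<and> (\<forall>k\<le>M. p k t = 0)" if v: "valid n (Suc m) t" for t
  proof -
    define a where "a j = marked n t j" for j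
    have a0: "a 0 = 0" "a (n - 2) = 1" using LL by (auto simp: a_def marked_def)
    have ai: "inj_on a L" using v by (simp add: valid_def L_def a_def[abs_def])
    have ta: "t k = a k" if "k \<in> L" "k \<noteq> 0" "k \<noteq> n - 2" for k using that by (simp add: a_def marked_def)
    define F where "F T = pfsum n m (\<lambda>k. p k t) (\<lambda>j k. c j k t) M t T" for T
    have fF: "f s = F T" if s: "\<And>k. k \<in> L \<Longrightarrow> k \<noteq> 0 \<Longrightarrow> k \<noteq> n - 2 \<Longrightarrow> s k = a k" "s m = T" and T: "\<And>k. k \<in> L \<Longrightarrow> T \<noteq> a k" for s T
    proof -
      define s' where "s' = (\<lambda>k. if k \<in> L \<and> k \<noteq> 0 \<and> k \<noteq> n - 2 then s k else t k)"
      have agree: "marked n s k = marked n (t(m := T)) k" if "k \<in> Lab n m" for k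
        using that s LL ta by (auto simp: marked_def)
      have "f \<in> reg n m" using f by (simp add: logf_def)
      have vs: "valid n m s" 
      proof -
        have "valid n m (t(m := T))" by (rule valid_upd[OF v m(1,2) n3]) (use T in \<open>simp add: a_def L_def\<close>)
        then show ?thesis using agree unfolding valid_def inj_on_def by simp
      qed
      have "g s = g t" if "g \<in> reg n (Suc m)" for g
        using that
      proof (induction rule: reg.induct)
        case (coord i)
        then have "i \<in> L" "i \<noteq> 0" "i \<noteq> n - 2" using m by (auto simp: L_def Lab_def)
        then show ?case using s ta by simp
      next
        case (inv_diff i j)
        have "marked n s k = marked n t k" if "k \<in> L" for k using that s ta by (auto simp: marked_def)
        then show ?case using inv_diff by (simp add: L_def)
      qed auto
      then have e: "p k s = p k t" "c j k s = c j k t" for j k using pc by blast+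
      have mk: "marked n s k = marked n t k" if "k \<in> Lab n (Suc m)" for k
        using agree[of k] marked_cong[OF that, of "t(m := T)" t] that LL by (auto simp: L_def)
      have "pfsum n m (\<lambda>k. p k s) (\<lambda>j k. c j k s) M s T = F T"
        unfolding F_def pfsum_def e by (simp add: mk cong: sum.cong)
      then show ?thesis using pc(3)[OF vs] s by simp
    qed
    have pole: "c j k t = 0" if j: "j \<in> L" and k: "1 \<le> k" "k \<le> M" for j k
    proof -
      \<comment> \<open>Translation by \<open>a j\<close> moves the node to 0. Under this smoothing
        the points other than t m stay at \<open>a k\<close> and t m equals
        \<open>a j + e\<close>.\<close>
      define x where "x = (\<lambda>k. if k = j then 0 else if k = m then 1 else a k - a j)"
      define S where "S = {j, m}"
      have jm: "j \<noteq> m" using j LL by auto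
      have card: "card S = 2" using jm by (simp add: S_def)
      have nS: "\<not> (0 \<in> S \<and> n - 2 \<in> S)" using LL jm by (auto simp: S_def)
      have "S \<noteq> Lab n m"
      proof
        assume "S = Lab n m" then have "0 \<in> S \<and> n - 2 \<in> S" using LL by auto
        then show False using nS by simp
      qed
      then have div: "S \<in> divs n m" using j card LL by (auto simp: divs_def S_def)
      have str: "x \<in> strat n m S"
      proof -
        have "inj_on x (Lab n m - S)" using ai by (auto simp: inj_on_def LL S_def x_def)
        moreover have "x k \<noteq> 0" if "k \<in> Lab n m - S" for k using that ai j by (auto simp: inj_on_def LL S_def x_def)
        ultimately show ?thesis using jm by (auto simp: strat_def S_def x_def)
      qed
      have "vol n m S = 0" unfolding vol_def if_not_P[OF nS] card by simp
      then have O: "(\<lambda>e. f (smoothing n S x e)) \<in> O[at 0](\<lambda>e. e powi (- 1))"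
        using f div str by (auto simp: logf_def)
      have w: "wpos S x e k = a k - a j" if "k \<in> L" for k e
        using that LL by (cases "k = j") (auto simp: wpos_def S_def x_def)
      have sm: "smoothing n S x e k = a k" if "k \<in> L" for k e
        using that w LL a0 by (simp add: smoothing_eq)
      have smm: "smoothing n S x e m = a j + e" for e
      proof -
        have "wpos S x e m = e" using jm by (simp add: wpos_def S_def x_def)
        then show ?thesis using w LL a0 by (simp add: smoothing_eq)
      qed
      have ev: "\<forall>\<^sub>F e in at 0. \<forall>k\<in>L. a j + e \<noteq> a k"
      proof (intro eventually_ball_finite LL ballI)
        fix k assume "k \<in> L"
        show "\<forall>\<^sub>F e in at 0. a j + e \<noteq> a k"
        proof (cases "k = j")
          case True then show ?thesis by (simp add: eventually_at_filter)
        next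
          case False
          then have "a j - a k \<noteq> 0" using ai j \<open>k \<in> L\<close> by (auto simp: inj_on_def)
          moreover have "((\<lambda>e. a j + e - a k) \<longlongrightarrow> a j + 0 - a k) (at 0)" by (intro tendsto_intros)
          ultimately have "\<forall>\<^sub>F e in at 0. a j + e - a k \<noteq> 0" by (intro eventually_nz_lim[where l="a j + 0 - a k"]) auto
          then show ?thesis by (auto elim!: eventually_mono)
        qed
      qed
      have "\<forall>\<^sub>F e in at 0. f (smoothing n S x e) = F (a j + e)"
        using ev by eventually_elim (intro fF, use sm smm in auto)
      then have "(\<lambda>e. F (a j + e)) \<in> O[at 0](\<lambda>e. e powi (- 1))" using O landau_o.big.in_cong by fast
      then have "(\<lambda>e. e * F (a j + e)) \<in> O[at 0](\<lambda>e. e * e powi (- 1))" by (intro landau_o.big.mult landau_o.big_refl)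
      moreover have "(\<lambda>e::complex. e * e powi (- 1)) \<in> O[at 0](\<lambda>_. 1)"
        by (rule bigoI[of _ 1]) (auto simp: eventually_at_filter power_int_minus)
      ultimately have O1: "(\<lambda>e. e * F (a j + e)) \<in> O[at 0](\<lambda>_. 1)" by (rule landau_o.big_trans)
      \<comment> \<open>The part of \<open>e * F (a j + e)\<close> that stays bounded; the terms of
        the point j itself form the singular part.\<close>
      define h where "h e = e * ((\<Sum>k\<le>M. p k t * (a j + e) ^ k) + (\<Sum>i\<in>L - {j}. \<Sum>k\<le>M. c i k t / (a j + e - a i) ^ Suc k))" for e
      have hl: "(h \<longlongrightarrow> 0 * ((\<Sum>k\<le>M. p k t * (a j + 0) ^ k) + (\<Sum>i\<in>L - {j}. \<Sum>k\<le>M. c i k t / (a j + 0 - a i) ^ Suc k))) (at 0)"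
        unfolding h_def[abs_def] using ai j by (intro tendsto_intros) (auto simp: inj_on_def)
      have hO: "h \<in> O[at 0](\<lambda>_. 1)" by (rule tendsto_bigo_1[OF hl])
      have "e * F (a j + e) = (\<Sum>k\<le>M. c j k t / e ^ k) + h e" if "e \<noteq> 0" for e
      proof -
        have "F (a j + e) = (\<Sum>k\<le>M. p k t * (a j + e) ^ k) + ((\<Sum>k\<le>M. c j k t / (a j + e - a j) ^ Suc k) + (\<Sum>i\<in>L - {j}. \<Sum>k\<le>M. c i k t / (a j + e - a i) ^ Suc k))"
          unfolding F_def pfsum_def L_def[symmetric] a_def[symmetric] using j LL by (simp add: sum.remove[of L j])
        moreover have "e * (\<Sum>k\<le>M. c j k t / (a j + e - a j) ^ Suc k) = (\<Sum>k\<le>M. c j k t / e ^ k)"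
          unfolding sum_distrib_left using that by (intro sum.cong) auto
        ultimately show ?thesis by (simp only: h_def distrib_left add_ac)
      qed
      then have "\<forall>\<^sub>F e in at 0. e * F (a j + e) = (\<Sum>k\<le>M. c j k t / e ^ k) + h e" by (simp add: eventually_at_filter)
      then have "(\<lambda>e. (\<Sum>k\<le>M. c j k t / e ^ k) + h e) \<in> O[at 0](\<lambda>_. 1)" using O1 landau_o.big.in_cong by fast
      from singular_part_zero[OF this hO] k show ?thesis by blast
    qed
    have poly: "p k t = 0" if k: "k \<le> M" for k
    proof -
      \<comment> \<open>Only m lies outside S. The smoothing shrinks all other points by e, and
        normalising them back to \<open>a k\<close> puts t m at 1/e.\<close>
      define x where "x = (\<lambda>k. if k = m then 1 else a k)"
      define S where "S = L"
      have S: "0 \<in> S" "n - 2 \<in> S" "m \<notin> S" "finite S" using LL by (auto simp: S_def)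
      have "2 \<le> card S"
      proof -
        have "card {0, n - 2} \<le> card S" using S by (intro card_mono) auto
        then show ?thesis using LL(8) by simp
      qed
      then have div: "S \<in> divs n m" using LL by (auto simp: divs_def S_def)
      have str: "x \<in> strat n m S" using ai by (auto simp: strat_def S_def LL x_def inj_on_def)
      have "card (Lab n m) = Suc (card S)" using LL by (simp add: S_def)
      then have "vol n m S = - 2" using S by (simp add: vol_def)
      then have O: "(\<lambda>e. f (smoothing n S x e)) \<in> O[at 0](\<lambda>e. e powi 1)"
        using f div str by (auto simp: logf_def)
      have w: "wpos S x e k = e * a k" if "k \<in> L" for k e
        using that LL by (auto simp: wpos_def S_def x_def)
      have sm: "smoothing n S x e k = a k" if "k \<in> L" "e \<noteq> 0" for k e
        using that w LL a0 by (simp add: smoothing_eq)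
      have smm: "smoothing n S x e m = 1 / e" for e
      proof -
        have "wpos S x e m = 1" using LL by (simp add: wpos_def S_def x_def)
        then show ?thesis using w LL a0 by (simp add: smoothing_eq)
      qed
      have ev: "\<forall>\<^sub>F e in at 0. \<forall>k\<in>L. 1 - e * a k \<noteq> 0"
      proof (intro eventually_ball_finite LL ballI)
        fix k
        have "((\<lambda>e. 1 - e * a k) \<longlongrightarrow> 1 - 0 * a k) (at 0)" by (intro tendsto_intros)
        then show "\<forall>\<^sub>F e in at 0. 1 - e * a k \<noteq> 0" by (rule eventually_nz_lim) auto
      qed
      have ne: "\<forall>\<^sub>F e::complex in at 0. e \<noteq> 0" by (simp add: eventually_at_filter)
      have "\<forall>\<^sub>F e in at 0. f (smoothing n S x e) = F (1 / e)"
        using ev ne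
      proof eventually_elim
        case (elim e)
        show ?case by (intro fF) (use sm smm elim in \<open>auto simp: field_simps\<close>)
      qed
      then have OF: "(\<lambda>e. F (1 / e)) \<in> O[at 0](\<lambda>e. e powi 1)" using O landau_o.big.in_cong by fast
      define h where "h e = (\<Sum>i\<in>L. \<Sum>k\<le>M. c i k t * (e / (1 - e * a i)) ^ Suc k)" for e
      have hl: "(h \<longlongrightarrow> (\<Sum>i\<in>L. \<Sum>k\<le>M. c i k t * (0 / (1 - 0 * a i)) ^ Suc k)) (at 0)"
        unfolding h_def[abs_def] by (intro tendsto_intros) auto
      have hO: "h \<in> O[at 0](\<lambda>_. 1)" by (rule tendsto_bigo_1[OF hl])
      have Fe: "\<forall>\<^sub>F e in at 0. F (1 / e) = (\<Sum>k\<le>M. p k t / e ^ k) + h e"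
        using ev ne
      proof eventually_elim
        case (elim e)
        have "1 / (1 / e - a i) = e / (1 - e * a i)" if "i \<in> L" for i
          using elim that by (simp add: field_simps)
        then have "c i k t / (1 / e - a i) ^ Suc k = c i k t * (e / (1 - e * a i)) ^ Suc k" if "i \<in> L" for i k
          using that by (metis divide_inverse inverse_eq_divide power_inverse)
        then have "(\<Sum>i\<in>L. \<Sum>k\<le>M. c i k t / (1 / e - a i) ^ Suc k) = (\<Sum>i\<in>L. \<Sum>k\<le>M. c i k t * (e / (1 - e * a i)) ^ Suc k)"
          by (intro sum.cong refl)
        moreover have "(\<Sum>k\<le>M. p k t * (1 / e) ^ k) = (\<Sum>k\<le>M. p k t / e ^ k)"
          by (simp add: power_one_over)
        ultimately show ?case unfolding F_def pfsum_def h_def L_def[symmetric] a_def[symmetric] by simp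
      qed
      have O1: "(\<lambda>e::complex. e powi 1) \<in> O[at 0](\<lambda>_. 1)" by (rule tendsto_bigo_1[where c=0]) (auto intro!: tendsto_eq_intros)
      have "(\<lambda>e. (\<Sum>k\<le>M. p k t / e ^ k) + h e) \<in> O[at 0](\<lambda>_. 1)"
        using landau_o.big_trans[OF OF O1] landau_o.big.in_cong[OF Fe] by blast
      from singular_part_zero[OF this hO] have z: "p k t = 0" if "1 \<le> k" "k \<le> M" for k using that by blast
      have "(\<Sum>k\<le>M. p k t / e ^ k) = p 0 t" for e
      proof -
        have "(\<Sum>k\<le>M. p k t / e ^ k) = (\<Sum>k\<in>{0}. p k t / e ^ k)"
          using z by (intro sum.mono_neutral_right) auto
        then show ?thesis by simp
      qed
      then have Fe': "\<forall>\<^sub>F e in at 0. F (1 / e) = p 0 t + h e" using Fe by simp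
      \<comment> \<open>\<open>singular_part_zero\<close> leaves open the constant
        \<open>p 0 t\<close>; it is 0 because \<open>F (1 / e)\<close> is O(e) and tends to
        it.\<close>
      have "((F \<circ> (\<lambda>e. 1 / e)) \<longlongrightarrow> p 0 t + 0) (at 0)"
      proof (rule Lim_transform_eventually)
        have "(\<Sum>i\<in>L. \<Sum>k\<le>M. c i k t * (0 / (1 - 0 * a i)) ^ Suc k) = 0" by simp
        then have "(h \<longlongrightarrow> 0) (at 0)" using hl by (simp only:)
        then show "((\<lambda>e. p 0 t + h e) \<longlongrightarrow> p 0 t + 0) (at 0)" by (intro tendsto_intros)
        show "\<forall>\<^sub>F e in at 0. p 0 t + h e = (F \<circ> (\<lambda>e. 1 / e)) e" using Fe' by eventually_elim simp
      qed
      moreover have "((F \<circ> (\<lambda>e. 1 / e)) \<longlongrightarrow> 0) (at 0)"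
      proof -
        obtain C where C: "\<forall>\<^sub>F e in at 0. norm (F (1 / e)) \<le> C * norm (e powi 1)" using OF by (rule landau_o.bigE)
        show ?thesis
        proof (rule Lim_null_comparison)
          show "\<forall>\<^sub>F e in at 0. norm ((F \<circ> (\<lambda>e. 1 / e)) e) \<le> C * norm (e powi 1)" using C by (simp add: o_def)
          have "((\<lambda>e::complex. C * norm (e powi 1)) \<longlongrightarrow> C * norm ((0::complex) powi 1)) (at 0)" by (intro tendsto_intros) auto
          then show "((\<lambda>e::complex. C * norm (e powi 1)) \<longlongrightarrow> 0) (at 0)" by simp
        qed
      qed
      ultimately have "p 0 t = 0" using tendsto_unique[of "at (0::complex)"] by fastforce
      then show ?thesis using z k by (cases "k = 0") auto
    qed
    show ?thesis using pole poly by blast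
  qed
  have "f t = (\<Sum>j\<in>L. c j 0 t / (t m - marked n t j))" if v: "valid n m t" for t
  proof -
    have "valid n (Suc m) t" using v LL by (auto simp: valid_def L_def intro: inj_on_subset)
    note vn = van[OF this]
    have "(\<Sum>k\<le>M. p k t * t m ^ k) = 0" using vn by (intro sum.neutral) auto
    moreover have "(\<Sum>k\<le>M. c j k t / (t m - marked n t j) ^ Suc k) = c j 0 t / (t m - marked n t j)" if "j \<in> L" for j
    proof -
      have "(\<Sum>k\<le>M. c j k t / (t m - marked n t j) ^ Suc k) = (\<Sum>k\<in>{0}. c j k t / (t m - marked n t j) ^ Suc k)"
        using vn that by (intro sum.mono_neutral_right) auto
      then show ?thesis by simp
    qed
    ultimately show ?thesis using pc(3)[OF v] by (simp add: pfsum_def L_def)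
  qed
  then show ?thesis using pc(2) unfolding L_def by (intro exI[of _ "\<lambda>j. c j 0"]) blast
qed

lemma powi_bigo_mult:
  fixes f h :: "complex \<Rightarrow> complex"
  assumes "f \<in> O[at 0](\<lambda>e. e powi k)" "h \<in> O[at 0](\<lambda>e. e powi l)"
  shows "(\<lambda>e. f e * h e) \<in> O[at 0](\<lambda>e. e powi (k + l))"
proof -
  have "(\<lambda>e. f e * h e) \<in> O[at 0](\<lambda>e. e powi k * e powi l)" by (rule landau_o.big.mult[OF assms])
  moreover have "\<forall>\<^sub>F e::complex in at 0. e powi k * e powi l = e powi (k + l)"
    by (auto simp: eventually_at_filter power_int_add)
  then have "O[at 0](\<lambda>e::complex. e powi k * e powi l) = O[at 0](\<lambda>e. e powi (k + l))" by (rule landau_o.big.cong)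
  ultimately show ?thesis by simp
qed

text \<open>A divisor S in the later coordinates has two lifts, S and \<open>insert m S\<close>,
  according to the component that carries t m. For the residue at j, t m is placed on the component
  of j in a generic position X. The bound for f then holds for all such X, and
  \<open>residue_bigo\<close> transfers it to the residue at the position of j.\<close>

lemma logf_residue:
  assumes m: "1 \<le> m" "m \<le> n - 3" "4 \<le> n" and f: "logf n m f"
    and c: "\<And>j. c j \<in> reg n (Suc m)" and fc: "\<And>t. valid n m t \<Longrightarrow> f t = (\<Sum>j\<in>Lab n (Suc m). c j t / (t m - marked n t j))"
    and j: "j \<in> Lab n (Suc m)"
  shows "logf n (Suc m) (c j)"
  unfolding logf_def
proof (intro conjI ballI c)
  fix S x assume S: "S \<in> divs n (Suc m)" and x: "x \<in> strat n (Suc m) S"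
  define L where "L = Lab n (Suc m)"
  have LL: "Lab n m = insert m L" "m \<notin> L" "finite L" "0 \<in> L" "n - 2 \<in> L" "m \<noteq> 0" "m \<noteq> n - 2" "n - 2 \<noteq> 0" 
    and n3: "3 \<le> n" and m2: "m \<le> n - 2" using m by (auto simp: Lab_def L_def)
  have SL: "S \<subseteq> L" "2 \<le> card S" "S \<noteq> L" "finite S" "m \<notin> S"
    using S LL finite_subset[of S L] by (auto simp: divs_def L_def)
  have xx: "inj_on x S" "inj_on x (L - S)" "\<And>k. k \<in> L \<Longrightarrow> k \<notin> S \<Longrightarrow> x k \<noteq> 0" using x by (auto simp: strat_def L_def)
  define w where "w k e = wpos S x e k" for k e
  define D where "D e = w (n - 2) e - w 0 e" for e
  define C where "C k e = c k (smoothing n S x e)" for k e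
  define e0 where "e0 = - 1 - vol n (Suc m) S"
  define \<delta> where "\<delta> \<longleftrightarrow> 0 \<in> S \<and> n - 2 \<in> S"
  have ne: "\<forall>\<^sub>F e::complex in at 0. e \<noteq> 0" by (simp add: eventually_at_filter)
  have wl: "(w k \<longlongrightarrow> (if k \<in> S then 0 else x k)) (at 0)" for k
  proof -
    have "w k = (\<lambda>e. if k \<in> S then e * x k else x k)" by (simp add: fun_eq_iff w_def wpos_def)
    then show ?thesis by (auto intro!: tendsto_eq_intros)
  qed
  have D0: "\<forall>\<^sub>F e in at 0. D e \<noteq> 0"
  proof -
    have "\<forall>\<^sub>F e in at 0. inj_on (wpos S x e) L" using wpos_inj[OF x] LL SL by (simp add: L_def)
    then show ?thesis by eventually_elim (use LL in \<open>simp add: D_def w_def inj_on_eq_iff\<close>)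
  qed
  \<comment> \<open>Differences of marked points are differences of unnormalised positions divided
    by D, so D comes out as a common factor. The residues do not depend on X, as they only see the
    later coordinates.\<close>
  have key: "\<forall>\<^sub>F e in at 0. f (smoothing n S' (x(m := X)) e) = D e * (\<Sum>k\<in>L. C k e / (wpos S' (x(m := X)) e m - w k e))"
    if S': "S' = S \<or> S' = insert m S" and st: "x(m := X) \<in> strat n m S'" for S' X
  proof -
    have "\<forall>\<^sub>F e in at 0. inj_on (wpos S' (x(m := X)) e) (Lab n m)"
      using S' SL LL by (intro wpos_inj[OF st]) auto
    then show ?thesis using D0
    proof eventually_elim
      case (elim e)
      define t where "t = smoothing n S' (x(m := X)) e"
      have wk: "wpos S' (x(m := X)) e k = w k e" if "k \<noteq> m" for k using that S' by (auto simp: wpos_def w_def)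
      have v: "valid n m t" unfolding t_def by (rule valid_smoothing[OF elim(1) m2 n3])
      have t: "t k = (wpos S' (x(m := X)) e k - w 0 e) / D e" for k
        unfolding t_def smoothing_eq D_def using wk[of 0] wk[of "n - 2"] LL by simp
      have mk: "marked n t k = (w k e - w 0 e) / D e" if "k \<in> L" for k
      proof -
        have "k \<in> Lab n m" "k \<noteq> m" using that LL by auto
        then show ?thesis unfolding t_def using marked_smoothing[OF elim(1) m2 n3, of k] wk LL by (simp add: D_def)
      qed
      have ct: "c k t = C k e" for k
        unfolding C_def t_def
      proof (rule reg_cong[OF c])
        fix i assume "Suc m \<le> i"
        then show "smoothing n S' (x(m := X)) e i = smoothing n S x e i"
          unfolding smoothing_eq using wk[of 0] wk[of "n - 2"] wk[of i] LL by (simp add: w_def)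
      qed
      have "f t = (\<Sum>k\<in>L. C k e / ((wpos S' (x(m := X)) e m - w 0 e) / D e - (w k e - w 0 e) / D e))"
        using fc[OF v] t[of m] mk by (simp add: L_def ct)
      also have "\<dots> = (\<Sum>k\<in>L. D e * (C k e / (wpos S' (x(m := X)) e m - w k e)))"
        using elim(2) by (intro sum.cong refl) (simp add: diff_divide_distrib[symmetric])
      finally show ?case by (simp add: t_def sum_distrib_left)
    qed
  qed
  have cardL: "card (Lab n m) = Suc (card L)" using LL by simp
  \<comment> \<open>D has order 1 in e exactly when S contains both 0 and n - 2. This matches the
    special case in \<open>vol\<close>, where the number of remaining points enters.\<close>
  have Dinv: "(\<lambda>e. inverse (D e)) \<in> O[at 0](\<lambda>e. e powi (if \<delta> then - 1 else 0))"
  proof (cases \<delta>)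
    case True
    then have "D e = e * (x (n - 2) - x 0)" for e by (simp add: \<delta>_def D_def w_def wpos_def algebra_simps)
    then have "(\<lambda>e. inverse (D e)) = (\<lambda>e. inverse (x (n - 2) - x 0) * inverse e)" by (simp add: fun_eq_iff)
    then show ?thesis using True by (simp add: power_int_minus)
  next
    case False
    have "\<exists>l. l \<noteq> 0 \<and> (D \<longlongrightarrow> l) (at 0)"
    proof -
      have "(D \<longlongrightarrow> (if n - 2 \<in> S then 0 else x (n - 2)) - (if 0 \<in> S then 0 else x 0)) (at 0)"
        unfolding D_def[abs_def] by (intro tendsto_diff wl)
      moreover have "(if n - 2 \<in> S then 0 else x (n - 2)) - (if 0 \<in> S then 0 else x 0) \<noteq> 0"
        using False xx(3)[of 0] xx(3)[of "n - 2"] inj_onD[OF xx(2), of "n - 2" 0] LL by (auto simp: \<delta>_def)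
      ultimately show ?thesis by blast
    qed
    then obtain l where "l \<noteq> 0" "(D \<longlongrightarrow> l) (at 0)" by blast
    from tendsto_inverse[OF this(2,1)] show ?thesis using False by (auto intro: tendsto_bigo_1)
  qed
  have OC: "C j \<in> O[at 0](\<lambda>e. e powi e0)"
  proof (cases "j \<in> S")
    case False
    have xj: "x j \<noteq> 0" using xx j False by (auto simp: L_def)
    \<comment> \<open>Besides the positions of the other points of its component, X has to avoid the
      node at 0.\<close>
    show ?thesis
    proof (rule residue_bigo[where L=L and B="insert 0 (x ` (L - S))" and \<nu>="\<lambda>_ _. 1" and a="\<lambda>_ _. 1" and b=w and x="x j"])
      fix X assume X: "X \<notin> insert 0 (x ` (L - S))"
      have st: "x(m := X) \<in> strat n m S"
      proof -
        have "Lab n m - S = insert m (L - S)" using LL SL by auto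
        moreover have "inj_on (x(m := X)) S" using xx(1) SL(5) by (auto simp: inj_on_def)
        moreover have "inj_on (x(m := X)) (insert m (L - S))"
        proof -
          have "inj_on (x(m := X)) (L - S)" using xx(2) LL(2) by (auto simp: inj_on_def)
          moreover have "X \<notin> (x(m := X)) ` (L - S - {m})" using X by auto
          ultimately show ?thesis by simp
        qed
        ultimately show ?thesis using X xx(3) LL by (auto simp: strat_def)
      qed
      have div: "S \<in> divs n m" using SL LL by (auto simp: divs_def)
      have wm: "wpos S (x(m := X)) e m = X" for e using SL by (simp add: wpos_def)
      have O: "(\<lambda>e. f (smoothing n S (x(m := X)) e)) \<in> O[at 0](\<lambda>e. e powi (- 1 - vol n m S))"
        using f div st by (auto simp: logf_def)
      have "- 1 - vol n m S + (if \<delta> then - 1 else 0) = e0"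
        unfolding e0_def vol_def cardL \<delta>_def L_def[symmetric] by auto
      with powi_bigo_mult[OF O Dinv] have "(\<lambda>e. f (smoothing n S (x(m := X)) e) * inverse (D e)) \<in> O[at 0](\<lambda>e. e powi e0)" by simp
      moreover have "\<forall>\<^sub>F e in at 0. f (smoothing n S (x(m := X)) e) * inverse (D e) = (\<Sum>k\<in>L. C k e * 1 / (1 * X - w k e))"
        using key[OF disjI1[OF refl] st] D0 by eventually_elim (simp add: wm)
      ultimately show "(\<lambda>e. \<Sum>k\<in>L. C k e * 1 / (1 * X - w k e)) \<in> O[at 0](\<lambda>e. e powi e0)"
        using landau_o.big.in_cong by fast
      fix k assume k: "k \<in> L"
      have "((\<lambda>e. 1 * X - w k e) \<longlongrightarrow> 1 * X - (if k \<in> S then 0 else x k)) (at 0)" by (intro tendsto_intros wl)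
      then show "\<forall>\<^sub>F e in at 0. 1 * X - w k e \<noteq> 0" by (rule eventually_nz_lim) (use X k in auto)
    next
      fix k assume k: "k \<in> L" "k \<noteq> j"
      have "((\<lambda>e. 1 * x j - w k e) \<longlongrightarrow> 1 * x j - (if k \<in> S then 0 else x k)) (at 0)" by (intro tendsto_intros wl)
      moreover have "1 * x j - (if k \<in> S then 0 else x k) \<noteq> 0" using xj k j False xx(2) by (auto simp: inj_on_def L_def)
      ultimately show "\<exists>l. l \<noteq> 0 \<and> ((\<lambda>e. 1 * x j - w k e) \<longlongrightarrow> l) (at 0)" by blast
    qed (use LL j False tendsto_bigo_1[OF wl] in \<open>auto simp: L_def w_def wpos_def\<close>)
  next
    case True
    \<comment> \<open>On this component t m sits at eX. Multiplication by e clears the scale: the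
      fraction of a label in S gets numerator factor 1 and a fixed denominator X - x k, the others
      keep a factor e.\<close>
    define \<nu> where "\<nu> k e = (if k \<in> S then 1 else e :: complex)" for k e
    have \<nu>l: "(\<nu> k \<longlongrightarrow> (if k \<in> S then 1 else 0)) (at 0)" for k
    proof -
      have "\<nu> k = (\<lambda>e. if k \<in> S then 1 else e)" by (simp add: fun_eq_iff \<nu>_def)
      then show ?thesis by (cases "k \<in> S") (simp_all add: tendsto_ident_at)
    qed
    show ?thesis
    proof (rule residue_bigo[where L=L and B="x ` S" and \<nu>=\<nu> and a=\<nu> and b="\<lambda>k e. x k" and x="x j"])
      fix X assume X: "X \<notin> x ` S"
      define S' where "S' = insert m S"
      have st: "x(m := X) \<in> strat n m S'"
      proof -
        have "Lab n m - S' = L - S" using LL SL by (auto simp: S'_def)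
        moreover have "inj_on (x(m := X)) S'"
        proof -
          have "inj_on (x(m := X)) S" using xx(1) SL(5) by (auto simp: inj_on_def)
          moreover have "X \<notin> (x(m := X)) ` (S - {m})" using X by auto
          ultimately show ?thesis by (simp add: S'_def)
        qed
        moreover have "inj_on (x(m := X)) (L - S)" using xx(2) LL(2) by (auto simp: inj_on_def)
        ultimately show ?thesis using xx(3) LL by (auto simp: strat_def)
      qed
      have cS: "card S' = Suc (card S)" using SL by (simp add: S'_def)
      have div: "S' \<in> divs n m" using SL LL cS by (auto simp: divs_def S'_def)
      have wm: "wpos S' (x(m := X)) e m = e * X" for e by (simp add: wpos_def S'_def)
      have O: "(\<lambda>e. f (smoothing n S' (x(m := X)) e)) \<in> O[at 0](\<lambda>e. e powi (- 1 - vol n m S'))"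
        using f div st by (auto simp: logf_def)
      have \<delta>': "0 \<in> S' \<and> n - 2 \<in> S' \<longleftrightarrow> \<delta>" using LL by (auto simp: \<delta>_def S'_def)
      have "1 + (- 1 - vol n m S' + (if \<delta> then - 1 else 0)) = e0"
        unfolding e0_def vol_def cardL \<delta>' \<delta>_def[symmetric] cS L_def[symmetric] by auto
      with powi_bigo_mult[OF _ powi_bigo_mult[OF O Dinv], of "\<lambda>e. e" 1] 
      have "(\<lambda>e. e * (f (smoothing n S' (x(m := X)) e) * inverse (D e))) \<in> O[at 0](\<lambda>e. e powi e0)" by simp
      moreover have "\<forall>\<^sub>F e in at 0. e * (f (smoothing n S' (x(m := X)) e) * inverse (D e)) = (\<Sum>k\<in>L. C k e * \<nu> k e / (\<nu> k e * X - x k))"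
        using key[OF disjI2[OF S'_def] st] D0 ne
      proof eventually_elim
        case (elim e)
        have "e * (f (smoothing n S' (x(m := X)) e) * inverse (D e)) = (\<Sum>k\<in>L. e * (C k e / (e * X - w k e)))"
          unfolding elim(1) wm sum_distrib_left[symmetric] using elim(2) by simp
        also have "\<dots> = (\<Sum>k\<in>L. C k e * \<nu> k e / (\<nu> k e * X - x k))"
        proof (intro sum.cong refl)
          fix k
          have "e * X - e * x k = e * (X - x k)" by (simp add: algebra_simps)
          then show "e * (C k e / (e * X - w k e)) = C k e * \<nu> k e / (\<nu> k e * X - x k)"
            using elim(3) by (simp add: w_def wpos_def \<nu>_def)
        qed
        finally show ?case .
      qed
      ultimately show "(\<lambda>e. \<Sum>k\<in>L. C k e * \<nu> k e / (\<nu> k e * X - x k)) \<in> O[at 0](\<lambda>e. e powi e0)"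
        using landau_o.big.in_cong by fast
      fix k assume k: "k \<in> L"
      have "((\<lambda>e. \<nu> k e * X - x k) \<longlongrightarrow> (if k \<in> S then 1 else 0) * X - x k) (at 0)" by (intro tendsto_intros \<nu>l)
      then show "\<forall>\<^sub>F e in at 0. \<nu> k e * X - x k \<noteq> 0" by (rule eventually_nz_lim) (use X k xx(3) in auto)
    next
      fix k assume k: "k \<in> L" "k \<noteq> j"
      have "((\<lambda>e. \<nu> k e * x j - x k) \<longlongrightarrow> (if k \<in> S then 1 else 0) * x j - x k) (at 0)" by (intro tendsto_intros \<nu>l)
      moreover have "(if k \<in> S then 1 else 0) * x j - x k \<noteq> 0" using k True xx(1,3) by (auto simp: inj_on_def)
      ultimately show "\<exists>l. l \<noteq> 0 \<and> ((\<lambda>e. \<nu> k e * x j - x k) \<longlongrightarrow> l) (at 0)" by blast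
    next
      show "\<nu> k \<in> O[at 0](\<lambda>_. 1)" for k by (rule tendsto_bigo_1[OF \<nu>l])
    qed (use LL SL j True in \<open>auto simp: L_def \<nu>_def\<close>)
  qed
  then show "(\<lambda>\<epsilon>. c j (smoothing n S x \<epsilon>)) \<in> O[at 0](\<lambda>\<epsilon>. \<epsilon> powi (- 1 - vol n (Suc m) S))"
    by (simp add: C_def[abs_def] e0_def)
qed

section \<open>Products of simple poles\<close>

definition tform :: "nat \<Rightarrow> nat \<Rightarrow> (nat \<Rightarrow> nat) \<Rightarrow> (nat \<Rightarrow> 'a) \<Rightarrow> 'a::field" where
  "tform n m a t = (\<Prod>i\<in>{m..n - 3}. 1 / (t i - marked n t (a i)))"

text \<open>Each i is tied to 0 or to a later label. Hence t m occurs in one factor only and can be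
  integrated first.\<close>

definition tarcs :: "nat \<Rightarrow> nat \<Rightarrow> (nat \<Rightarrow> nat) set" where
  "tarcs n m = {a. \<forall>i\<in>{m..n - 3}. a i \<in> Lab n (Suc i)}"

inductive_set tspan :: "nat \<Rightarrow> nat \<Rightarrow> ((nat \<Rightarrow> complex) \<Rightarrow> complex) set" for n m where
  zero: "(\<lambda>t. 0) \<in> tspan n m"
| add: "g \<in> tspan n m \<Longrightarrow> a \<in> tarcs n m \<Longrightarrow> (\<lambda>t. of_rat q * tform n m a t + g t) \<in> tspan n m"

lemma tspan_plus: "f \<in> tspan n m \<Longrightarrow> g \<in> tspan n m \<Longrightarrow> (\<lambda>t. f t + g t) \<in> tspan n m"
  by (induction rule: tspan.induct) (auto simp: add.assoc intro: tspan.intros)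

lemma tspan_sum: "finite L \<Longrightarrow> (\<And>j. j \<in> L \<Longrightarrow> f j \<in> tspan n m) \<Longrightarrow> (\<lambda>t. \<Sum>j\<in>L. f j t) \<in> tspan n m"
  by (induction L rule: finite_induct) (auto intro: tspan.zero tspan_plus)

lemma tspan_step:
  assumes "f \<in> tspan n (Suc m)" "j \<in> Lab n (Suc m)" "m \<le> n - 3"
  shows "(\<lambda>t. f t / (t m - marked n t j)) \<in> tspan n m"
  using assms(1)
proof (induction rule: tspan.induct)
  case zero then show ?case by (simp add: tspan.zero)
next
  case (add g a q)
  define b where "b = a(m := j)"
  have i: "{m..n - 3} = insert m {Suc m..n - 3}" using assms by auto
  have "b \<in> tarcs n m" using add assms by (auto simp: tarcs_def b_def i)
  moreover have "tform n m b t = tform n (Suc m) a t / (t m - marked n t j)" for t :: "nat \<Rightarrow> complex"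
  proof -
    have "(\<Prod>i\<in>{Suc m..n - 3}. 1 / (t i - marked n t (b i))) = (\<Prod>i\<in>{Suc m..n - 3}. 1 / (t i - marked n t (a i)))"
      by (intro prod.cong) (auto simp: b_def)
    then show ?thesis unfolding tform_def i by (simp add: b_def)
  qed
  ultimately have "(\<lambda>t. of_rat q * (tform n (Suc m) a t / (t m - marked n t j)) + g t / (t m - marked n t j)) \<in> tspan n m"
    using tspan.add[OF add.IH, of b q] by simp
  then show ?case by (simp add: add_divide_distrib)
qed

lemma reg_base: "f \<in> reg n (n - 2) \<Longrightarrow> 3 \<le> n \<Longrightarrow> \<exists>q. \<forall>t. f t = of_rat q"
proof (induction rule: reg.induct)
  case (inv_diff i j)
  then have "i = 0" "j = n - 2" by (auto simp: Lab_def)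
  then have "\<forall>t. 1 / (marked n t j - marked n t i) = (of_rat 1 :: complex)" using inv_diff by (auto simp: marked_def)
  then show ?case by blast
next
  case (add f g)
  then obtain p q where "\<And>t. f t = of_rat p" "\<And>t. g t = of_rat q" by blast
  then show ?case by (intro exI[of _ "p + q"]) (simp add: of_rat_add)
next
  case (mult f g)
  then obtain p q where "\<And>t. f t = of_rat p" "\<And>t. g t = of_rat q" by blast
  then show ?case by (intro exI[of _ "p * q"]) (simp add: of_rat_mult)
next
  case (coord i) then show ?case by linarith
qed blast

lemma logf_tspan:
  assumes "1 \<le> m" "m \<le> n - 2" "4 \<le> n" "logf n m f"
  shows "\<exists>g\<in>tspan n m. \<forall>t. valid n m t \<longrightarrow> f t = g t"
  using assms
proof (induction "n - 2 - m" arbitrary: m f)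
  case 0
  then have m: "m = n - 2" by linarith
  have n: "3 \<le> n" using 0(4) by linarith
  have em: "{m..n - 3} = {}" using m n by simp
  have "f \<in> reg n (n - 2)" using 0(5) unfolding logf_def m by blast
  from reg_base[OF this n] obtain q where q: "\<And>t. f t = of_rat q" by blast
  have "(\<lambda>_. 0) \<in> tarcs n m" unfolding tarcs_def em by simp
  then have "(\<lambda>t. of_rat q * tform n m (\<lambda>_. 0) t + 0) \<in> tspan n m" by (intro tspan.intros)
  moreover have "tform n m (\<lambda>_. 0) t = 1" for t :: "nat \<Rightarrow> complex" unfolding tform_def em by simp
  ultimately show ?case using q by (intro bexI[of _ "\<lambda>t. of_rat q * tform n m (\<lambda>_. 0) t + 0"]) simp_all
next
  case (Suc k)
  have m: "1 \<le> m" "m \<le> n - 3" "4 \<le> n" using Suc.hyps(2) Suc.prems(1-3) by linarith+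
  obtain c where c: "\<And>j. c j \<in> reg n (Suc m)" "\<And>t. valid n m t \<Longrightarrow> f t = (\<Sum>j\<in>Lab n (Suc m). c j t / (t m - marked n t j))"
    using log_partial_fraction[OF m Suc.prems(4)] by blast
  have pre: "k = n - 2 - Suc m" "1 \<le> Suc m" "Suc m \<le> n - 2" using Suc.hyps(2) m(1,2) by linarith+
  have ex: "\<exists>g\<in>tspan n (Suc m). \<forall>t. valid n (Suc m) t \<longrightarrow> c j t = g t" if j: "j \<in> Lab n (Suc m)" for j
    by (rule Suc.hyps(1)[OF pre m(3) logf_residue[OF m Suc.prems(4) c j]])
  define g where "g j = (SOME g. g \<in> tspan n (Suc m) \<and> (\<forall>t. valid n (Suc m) t \<longrightarrow> c j t = g t))" for j
  have gg: "g j \<in> tspan n (Suc m) \<and> (\<forall>t. valid n (Suc m) t \<longrightarrow> c j t = g j t)" if j: "j \<in> Lab n (Suc m)" for j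
  proof -
    have "\<exists>g. g \<in> tspan n (Suc m) \<and> (\<forall>t. valid n (Suc m) t \<longrightarrow> c j t = g t)" using ex[OF j] unfolding Bex_def .
    from someI_ex[OF this] show ?thesis unfolding g_def .
  qed
  have g: "g j \<in> tspan n (Suc m)" "valid n (Suc m) t \<Longrightarrow> c j t = g j t" if j: "j \<in> Lab n (Suc m)" for j t
    using gg[OF j] by simp_all
  have mem: "(\<lambda>t. \<Sum>j\<in>Lab n (Suc m). g j t / (t m - marked n t j)) \<in> tspan n m"
    by (rule tspan_sum[OF finite_Lab]) (rule tspan_step[OF g(1) _ m(2)])
  have eq: "f t = (\<Sum>j\<in>Lab n (Suc m). g j t / (t m - marked n t j))" if v: "valid n m t" for t
  proof -
    have "Lab n (Suc m) \<subseteq> Lab n m" by (auto simp: Lab_def)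
    from inj_on_subset[OF v[unfolded valid_def] this] have "valid n (Suc m) t" unfolding valid_def .
    then show ?thesis unfolding c(2)[OF v] by (intro sum.cong refl) (simp only: g(2))
  qed
  show ?case by (rule bexI[OF _ mem]) (intro allI impI, rule eq)
qed


section \<open>Integration over the cell\<close>

text \<open>Dividing by the highest power of L shows that the top coefficient is 0. Hence a
  polynomial in a divergent quantity can only converge if it is constant.\<close>

lemma poly_in_divergent_constant:
  fixes L :: "real \<Rightarrow> real"
  assumes L: "filterlim L at_bot F" "F \<noteq> bot" and lim: "((\<lambda>u. \<Sum>i\<le>d. L u ^ i * c i) \<longlongrightarrow> I) F"
  shows "I = c (0::nat)"
  using lim
proof (induction d)
  case 0
  then have "((\<lambda>u. c 0) \<longlongrightarrow> I) F" by simp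
  then show ?case using tendsto_unique[OF L(2) _ tendsto_const] by metis
next
  case (Suc d)
  have iL: "((\<lambda>u. inverse (L u)) \<longlongrightarrow> 0) F" by (rule tendsto_inverse_0[THEN filterlim_compose]) (rule filterlim_mono[OF L(1) at_bot_le_at_infinity order_refl])
  have ne: "\<forall>\<^sub>F u in F. L u \<noteq> 0"
    using filterlim_at_bot_dense[THEN iffD1, OF L(1), rule_format, of 0] by (rule eventually_mono) auto
  have "((\<lambda>u. inverse (L u) ^ Suc d * (\<Sum>i\<le>Suc d. L u ^ i * c i)) \<longlongrightarrow> 0 ^ Suc d * I) F"
    by (intro tendsto_intros iL Suc.prems)
  moreover have "\<forall>\<^sub>F u in F. inverse (L u) ^ Suc d * (\<Sum>i\<le>Suc d. L u ^ i * c i) = (\<Sum>i\<le>d. inverse (L u) ^ (Suc d - i) * c i) + c (Suc d)"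
    using ne
  proof eventually_elim
    case (elim u)
    have inv: "inverse (L u) ^ k * (L u ^ k * z) = z" for k z
      using elim by (simp add: mult.assoc[symmetric] power_mult_distrib[symmetric])
    have "inverse (L u) ^ Suc d * (L u ^ i * c i) = inverse (L u) ^ (Suc d - i) * c i" if "i \<le> d" for i
    proof -
      have "inverse (L u) ^ Suc d = inverse (L u) ^ (Suc d - i) * inverse (L u) ^ i" using that by (simp add: power_add[symmetric])
      then show ?thesis by (simp only: mult.assoc inv)
    qed
    then have "(\<Sum>i\<le>d. inverse (L u) ^ Suc d * (L u ^ i * c i)) = (\<Sum>i\<le>d. inverse (L u) ^ (Suc d - i) * c i)"
      by (intro sum.cong refl) simp
    then show ?case by (simp only: sum.atMost_Suc distrib_left sum_distrib_left inv)
  qed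
  ultimately have "((\<lambda>u. (\<Sum>i\<le>d. inverse (L u) ^ (Suc d - i) * c i) + c (Suc d)) \<longlongrightarrow> 0 ^ Suc d * I) F"
    by (rule Lim_transform_eventually)
  moreover have "((\<lambda>u. (\<Sum>i\<le>d. inverse (L u) ^ (Suc d - i) * c i) + c (Suc d)) \<longlongrightarrow> (\<Sum>i\<le>d. 0 ^ (Suc d - i) * c i) + c (Suc d)) F"
    by (intro tendsto_intros iL)
  ultimately have "0 ^ Suc d * I = (\<Sum>i\<le>d. 0 ^ (Suc d - i) * c i) + c (Suc d)" using tendsto_unique[OF L(2)] by blast
  moreover have "(\<Sum>i\<le>d. 0 ^ (Suc d - i) * c i) = 0" by (intro sum.neutral) (auto simp: power_0_left)
  ultimately have "c (Suc d) = 0" by simp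
  then show ?case using Suc by simp
qed

lemma ln_1_minus_at_bot: "filterlim (\<lambda>u::real. ln (1 - u)) at_bot (at_left 1)" by real_asymp

text \<open>Existence of the integral makes both divergences cancel: at 0 it forces B = 0, and at T
  it leaves a convergent polynomial in the logarithm, which equals its constant term.\<close>

lemma regularised_integral:
  fixes f P p :: "real \<Rightarrow> real"
  assumes T: "0 < T"
    and P: "\<And>s. 0 < s \<Longrightarrow> s < T \<Longrightarrow> (P has_real_derivative f s) (at s)"
    and Pp: "\<And>s. 0 < s \<Longrightarrow> s < T \<Longrightarrow> P s = p s + B * ln s"
    and p0: "(p \<longlongrightarrow> 0) (at_right 0)"
    and ex: "((\<lambda>u. p (u * T) - (\<Sum>i\<le>d. ln (1 - u) ^ i * c i)) \<longlongrightarrow> 0) (at_left 1)"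
    and int: "integrable lborel (\<lambda>s. indicator {0<..<T} s * f s)"
  shows "(LINT s|lborel. indicator {0<..<T} s * f s) = c 0"
proof -
  define h where "h s = indicator {0<..<T} s * f s" for s
  define J where "J s = integral {0..s} h" for s
  have hi: "h integrable_on {0..T}" 
    using integrable_on_lborel[OF int] unfolding h_def[abs_def] by (rule integrable_on_subinterval) auto
  have Jc: "continuous_on {0..T} J" unfolding J_def[abs_def] by (rule indefinite_integral_continuous_1[OF hi])
  have JT: "J T = (LINT s|lborel. h s)"
  proof -
    have "(\<lambda>s. if s \<in> {0..T} then h s else 0) = h" by (auto simp: h_def fun_eq_iff)
    then have "J T = integral UNIV h" unfolding J_def using integral_restrict_UNIV[of "{0..T}" h] by simp
    then show ?thesis using integral_lborel[OF int] by (simp add: h_def[abs_def])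
  qed
  have J0: "J 0 = 0" by (simp add: J_def)
  have diff: "P b - P a = J b - J a" if "0 < a" "a \<le> b" "b < T" for a b
  proof -
    have "(f has_integral (P b - P a)) {a..b}"
      using that P by (intro fundamental_theorem_of_calculus) (auto simp: has_real_derivative_iff_has_vector_derivative[symmetric] intro: has_field_derivative_at_within)
    then have "(h has_integral (P b - P a)) {a..b}"
      by (rule has_integral_eq[rotated]) (use that in \<open>auto simp: h_def\<close>)
    then have "integral {a..b} h = P b - P a" by (rule integral_unique)
    moreover have "integral {0..a} h + integral {a..b} h = integral {0..b} h"
      using that by (intro Henstock_Kurzweil_Integration.integral_combine integrable_on_subinterval[OF hi]) auto
    ultimately show ?thesis by (simp add: J_def)
  qed
  \<comment> \<open>The constant of integration. It turns out to be 0, because p and the indefinite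
    integral both tend to 0 at 0 and B vanishes.\<close>
  define k where "k = P (T / 2) - J (T / 2)"
  have PJ: "P s = J s + k" if "0 < s" "s < T" for s
    using diff[of s "T / 2"] diff[of "T / 2" s] that T by (cases "s \<le> T / 2") (auto simp: k_def)
  have evr: "\<forall>\<^sub>F s in at_right 0. 0 < s \<and> s < T" using T by (auto simp: eventually_at_right_field intro!: exI[of _ T])
  have Jr: "(J \<longlongrightarrow> 0) (at_right 0)"
    using Jc T J0 by (auto simp: continuous_on_Icc_at_rightD dest: continuous_on_Icc_at_rightD)
  have Jl: "(J \<longlongrightarrow> J T) (at_left T)" using continuous_on_Icc_at_leftD[OF Jc T] .
  have "((\<lambda>s. B * ln s) \<longlongrightarrow> k) (at_right 0)"
  proof (rule Lim_transform_eventually)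
    have "((\<lambda>s. J s + k - p s) \<longlongrightarrow> 0 + k - 0) (at_right 0)" by (intro tendsto_intros Jr p0)
    then show "((\<lambda>s. J s + k - p s) \<longlongrightarrow> k) (at_right 0)" by simp
    show "\<forall>\<^sub>F s in at_right 0. J s + k - p s = B * ln s"
      using evr by eventually_elim (use PJ Pp in force)
  qed
  note Bl = this
  have B0: "B = 0"
  proof (rule ccontr)
    assume "B \<noteq> 0"
    then have "((\<lambda>s. (1 / B) * (B * ln s)) \<longlongrightarrow> (1 / B) * k) (at_right 0)" by (intro tendsto_intros Bl)
    then have "((\<lambda>s. ln s) \<longlongrightarrow> k / B) (at_right (0::real))" using \<open>B \<noteq> 0\<close> by simp
    moreover have "filterlim (\<lambda>s::real. ln s) at_infinity (at_right 0)"
      by (rule filterlim_mono[OF ln_at_0 at_bot_le_at_infinity order_refl])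
    ultimately show False using not_tendsto_and_filterlim_at_infinity[of "at_right (0::real)"] by fastforce
  qed
  then have k0: "k = 0" using Bl tendsto_unique[of "at_right (0::real)" "\<lambda>s. 0" k 0] by simp
  have "filterlim (\<lambda>u. u * T) (at_left T) (at_left 1)"
    unfolding filterlim_at using T by (auto intro!: tendsto_eq_intros simp: eventually_at_filter)
  from filterlim_compose[OF Jl this] have "((\<lambda>u. J (u * T)) \<longlongrightarrow> J T) (at_left 1)" .
  moreover have "\<forall>\<^sub>F u in at_left 1. J (u * T) = p (u * T)"
    using eventually_at_left_real[of 0 1]
  proof (rule eventually_mono)
    show "0 < (1::real)" by simp
    fix u :: real assume "u \<in> {0<..<1}"
    then have "0 < u * T" "u * T < T" using T by auto
    from PJ[OF this] Pp[OF this] show "J (u * T) = p (u * T)" using B0 k0 by simp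
  qed
  ultimately have "((\<lambda>u. p (u * T)) \<longlongrightarrow> J T) (at_left 1)" by (rule Lim_transform_eventually)
  from tendsto_diff[OF this ex] have "((\<lambda>u. \<Sum>i\<le>d. ln (1 - u) ^ i * c i) \<longlongrightarrow> J T) (at_left 1)" by simp
  from poly_in_divergent_constant[OF ln_1_minus_at_bot _ this] have "J T = c 0" by simp
  then show ?thesis using JT by (simp add: h_def)
qed

lemma hcoef_cong: "(\<And>a. a \<in> set w \<Longrightarrow> a \<noteq> 0 \<Longrightarrow> x a = x' a) \<Longrightarrow> hcoef x w N = hcoef x' w N"
proof (induction w arbitrary: N)
  case (Cons a w)
  then have IH: "hcoef x w N = hcoef x' w N" for N by simp
  then have "hcoef x w = hcoef x' w" by (simp add: fun_eq_iff)
  then show ?case using Cons.prems by simp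
qed simp

lemma hlog_cong: "(\<And>a. a \<in> set w \<Longrightarrow> a \<noteq> 0 \<Longrightarrow> x a = x' a) \<Longrightarrow> hlog x w s = hlog x' w s"
  unfolding hlog_def using hcoef_cong[of w x x'] by simp

lemma hspan_cser:
  assumes "\<Phi> \<in> hspan A K0 K" "adm A x q" "0 \<le> t" "q * t < 1"
  shows "summable (\<lambda>J. \<Phi> x J * t ^ J)"
proof -
  obtain C where "\<And>J. \<bar>\<Phi> x J\<bar> \<le> C * q ^ J" using hspan_bound[OF assms(1,2)] by blast
  then show ?thesis using assms by (intro summable_bounded[where C=C and q=q]) (auto simp: adm_def)
qed

section \<open>Partial integrals over the cell\<close>

text \<open>The cell in the remaining coordinates. No extensionality is imposed, so that coordinates
  already integrated can be left alone.\<close>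

definition ocell :: "nat \<Rightarrow> nat \<Rightarrow> (nat \<Rightarrow> real) set" where
  "ocell n m = {t. strict_mono_on (Lab n m) (marked n t)}"

text \<open>The integrands left when t 1, ..., t (m - 1) are integrated out: the inner integrations
  have produced a hyperlogarithm at t m in later letters. K restricts the constants at the empty
  word, the only word that survives at the last stage.\<close>

inductive_set fsp :: "nat \<Rightarrow> nat \<Rightarrow> real set \<Rightarrow> ((nat \<Rightarrow> real) \<Rightarrow> real) set" for n m K where
  zero: "(\<lambda>t. 0) \<in> fsp n m K"
| add: "g \<in> fsp n m K \<Longrightarrow> k \<in> mzv1 \<Longrightarrow> (w = [] \<longrightarrow> k \<in> K) \<Longrightarrow> a \<in> tarcs n m \<Longrightarrow> ok_word w \<Longrightarrow> set w \<subseteq> Lab n (Suc m) \<Longrightarrow>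
    (\<lambda>t. k * (tform n m a t * hlog (marked n t) w (marked n t m)) + g t) \<in> fsp n m K"

lemma fsp_plus: "f \<in> fsp n m K \<Longrightarrow> g \<in> fsp n m K \<Longrightarrow> (\<lambda>t. f t + g t) \<in> fsp n m K"
proof (induction rule: fsp.induct)
  case (add f k w a)
  have "(\<lambda>t. k * (tform n m a t * hlog (marked n t) w (marked n t m)) + (f t + g t)) \<in> fsp n m K"
    by (rule fsp.add) (use add in blast)+
  then show ?case by (simp only: add.assoc)
qed simp

lemma ocell_less: "t \<in> ocell n m \<Longrightarrow> i \<in> Lab n m \<Longrightarrow> j \<in> Lab n m \<Longrightarrow> i < j \<Longrightarrow> marked n t i < marked n t j"
  by (auto simp: ocell_def strict_mono_on_def)

lemma marked_0 [simp]: "marked n t 0 = 0" by (simp add: marked_def)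

text \<open>On the cell t m lies strictly below all later points, so 1/q fits strictly in
  between.\<close>

lemma adm_exists:
  assumes t: "t \<in> ocell n m" and m: "1 \<le> m" "m \<le> n - 2"
  shows "\<exists>q. adm {Suc m..n - 2} (marked n t) q \<and> q * marked n t m < 1" "0 < marked n t m"
proof -
  show T: "0 < marked n t m" using ocell_less[OF t, of 0 m] m by (auto simp: Lab_def)
  have gt: "marked n t m < marked n t a" if "a \<in> {Suc m..n - 2}" for a
    using ocell_less[OF t, of m a] that m by (auto simp: Lab_def)
  define M where "M = Max (insert 0 ((\<lambda>a. 1 / marked n t a) ` {Suc m..n - 2}))"
  have "M \<in> insert 0 ((\<lambda>a. 1 / marked n t a) ` {Suc m..n - 2})" unfolding M_def by (intro Max_in) auto
  then have "M < 1 / marked n t m" using gt T by (auto intro!: divide_strict_left_mono mult_pos_pos intro: less_trans)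
  then obtain q where q: "M < q" "q < 1 / marked n t m" using dense by blast
  have le: "x \<le> M" if "x \<in> insert 0 ((\<lambda>a. 1 / marked n t a) ` {Suc m..n - 2})" for x
    unfolding M_def using that by (intro Max_ge) auto
  have "0 < q" using le[of 0] q by simp
  moreover have "0 < marked n t a \<and> 1 / marked n t a < q" if "a \<in> {Suc m..n - 2}" for a
    using le[of "1 / marked n t a"] q gt[OF that] T that by (auto intro: le_less_trans)
  ultimately have "adm {Suc m..n - 2} (marked n t) q" by (auto simp: adm_def)
  moreover have "q * marked n t m < 1" using q T by (simp add: field_simps)
  ultimately show "\<exists>q. adm {Suc m..n - 2} (marked n t) q \<and> q * marked n t m < 1" by blast
qed

lemma Lab_Suc_eq: "Lab n (Suc m) = {0} \<union> {Suc m..n - 2}" by (simp add: Lab_def)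

lemma hspan_fsp:
  assumes "\<Phi> \<in> hspan {Suc m..n - 2} mzv_algebra mzv1" "k \<in> mzv1" "a \<in> tarcs n m" "1 \<le> m" "m \<le> n - 2"
  shows "\<exists>g\<in>fsp n m mzv_algebra. \<forall>t\<in>ocell n m. k * (tform n m a t * cser \<Phi> (marked n t) (marked n t m)) = g t"
  using assms(1)
proof (induction rule: hspan.induct)
  case zero
  show ?case by (rule bexI[OF _ fsp.zero]) (simp add: cser_def)
next
  case (add f c w)
  from add.IH obtain g where g: "g \<in> fsp n m mzv_algebra" "\<And>t. t \<in> ocell n m \<Longrightarrow> k * (tform n m a t * cser f (marked n t) (marked n t m)) = g t"
    by (elim bexE) (rule that, assumption, simp)
  have "(\<lambda>t. (k * c) * (tform n m a t * hlog (marked n t) w (marked n t m)) + g t) \<in> fsp n m mzv_algebra"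
  proof (rule fsp.add[OF g(1) mzv1_mult[OF assms(2) add.hyps(2)] _ assms(3) add.hyps(4)])
    show "w = [] \<longrightarrow> k * c \<in> mzv_algebra" using add.hyps(3) mzv1_mult_mzv[OF assms(2)] by blast
    show "set w \<subseteq> Lab n (Suc m)" unfolding Lab_Suc_eq by (rule add.hyps(5))
  qed
  then show ?case
  proof (rule bexI[rotated], intro ballI)
    fix t assume t: "t \<in> ocell n m"
    obtain q where q: "adm {Suc m..n - 2} (marked n t) q" "q * marked n t m < 1" using adm_exists(1)[OF t assms(4,5)] by blast
    have T: "0 < marked n t m" by (rule adm_exists(2)[OF t assms(4,5)])
    have s1: "summable (\<lambda>J. f (marked n t) J * marked n t m ^ J)" by (rule hspan_cser[OF add.hyps(1) q(1) _ q(2)]) (use T in simp)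
    have s2: "summable (\<lambda>J. hcoef (marked n t) w J * marked n t m ^ J)"
      using T q(2) by (intro hlog_summable[OF adm_wbnd[OF q(1) add.hyps(5)]]) simp
    have "cser (\<lambda>x J. c * hcoef x w J + f x J) (marked n t) (marked n t m) = (\<Sum>J. c * (hcoef (marked n t) w J * marked n t m ^ J) + f (marked n t) J * marked n t m ^ J)"
      unfolding cser_def by (intro suminf_cong) (simp add: algebra_simps)
    also have "\<dots> = c * hlog (marked n t) w (marked n t m) + cser f (marked n t) (marked n t m)"
      unfolding hlog_def cser_def suminf_add[OF summable_mult[OF s2] s1, symmetric] suminf_mult[OF s2] ..
    finally have eq: "cser (\<lambda>x J. c * hcoef x w J + f x J) (marked n t) (marked n t m) = c * hlog (marked n t) w (marked n t m) + cser f (marked n t) (marked n t m)" .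
    show "k * (tform n m a t * cser (\<lambda>x J. c * hcoef x w J + f x J) (marked n t) (marked n t m)) = (k * c) * (tform n m a t * hlog (marked n t) w (marked n t m)) + g t"
      unfolding eq g(2)[OF t, symmetric] by (simp add: algebra_simps)
  qed
qed

lemma tform_upd:
  fixes t :: "nat \<Rightarrow> 'a::field"
  assumes "1 \<le> m" "m \<le> n - 3" "4 \<le> n" "a \<in> tarcs n m"
  shows "tform n m a (t(m := s)) = (1 / (s - marked n t (a m))) * tform n (Suc m) a t"
proof -
  have i: "{m..n - 3} = insert m {Suc m..n - 3}" using assms by auto
  have mk: "marked n (t(m := s)) j = marked n t j" if "j \<in> Lab n (Suc m)" for j and s :: 'a
    using that by (intro marked_cong) auto
  have "a i \<in> Lab n (Suc m)" if "i \<in> {m..n - 3}" for i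
  proof -
    have "a i \<in> Lab n (Suc i)" using assms(4) that by (auto simp: tarcs_def)
    then show ?thesis using that by (auto simp: Lab_def)
  qed
  then have "(\<Prod>i\<in>{Suc m..n - 3}. 1 / ((t(m := s)) i - marked n (t(m := s)) (a i))) = (\<Prod>i\<in>{Suc m..n - 3}. 1 / (t i - marked n t (a i)))"
    using mk by (intro prod.cong) auto
  moreover have "a m \<in> Lab n (Suc m)" using assms by (auto simp: tarcs_def)
  ultimately show ?thesis unfolding tform_def i using mk by simp
qed

text \<open>The primitive in t m splits as p + B ln so that a logarithmic divergence at 0 is allowed;
  the regularised value at the upper end is the coefficient of the zeroth power of ln (1 - u).\<close>
definition antider :: "nat \<Rightarrow> nat \<Rightarrow> ((nat \<Rightarrow> real) \<Rightarrow> real) \<Rightarrow> ((nat \<Rightarrow> real) \<Rightarrow> real) \<Rightarrow> bool" where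
  "antider n m G G' \<longleftrightarrow> (\<exists>d \<Psi> p B. \<Psi> 0 = G' \<and> (\<forall>i>d. \<Psi> i = (\<lambda>t. 0)) \<and> (\<forall>t\<in>ocell n (Suc m).
     (\<forall>s. 0 < s \<and> s < marked n t (Suc m) \<longrightarrow> ((\<lambda>s. p t s + B t * ln s) has_real_derivative G (t(m := s))) (at s)) \<and>
     (p t \<longlongrightarrow> 0) (at_right 0) \<and>
     ((\<lambda>u. p t (u * marked n t (Suc m)) - (\<Sum>i\<le>d. ln (1 - u) ^ i * \<Psi> i t)) \<longlongrightarrow> 0) (at_left 1)))"

lemma antider_plus:
  assumes "antider n m G G'" "antider n m H H'"
  shows "antider n m (\<lambda>t. G t + H t) (\<lambda>t. G' t + H' t)"
proof -
  obtain d \<Psi> p B where 1: "\<Psi> 0 = G'" "\<And>i. i > d \<Longrightarrow> \<Psi> i = (\<lambda>t. 0)"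
    "\<And>t s. t \<in> ocell n (Suc m) \<Longrightarrow> 0 < s \<Longrightarrow> s < marked n t (Suc m) \<Longrightarrow> ((\<lambda>s. p t s + B t * ln s) has_real_derivative G (t(m := s))) (at s)"
    "\<And>t. t \<in> ocell n (Suc m) \<Longrightarrow> (p t \<longlongrightarrow> 0) (at_right 0)"
    "\<And>t. t \<in> ocell n (Suc m) \<Longrightarrow> ((\<lambda>u. p t (u * marked n t (Suc m)) - (\<Sum>i\<le>d. ln (1 - u) ^ i * \<Psi> i t)) \<longlongrightarrow> 0) (at_left 1)"
    using assms(1) unfolding antider_def by blast
  obtain e \<Theta> q C where 2: "\<Theta> 0 = H'" "\<And>i. i > e \<Longrightarrow> \<Theta> i = (\<lambda>t. 0)"
    "\<And>t s. t \<in> ocell n (Suc m) \<Longrightarrow> 0 < s \<Longrightarrow> s < marked n t (Suc m) \<Longrightarrow> ((\<lambda>s. q t s + C t * ln s) has_real_derivative H (t(m := s))) (at s)"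
    "\<And>t. t \<in> ocell n (Suc m) \<Longrightarrow> (q t \<longlongrightarrow> 0) (at_right 0)"
    "\<And>t. t \<in> ocell n (Suc m) \<Longrightarrow> ((\<lambda>u. q t (u * marked n t (Suc m)) - (\<Sum>i\<le>e. ln (1 - u) ^ i * \<Theta> i t)) \<longlongrightarrow> 0) (at_left 1)"
    using assms(2) unfolding antider_def by blast
  show ?thesis unfolding antider_def
  proof (intro exI[of _ "max d e"] exI[of _ "\<lambda>i t. \<Psi> i t + \<Theta> i t"] exI[of _ "\<lambda>t s. p t s + q t s"] exI[of _ "\<lambda>t. B t + C t"] conjI ballI allI impI)
    show "(\<lambda>t. \<Psi> 0 t + \<Theta> 0 t) = (\<lambda>t. G' t + H' t)" using 1(1) 2(1) by simp
    show "(\<lambda>t. \<Psi> i t + \<Theta> i t) = (\<lambda>t. 0)" if "max d e < i" for i using 1(2)[of i] 2(2)[of i] that by simp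
    fix t assume t: "t \<in> ocell n (Suc m)"
    { fix s assume s: "0 < s \<and> s < marked n t (Suc m)"
      have "((\<lambda>s. (p t s + B t * ln s) + (q t s + C t * ln s)) has_real_derivative (G (t(m := s)) + H (t(m := s)))) (at s)"
        using s by (intro DERIV_add 1(3)[OF t] 2(3)[OF t]) auto
      then show "((\<lambda>s. p t s + q t s + (B t + C t) * ln s) has_real_derivative (G (t(m := s)) + H (t(m := s)))) (at s)"
        by (simp add: algebra_simps) }
    show "((\<lambda>s. p t s + q t s) \<longlongrightarrow> 0) (at_right 0)" using tendsto_add[OF 1(4)[OF t] 2(4)[OF t]] by simp
    have s1: "(\<Sum>i\<le>max d e. ln (1 - u) ^ i * \<Psi> i t) = (\<Sum>i\<le>d. ln (1 - u) ^ i * \<Psi> i t)" for u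
      using 1(2) by (intro sum.mono_neutral_right) auto
    have s2: "(\<Sum>i\<le>max d e. ln (1 - u) ^ i * \<Theta> i t) = (\<Sum>i\<le>e. ln (1 - u) ^ i * \<Theta> i t)" for u
      using 2(2) by (intro sum.mono_neutral_right) auto
    have "(\<lambda>u. p t (u * marked n t (Suc m)) + q t (u * marked n t (Suc m)) - (\<Sum>i\<le>max d e. ln (1 - u) ^ i * (\<Psi> i t + \<Theta> i t)))
      = (\<lambda>u. (p t (u * marked n t (Suc m)) - (\<Sum>i\<le>d. ln (1 - u) ^ i * \<Psi> i t)) + (q t (u * marked n t (Suc m)) - (\<Sum>i\<le>e. ln (1 - u) ^ i * \<Theta> i t)))"
      unfolding distrib_left sum.distrib s1 s2 by (simp add: fun_eq_iff)
    then show "((\<lambda>u. p t (u * marked n t (Suc m)) + q t (u * marked n t (Suc m)) - (\<Sum>i\<le>max d e. ln (1 - u) ^ i * (\<Psi> i t + \<Theta> i t))) \<longlongrightarrow> 0) (at_left 1)"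
      using tendsto_add[OF 1(5)[OF t] 2(5)[OF t]] by simp
  qed
qed

text \<open>Prepending \<open>a m\<close> to \<open>w\<close> gives a primitive, and its expansion
  at the next point is that of a hyperlogarithm at a colliding letter. Only the single letter 0 has
  no power series: there the primitive is a multiple of ln and goes into the summand B.\<close>

lemma antider_term:
  assumes m: "1 \<le> m" "m \<le> n - 3" "4 \<le> n" and k: "k \<in> mzv1" and a: "a \<in> tarcs n m" and w: "ok_word w" "set w \<subseteq> Lab n (Suc m)"
  shows "\<exists>G'. antider n m (\<lambda>t. k * (tform n m a t * hlog (marked n t) w (marked n t m))) G' \<and>
    (\<exists>g\<in>fsp n (Suc m) mzv_algebra. \<forall>t\<in>ocell n (Suc m). G' t = g t)"
proof -
  define G where "G t = k * (tform n m a t * hlog (marked n t) w (marked n t m))" for t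
  have am: "a m \<in> Lab n (Suc m)" using a m by (auto simp: tarcs_def)
  have a': "a \<in> tarcs n (Suc m)" using a by (auto simp: tarcs_def)
  have m': "1 \<le> Suc m" "Suc m \<le> n - 2" using m by auto
  have Geq: "G (t(m := s)) = k * tform n (Suc m) a t * (hlog (marked n t) w s / (s - marked n t (a m)))" for t :: "nat \<Rightarrow> real" and s
  proof -
    have mm: "marked n (t(m := s)) m = s" using m by (auto simp: marked_def)
    have "hlog (marked n (t(m := s))) w s = hlog (marked n t) w s"
    proof (rule hlog_cong)
      fix b assume "b \<in> set w"
      then have "b \<in> Lab n (Suc m)" using w by auto
      then show "marked n (t(m := s)) b = marked n t b" by (intro marked_cong) auto
    qed
    then show ?thesis unfolding G_def mm tform_upd[OF m a] by simp
  qed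
  show ?thesis
  proof (cases "w = [] \<and> a m = 0")
    case True
    have "antider n m G (\<lambda>t. 0)" unfolding antider_def
    proof (intro exI[of _ 0] exI[of _ "\<lambda>i t. 0"] exI[of _ "\<lambda>t s. 0"] exI[of _ "\<lambda>t. k * tform n (Suc m) a t"] conjI allI impI ballI)
      fix t and s :: real assume "0 < s \<and> s < marked n t (Suc m)"
      then show "((\<lambda>s. 0 + k * tform n (Suc m) a t * ln s) has_real_derivative G (t(m := s))) (at s)"
        unfolding Geq using True by (auto intro!: derivative_eq_intros)
    qed auto
    then show ?thesis unfolding G_def[abs_def] by (intro exI[of _ "\<lambda>t. 0"] conjI bexI[OF _ fsp.zero]) auto
  next
    case False
    define v where "v = a m # w"
    have v: "ok_word v" "set v \<subseteq> {0, Suc m} \<union> {Suc (Suc m)..n - 2}" "v \<noteq> []"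
    proof -
      show "ok_word v" using False w by (auto simp: v_def ok_word_Cons)
      have "Lab n (Suc m) \<subseteq> {0, Suc m} \<union> {Suc (Suc m)..n - 2}" by (auto simp: Lab_def)
      then show "set v \<subseteq> {0, Suc m} \<union> {Suc (Suc m)..n - 2}" using am w by (auto simp: v_def)
    qed (simp add: v_def)
    obtain d \<Phi> where \<Phi>: "\<Phi> 0 \<in> hspan {Suc (Suc m)..n - 2} mzv_algebra mzv1" 
      "\<And>x q. adm {Suc (Suc m)..n - 2} x q \<Longrightarrow> 0 < x (Suc m) \<Longrightarrow> q * x (Suc m) < 1 \<Longrightarrow>
        ((\<lambda>u. hlog x v (u * x (Suc m)) - (\<Sum>i\<le>d. ln (1 - u) ^ i * cser (\<Phi> i) x (x (Suc m)))) \<longlongrightarrow> 0) (at_left 1)"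
      using hlog_expansion_mzv[OF _ _ _ v] by auto
    define \<Psi> where "\<Psi> i t = (if i \<le> d then k * (tform n (Suc m) a t * cser (\<Phi> i) (marked n t) (marked n t (Suc m))) else 0)" for i t
    have "antider n m G (\<Psi> 0)" unfolding antider_def
    proof (intro exI[of _ d] exI[of _ \<Psi>] exI[of _ "\<lambda>t s. k * tform n (Suc m) a t * hlog (marked n t) v s"] exI[of _ "\<lambda>t. 0"] conjI allI impI ballI refl)
      show "\<Psi> i = (\<lambda>t. 0)" if "d < i" for i using that by (simp add: \<Psi>_def fun_eq_iff)
      fix t assume t: "t \<in> ocell n (Suc m)"
      define T where "T = marked n t (Suc m)"
      have T: "0 < T" unfolding T_def by (rule adm_exists(2)[OF t m'])
      have wb: "wbnd (marked n t) (set v) (1 / T)"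
      proof -
        have "0 < marked n t b \<and> 1 / marked n t b \<le> 1 / T" if "b \<in> set v - {0}" for b
        proof -
          have "T \<le> marked n t b" using that v(2) ocell_less[OF t, of "Suc m" b] m' by (cases "b = Suc m") (auto simp: T_def Lab_def)
          then show ?thesis using T by (auto intro: divide_left_mono)
        qed
        then show ?thesis using T by (auto simp: wbnd_def)
      qed
      { fix s assume s: "0 < s \<and> s < marked n t (Suc m)"
        have "(hlog (marked n t) v has_real_derivative hlog (marked n t) w s / (s - (if a m = 0 then 0 else marked n t (a m)))) (at s)"
          unfolding v_def by (rule hlog_deriv[OF wb[unfolded v_def]]) (use s T v(1) in \<open>auto simp: v_def T_def\<close>)
        then have "((\<lambda>s. k * tform n (Suc m) a t * hlog (marked n t) v s) has_real_derivative k * tform n (Suc m) a t * (hlog (marked n t) w s / (s - marked n t (a m)))) (at s)"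
          by (intro DERIV_cmult) (auto split: if_splits)
        then show "((\<lambda>s. k * tform n (Suc m) a t * hlog (marked n t) v s + 0 * ln s) has_real_derivative G (t(m := s))) (at s)"
          unfolding Geq by simp }
      have "isCont (hlog (marked n t) v) 0" by (rule hlog_continuous[OF wb]) simp
      then have "(hlog (marked n t) v \<longlongrightarrow> 0) (at 0)" using v(3) by (simp add: isCont_def hlog_at_0)
      then have "(hlog (marked n t) v \<longlongrightarrow> 0) (at_right 0)" by (rule filterlim_mono[OF _ order_refl at_within_le_at])
      then show "((\<lambda>s. k * tform n (Suc m) a t * hlog (marked n t) v s) \<longlongrightarrow> 0) (at_right 0)" by (rule tendsto_mult_right_zero)
      obtain q where q: "adm {Suc (Suc m)..n - 2} (marked n t) q" "q * marked n t (Suc m) < 1" using adm_exists(1)[OF t m'] by blast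
      have lim: "((\<lambda>u. hlog (marked n t) v (u * T) - (\<Sum>i\<le>d. ln (1 - u) ^ i * cser (\<Phi> i) (marked n t) T)) \<longlongrightarrow> 0) (at_left 1)"
        using \<Phi>(2)[OF q(1) _ q(2)] T by (simp add: T_def)
      have "(\<lambda>u. k * tform n (Suc m) a t * hlog (marked n t) v (u * marked n t (Suc m)) - (\<Sum>i\<le>d. ln (1 - u) ^ i * \<Psi> i t))
        = (\<lambda>u. k * tform n (Suc m) a t * (hlog (marked n t) v (u * T) - (\<Sum>i\<le>d. ln (1 - u) ^ i * cser (\<Phi> i) (marked n t) T)))"
        by (simp add: fun_eq_iff \<Psi>_def T_def right_diff_distrib sum_distrib_left mult_ac)
      then show "((\<lambda>u. k * tform n (Suc m) a t * hlog (marked n t) v (u * marked n t (Suc m)) - (\<Sum>i\<le>d. ln (1 - u) ^ i * \<Psi> i t)) \<longlongrightarrow> 0) (at_left 1)"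
        using tendsto_mult_right_zero[OF lim] by simp
    qed
    moreover have "\<exists>g\<in>fsp n (Suc m) mzv_algebra. \<forall>t\<in>ocell n (Suc m). \<Psi> 0 t = g t"
      using hspan_fsp[OF \<Phi>(1) k a' m'] by (simp add: \<Psi>_def)
    ultimately show ?thesis unfolding G_def[abs_def] by blast
  qed
qed

lemma antider_fsp:
  assumes m: "1 \<le> m" "m \<le> n - 3" "4 \<le> n" and G: "G \<in> fsp n m K"
  shows "\<exists>G'. antider n m G G' \<and> (\<exists>g\<in>fsp n (Suc m) mzv_algebra. \<forall>t\<in>ocell n (Suc m). G' t = g t)"
  using G
proof (induction rule: fsp.induct)
  case zero
  have "antider n m (\<lambda>t. 0) (\<lambda>t. 0)" unfolding antider_def
    by (intro exI[of _ 0] exI[of _ "\<lambda>i t. 0"] exI[of _ "\<lambda>t s. 0"] exI[of _ "\<lambda>t. 0"]) auto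
  then show ?case by (intro exI[of _ "\<lambda>t. 0"] conjI bexI[OF _ fsp.zero]) auto
next
  case (add H k w a)
  obtain G' g where 1: "antider n m (\<lambda>t. k * (tform n m a t * hlog (marked n t) w (marked n t m))) G'" "g \<in> fsp n (Suc m) mzv_algebra" "\<And>t. t \<in> ocell n (Suc m) \<Longrightarrow> G' t = g t"
    using antider_term[OF m add(2,4,5,6)] by blast
  obtain H' h where 2: "antider n m H H'" "h \<in> fsp n (Suc m) mzv_algebra" "\<And>t. t \<in> ocell n (Suc m) \<Longrightarrow> H' t = h t"
    using add.IH by blast
  show ?case
    by (intro exI[of _ "\<lambda>t. G' t + H' t"] conjI antider_plus 1 2 bexI[OF _ fsp_plus[OF 1(2) 2(2)]]) (use 1(3) 2(3) in simp)
qed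

lemma antider_integral:
  assumes m: "1 \<le> m" "m \<le> n - 3" "4 \<le> n" and G: "antider n m G G'" and t: "t \<in> ocell n (Suc m)"
    and int: "integrable lborel (\<lambda>s. indicator {0<..<marked n t (Suc m)} s * G (t(m := s)))"
  shows "(LINT s|lborel. indicator {0<..<marked n t (Suc m)} s * G (t(m := s))) = G' t"
proof -
  obtain d \<Psi> p B where 1: "\<Psi> 0 = G'" 
    "\<And>s. 0 < s \<Longrightarrow> s < marked n t (Suc m) \<Longrightarrow> ((\<lambda>s. p t s + B t * ln s) has_real_derivative G (t(m := s))) (at s)"
    "(p t \<longlongrightarrow> 0) (at_right 0)"
    "((\<lambda>u. p t (u * marked n t (Suc m)) - (\<Sum>i\<le>d. ln (1 - u) ^ i * \<Psi> i t)) \<longlongrightarrow> 0) (at_left 1)"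
    using G t unfolding antider_def by blast
  have T: "0 < marked n t (Suc m)" by (rule adm_exists(2)[OF t]) (use m in auto)
  show ?thesis
    using regularised_integral[OF T 1(2) refl 1(3,4) int] 1(1) by simp
qed

section \<open>Measurability and Fubini's theorem\<close>

lemma (in product_sigma_finite) Fubini_insert:
  fixes f :: "_ \<Rightarrow> real"
  assumes I: "finite I" "i \<notin> I" and f: "integrable (Pi\<^sub>M (insert i I) M) f"
  shows "AE x in Pi\<^sub>M I M. integrable (M i) (\<lambda>y. f (x(i := y)))"
    and "integrable (Pi\<^sub>M I M) (\<lambda>x. \<integral>y. f (x(i := y)) \<partial>M i)"
proof -
  interpret I: finite_product_sigma_finite M I by standard fact
  interpret J: finite_product_sigma_finite M "{i}" by standard simp
  interpret P: pair_sigma_finite "Pi\<^sub>M I M" "Pi\<^sub>M {i} M" ..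
  have fb: "f \<in> borel_measurable (Pi\<^sub>M (insert i I) M)" using f by auto
  have f_int: "integrable (Pi\<^sub>M I M \<Otimes>\<^sub>M Pi\<^sub>M {i} M) (\<lambda>x. f (merge I {i} x))"
    by (rule integrable_distr[OF measurable_merge]) (use distr_merge[of I "{i}"] I f in simp)
  have mb: "(\<lambda>y. f (x(i := y))) \<in> borel_measurable (M i)" if "x \<in> space (Pi\<^sub>M I M)" for x
    using measurable_comp[OF measurable_component_update fb, OF that I(2)] unfolding comp_def .
  have eq: "f (merge I {i} (x, y)) = f (x(i := y i))" if "x \<in> space (Pi\<^sub>M I M)" for x y
    using that I by (intro arg_cong[where f=f]) (auto simp: merge_def space_PiM extensional_def PiE_def fun_eq_iff)
  have d: "distr (Pi\<^sub>M {i} M) (M i) (\<lambda>x. x i) = M i" by (rule distr_singleton)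
  have int_iff: "integrable (Pi\<^sub>M {i} M) (\<lambda>y. f (merge I {i} (x, y))) \<longleftrightarrow> integrable (M i) (\<lambda>y. f (x(i := y)))"
    if x: "x \<in> space (Pi\<^sub>M I M)" for x
  proof -
    have "integrable (M i) (\<lambda>y. f (x(i := y))) \<longleftrightarrow> integrable (distr (Pi\<^sub>M {i} M) (M i) (\<lambda>x. x i)) (\<lambda>y. f (x(i := y)))"
      by (simp only: d)
    also have "\<dots> \<longleftrightarrow> integrable (Pi\<^sub>M {i} M) (\<lambda>y. f (x(i := y i)))"
      by (rule integrable_distr_eq) (use mb[OF x] in auto)
    finally show ?thesis by (simp add: eq[OF x])
  qed
  show "AE x in Pi\<^sub>M I M. integrable (M i) (\<lambda>y. f (x(i := y)))"
    using P.AE_integrable_fst'[OF f_int] AE_space by eventually_elim (simp add: int_iff)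
  have "integrable (Pi\<^sub>M I M) (\<lambda>x. \<integral>y. f (merge I {i} (x, y)) \<partial>Pi\<^sub>M {i} M)" by (rule P.integrable_fst'[OF f_int])
  moreover have "(\<integral>y. f (merge I {i} (x, y)) \<partial>Pi\<^sub>M {i} M) = (\<integral>y. f (x(i := y)) \<partial>M i)" if x: "x \<in> space (Pi\<^sub>M I M)" for x
    unfolding eq[OF x] by (rule product_integral_singleton[OF mb[OF x]])
  ultimately show "integrable (Pi\<^sub>M I M) (\<lambda>x. \<integral>y. f (x(i := y)) \<partial>M i)"
    by (simp cong: Bochner_Integration.integrable_cong)
qed

abbreviation PL :: "nat \<Rightarrow> nat \<Rightarrow> (nat \<Rightarrow> real) measure" where
  "PL n m \<equiv> Pi\<^sub>M {m..n - 3} (\<lambda>_. lborel)"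

lemma marked_measurable:
  assumes "i \<in> Lab n m" shows "(\<lambda>t. marked n t i) \<in> borel_measurable (PL n m)"
proof -
  have "i = 0 \<or> (m \<le> i \<and> i \<le> n - 2)" using assms by (auto simp: Lab_def)
  moreover have "i \<in> {m..n - 3}" if "i \<noteq> n - 2" "m \<le> i" "i \<le> n - 2" using that by auto
  ultimately consider "i = 0" | "i \<noteq> 0" "i = n - 2" | "i \<noteq> 0" "i \<noteq> n - 2" "i \<in> {m..n - 3}" by blast
  then show ?thesis
  proof cases
    case 3
    then have "(\<lambda>t. marked n t i) = (\<lambda>t :: nat \<Rightarrow> real. t i)" by (simp add: marked_def)
    moreover have "(\<lambda>t. t i) \<in> measurable (PL n m) lborel" by (rule measurable_component_singleton[OF 3(3)])
    ultimately show ?thesis by simp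
  qed (simp_all add: marked_def)
qed

lemma conv_measurable:
  assumes "\<And>k. (\<lambda>t. f t k) \<in> borel_measurable M" "y \<in> borel_measurable M"
  shows "(\<lambda>t. conv (y t) (f t) k) \<in> borel_measurable M"
  by (induction k) (use assms in \<open>auto intro!: borel_measurable_divide borel_measurable_diff\<close>)

lemma hcoef_measurable:
  assumes "\<And>a. a \<in> set w \<Longrightarrow> (\<lambda>t. x t a) \<in> borel_measurable M"
  shows "(\<lambda>t. hcoef (x t) w N) \<in> borel_measurable M"
  using assms
proof (induction w arbitrary: N)
  case (Cons a w)
  have IH: "(\<lambda>t. hcoef (x t) w N) \<in> borel_measurable M" for N using Cons by simp
  have "(\<lambda>t. conv (x t a) (hcoef (x t) w) N) \<in> borel_measurable M"
    by (intro conv_measurable IH) (use Cons in simp)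
  then show ?case using IH[of N] by (cases "a = 0") (simp_all add: borel_measurable_divide)
qed simp

lemma hlog_measurable:
  assumes "\<And>a. a \<in> set w \<Longrightarrow> (\<lambda>t. x t a) \<in> borel_measurable M" "s \<in> borel_measurable M"
  shows "(\<lambda>t. hlog (x t) w (s t)) \<in> borel_measurable M"
  unfolding hlog_def
  by (intro borel_measurable_suminf borel_measurable_times hcoef_measurable borel_measurable_power assms)

lemma fsp_measurable:
  assumes "g \<in> fsp n m K" "1 \<le> m" "m \<le> n - 2"
  shows "g \<in> borel_measurable (PL n m)"
  using assms(1)
proof (induction rule: fsp.induct)
  case (add g k w a)
  have w: "(\<lambda>t. marked n t b) \<in> borel_measurable (PL n m)" if "b \<in> set w" for b
    using that add.hyps(6) by (intro marked_measurable) (auto simp: Lab_def)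
  have m: "(\<lambda>t. marked n t m) \<in> borel_measurable (PL n m)"
    using assms by (intro marked_measurable) (auto simp: Lab_def)
  have tf: "tform n m a \<in> borel_measurable (PL n m)"
    unfolding tform_def[abs_def]
  proof (intro borel_measurable_prod borel_measurable_divide borel_measurable_diff borel_measurable_const)
    fix i assume i: "i \<in> {m..n - 3}"
    show "(\<lambda>t. t i) \<in> borel_measurable (PL n m)" using measurable_component_singleton[OF i, of "\<lambda>_. lborel"] by simp
    have "a i \<in> Lab n (Suc i)" using add.hyps(4) i by (auto simp: tarcs_def)
    then show "(\<lambda>t. marked n t (a i)) \<in> borel_measurable (PL n m)"
      using i by (intro marked_measurable) (auto simp: Lab_def)
  qed
  show ?case
    by (intro borel_measurable_add borel_measurable_times borel_measurable_const hlog_measurable tf m w add.IH)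
qed simp

lemma ocell_measurable: "{t \<in> space (PL n m). t \<in> ocell n m} \<in> sets (PL n m)"
proof -
  have "{t \<in> space (PL n m). \<forall>r\<in>Lab n m. \<forall>s\<in>Lab n m. r < s \<longrightarrow> marked n t r < marked n t s} \<in> sets (PL n m)"
  proof (rule sets.sets_Collect_finite_All[OF _ finite_Lab], rule sets.sets_Collect_finite_All[OF _ finite_Lab])
    fix r s assume r: "r \<in> Lab n m" and s: "s \<in> Lab n m"
    have "{t \<in> space (PL n m). marked n t r < marked n t s} \<in> sets (PL n m)"
      by (rule borel_measurable_less[OF marked_measurable[OF r] marked_measurable[OF s]])
    then show "{t \<in> space (PL n m). r < s \<longrightarrow> marked n t r < marked n t s} \<in> sets (PL n m)"
      by (cases "r < s") simp_all
  qed
  moreover have "t \<in> ocell n m \<longleftrightarrow> (\<forall>r\<in>Lab n m. \<forall>s\<in>Lab n m. r < s \<longrightarrow> marked n t r < marked n t s)" for t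
    unfolding ocell_def strict_mono_on_def mem_Collect_eq by meson
  ultimately show ?thesis by (simp only:)
qed

lemma ocell_upd:
  assumes "1 \<le> m" "m \<le> n - 3" "4 \<le> n"
  shows "t(m := s) \<in> ocell n m \<longleftrightarrow> t \<in> ocell n (Suc m) \<and> 0 < s \<and> s < marked n t (Suc m)"
proof -
  have L: "Lab n m = insert m (Lab n (Suc m))" "m \<notin> Lab n (Suc m)" "0 \<in> Lab n (Suc m)" "Suc m \<in> Lab n (Suc m)" using assms by (auto simp: Lab_def)
  have k: "marked n (t(m := s)) j = marked n t j" if "j \<in> Lab n (Suc m)" for j
    using that by (intro marked_cong) auto
  have mm: "marked n (t(m := s)) m = s" using assms by (auto simp: marked_def)
  show ?thesis
  proof
    assume a: "t(m := s) \<in> ocell n m"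
    have "marked n t i < marked n t j" if "i \<in> Lab n (Suc m)" "j \<in> Lab n (Suc m)" "i < j" for i j
      using ocell_less[OF a, of i j] that k L by simp
    then have "t \<in> ocell n (Suc m)" by (auto simp: ocell_def strict_mono_on_def)
    moreover have "0 < s" using ocell_less[OF a, of 0 m] L k[OF L(3)] mm assms by simp
    moreover have "s < marked n t (Suc m)" using ocell_less[OF a, of m "Suc m"] L k[OF L(4)] mm by simp
    ultimately show "t \<in> ocell n (Suc m) \<and> 0 < s \<and> s < marked n t (Suc m)" by blast
  next
    assume a: "t \<in> ocell n (Suc m) \<and> 0 < s \<and> s < marked n t (Suc m)"
    have "marked n (t(m := s)) i < marked n (t(m := s)) j" if ij: "i \<in> Lab n m" "j \<in> Lab n m" "i < j" for i j
    proof -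
      consider "i = m" "j \<in> Lab n (Suc m)" | "j = m" "i \<in> Lab n (Suc m)" | "i \<in> Lab n (Suc m)" "j \<in> Lab n (Suc m)"
        using ij L by auto
      then show ?thesis
      proof cases
        case 1
        then have "Suc m \<le> j" using ij by simp
        then have "marked n t (Suc m) \<le> marked n t j"
          using ocell_less[of t n "Suc m" "Suc m" j] a 1 L by (cases "j = Suc m") auto
        then show ?thesis using 1 a k mm by simp
      next
        case 2
        then have "i = 0" using ij by (auto simp: Lab_def)
        then show ?thesis using 2 a mm k[OF L(3)] by simp
      next
        case 3
        then show ?thesis using ocell_less[of t n "Suc m" i j] a ij k by simp
      qed
    qed
    then show "t(m := s) \<in> ocell n m" by (auto simp: ocell_def strict_mono_on_def)
  qed
qed

interpretation lb: product_sigma_finite "\<lambda>_ :: nat. lborel :: real measure" ..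

text \<open>The regularised value is known to equal the inner integral only where the inner
  integrand is integrable, thus almost everywhere. For this reason the measurability of the new
  integrand is established separately.\<close>

lemma fsp_integral_step:
  assumes m: "1 \<le> m" "m \<le> n - 3" "4 \<le> n" and G: "G \<in> fsp n m K"
    and int: "integrable (PL n m) (\<lambda>t. indicator (ocell n m) t * G t)"
  shows "\<exists>g\<in>fsp n (Suc m) mzv_algebra. integrable (PL n (Suc m)) (\<lambda>t. indicator (ocell n (Suc m)) t * g t) \<and>
    (LINT t|PL n m. indicator (ocell n m) t * G t) = (LINT t|PL n (Suc m). indicator (ocell n (Suc m)) t * g t)"
proof -
  obtain G' g where g: "antider n m G G'" "g \<in> fsp n (Suc m) mzv_algebra" "\<And>t. t \<in> ocell n (Suc m) \<Longrightarrow> G' t = g t"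
    using antider_fsp[OF m G] by blast
  define f where "f t = indicator (ocell n m) t * G t" for t
  have ins: "{m..n - 3} = insert m {Suc m..n - 3}" using m by auto
  have fi: "integrable (Pi\<^sub>M (insert m {Suc m..n - 3}) (\<lambda>_. lborel)) f" using int unfolding ins f_def[abs_def] .
  have m': "m \<notin> {Suc m..n - 3}" "finite {Suc m..n - 3}" by auto
  have fu: "f (t(m := s)) = indicator (ocell n (Suc m)) t * (indicator {0<..<marked n t (Suc m)} s * G (t(m := s)))" for t s
    unfolding f_def indicator_def ocell_upd[OF m] by auto
  note Fub = lb.Fubini_insert[OF m'(2,1) fi]
  have AE: "AE t in PL n (Suc m). (LINT s|lborel. f (t(m := s))) = indicator (ocell n (Suc m)) t * g t"
    using Fub(1)
  proof eventually_elim
    case (elim t)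
    show ?case
    proof (cases "t \<in> ocell n (Suc m)")
      case True
      then have "f (t(m := s)) = indicator {0<..<marked n t (Suc m)} s * G (t(m := s))" for s using fu by simp
      then show ?thesis using antider_integral[OF m g(1) True] elim g(3)[OF True] True by simp
    next
      case False
      then show ?thesis by (simp add: fu)
    qed
  qed
  have gm: "(\<lambda>t. indicator (ocell n (Suc m)) t * g t) \<in> borel_measurable (PL n (Suc m))"
  proof (intro borel_measurable_times)
    show "g \<in> borel_measurable (PL n (Suc m))" using m by (intro fsp_measurable[OF g(2)]) auto
    show "(indicator (ocell n (Suc m)) :: _ \<Rightarrow> real) \<in> borel_measurable (PL n (Suc m))"
    proof -
      have "ocell n (Suc m) \<inter> space (PL n (Suc m)) = {t \<in> space (PL n (Suc m)). t \<in> ocell n (Suc m)}" by blast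
      then show ?thesis unfolding borel_measurable_indicator_iff using ocell_measurable by simp
    qed
  qed
  have "integrable (PL n (Suc m)) (\<lambda>t. indicator (ocell n (Suc m)) t * g t)"
    using integrable_cong_AE[OF borel_measurable_integrable[OF Fub(2)] gm AE] Fub(2) by blast
  moreover have "(LINT t|PL n m. f t) = (LINT t|PL n (Suc m). indicator (ocell n (Suc m)) t * g t)"
    unfolding ins lb.product_integral_insert[OF m'(2,1) fi]
    by (rule integral_cong_AE[OF borel_measurable_integrable[OF Fub(2)] gm AE])
  ultimately show ?thesis using g(2) unfolding f_def[abs_def] by blast
qed

text \<open>When no coordinate is left, the words can contain only the label 0; hence they are empty
  and their constants lie in K. The condition on K is imposed at this stage alone, because the
  rational form starts with constants in Q + Z and every integration step leads to constants in
  Z.\<close>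

lemma fsp_integral:
  assumes "1 \<le> m" "m \<le> n - 2" "4 \<le> n" "G \<in> fsp n m K" "m = n - 2 \<Longrightarrow> K \<subseteq> mzv_algebra"
    and "integrable (PL n m) (\<lambda>t. indicator (ocell n m) t * G t)"
  shows "(LINT t|PL n m. indicator (ocell n m) t * G t) \<in> mzv_algebra"
  using assms
proof (induction "n - 2 - m" arbitrary: m G K)
  case 0
  then have m: "m = n - 2" by linarith
  have em: "{m..n - 3} = {}" using m "0.prems"(3) by simp
  have Gm: "G t \<in> mzv_algebra" for t
    using "0.prems"(4)
  proof (induction rule: fsp.induct)
    case zero show ?case by (rule mzv_algebra_0)
  next
    case (add g k w a)
    have "Lab n (Suc m) = {0}" using m by (simp add: Lab_def)
    then have "set w \<subseteq> {0}" using add.hyps(6) by simp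
    then have w: "w = []" using add.hyps(5) by (cases w rule: rev_cases) (auto simp: ok_word_def)
    then have "k \<in> mzv_algebra" using add.hyps(3) "0.prems"(5)[OF m] by blast
    moreover have "tform n m a t = 1" unfolding tform_def em by simp
    ultimately show ?case using w add.IH by (simp add: mzv_algebra_add)
  qed
  have "(LINT t|PL n m. indicator (ocell n m) t * G t) = indicator (ocell n m) (\<lambda>_. undefined) * G (\<lambda>_. undefined)"
  proof -
    have "(LINT t|count_space {u}. F t) = F u" for F :: "(nat \<Rightarrow> real) \<Rightarrow> real" and u
      by (simp add: lebesgue_integral_count_space_finite)
    then show ?thesis unfolding em PiM_empty by blast
  qed
  then show ?case using Gm mzv_algebra_0 by (simp add: indicator_def)
next
  case (Suc k)
  have m: "1 \<le> m" "m \<le> n - 3" "4 \<le> n" using Suc.hyps(2) Suc.prems(1-3) by linarith+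
  obtain g where g: "g \<in> fsp n (Suc m) mzv_algebra" "integrable (PL n (Suc m)) (\<lambda>t. indicator (ocell n (Suc m)) t * g t)"
    "(LINT t|PL n m. indicator (ocell n m) t * G t) = (LINT t|PL n (Suc m). indicator (ocell n (Suc m)) t * g t)"
    using fsp_integral_step[OF m Suc.prems(4,6)] by blast
  show ?case unfolding g(3)
  proof (rule Suc.hyps(1)[OF _ _ _ m(3) g(1) _ g(2)])
    show "k = n - 2 - Suc m" "1 \<le> Suc m" "Suc m \<le> n - 2" using Suc.hyps(2) m by linarith+
  qed simp
qed

section \<open>Cell-zeta values are multizeta values\<close>

lemma marked_of_real: "marked n (\<lambda>i. complex_of_real (t i)) j = complex_of_real (marked n t j)"
  by (simp add: marked_def)

lemma tform_of_real: "tform n m a (\<lambda>i. complex_of_real (t i)) = complex_of_real (tform n m a t)"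
  by (simp add: tform_def marked_of_real)

lemma of_real_of_rat: "complex_of_real (of_rat q) = of_rat q"
  by (cases q) (simp add: of_rat_rat)

text \<open>The initial integrands belong to the empty word, whose hyperlogarithm is 1. The choice
  \<open>K = mzv1\<close> admits their rational coefficients.\<close>

lemma tspan_real:
  assumes "g \<in> tspan n m"
  shows "\<exists>h\<in>fsp n m mzv1. \<forall>t. g (\<lambda>i. complex_of_real (t i)) = complex_of_real (h t)"
  using assms
proof (induction rule: tspan.induct)
  case zero show ?case by (rule bexI[OF _ fsp.zero]) simp
next
  case (add g a q)
  from add.IH obtain h where h: "h \<in> fsp n m mzv1" "\<And>t. g (\<lambda>i. complex_of_real (t i)) = complex_of_real (h t)"
    by (elim bexE) (rule that, assumption, simp)
  have "(\<lambda>t. of_rat q * (tform n m a t * hlog (marked n t) [] (marked n t m)) + h t) \<in> fsp n m mzv1"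
    by (rule fsp.add[OF h(1) rat_mzv1 _ add.hyps(2)]) (simp_all add: rat_mzv1)
  then show ?case
    by (rule bexI[rotated]) (simp add: h(2) tform_of_real of_real_of_rat)
qed

text \<open>Convergence on the cell is not used: the integral of a form that is not integrable is 0
  by convention, hence lies in the multizeta algebra as well.\<close>
lemma cell_zeta_sub: "cell_zeta_algebra \<subseteq> mzv_algebra"
proof -
  have "x \<in> mzv_algebra" if n: "5 \<le> n" and f: "f \<in> log_forms n" and x: "complex_of_real x = cell_integral n f" for x n f
  proof -
    have "\<exists>g\<in>tspan n 1. \<forall>t. valid n 1 t \<longrightarrow> f t = g t"
      by (rule logf_tspan[OF _ _ _ log_forms_logf[OF n f]]) (use n in auto)
    then obtain g where g: "g \<in> tspan n 1" "\<And>t. valid n 1 t \<Longrightarrow> f t = g t" by blast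
    obtain h where h: "h \<in> fsp n 1 mzv1" "\<And>t. g (\<lambda>i. complex_of_real (t i)) = complex_of_real (h t)"
      using tspan_real[OF g(1)] by blast
    have L: "Lab n 1 = {..n - 2}" by (auto simp: Lab_def)
    have "cell_integral n f = (LINT t|PL n 1. complex_of_real (indicator (ocell n 1) t * h t))"
      unfolding cell_integral_def set_lebesgue_integral_def
    proof (rule Bochner_Integration.integral_cong[OF refl])
      fix t :: "nat \<Rightarrow> real" assume "t \<in> space (PL n 1)"
      then have "t \<in> {1..n - 3} \<rightarrow>\<^sub>E UNIV" by (simp add: space_PiM)
      then have iff: "t \<in> standard_cell n \<longleftrightarrow> t \<in> ocell n 1" unfolding standard_cell_def ocell_def L by simp
      show "indicator (standard_cell n) t *\<^sub>R f (\<lambda>i. complex_of_real (t i)) = complex_of_real (indicator (ocell n 1) t * h t)"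
      proof (cases "t \<in> ocell n 1")
        case True
        have "valid n 1 (\<lambda>i. complex_of_real (t i))"
        proof -
          have "inj_on (marked n t) (Lab n 1)" using True unfolding ocell_def by (blast intro: strict_mono_on_imp_inj_on)
          then show ?thesis by (simp add: valid_def inj_on_def marked_of_real)
        qed
        then show ?thesis using True iff g(2) h(2) by simp
      next
        case False then show ?thesis using iff by simp
      qed
    qed
    then have "complex_of_real x = complex_of_real (LINT t|PL n 1. indicator (ocell n 1) t * h t)"
      unfolding x integral_complex_of_real .
    then have xe: "x = (LINT t|PL n 1. indicator (ocell n 1) t * h t)" using of_real_eq_iff by blast
    show ?thesis
    proof (cases "integrable (PL n 1) (\<lambda>t. indicator (ocell n 1) t * h t)")
      case True
      show ?thesis unfolding xe by (rule fsp_integral[OF _ _ _ h(1) _ True]) (use n in auto)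
    next
      case False
      then show ?thesis unfolding xe by (simp add: not_integrable_integral_eq mzv_algebra_0)
    qed
  qed
  then have "{x. \<exists>n\<ge>5. \<exists>f\<in>log_forms n. converges_on_cell n f \<and> complex_of_real x = cell_integral n f} \<subseteq> mzv_algebra" by blast
  moreover have "rat_real.subspace mzv_algebra" unfolding mzv_algebra_def by (rule rat_real.subspace_span)
  ultimately show ?thesis unfolding cell_zeta_algebra_def by (rule rat_real.span_minimal)
qed


section \<open>Multizeta values as cell integrals\<close>

text \<open>The sign of the iterated integral of a word: 1/s is positive and 1/(s - 1) negative
  between 0 and 1.\<close>

definition wsgn :: "nat list \<Rightarrow> real" where "wsgn w = (\<Prod>a\<leftarrow>w. if a = 0 then 1 else - 1)"

lemma wsgn_simps [simp]: "wsgn [] = 1" "wsgn (a # w) = (if a = 0 then wsgn w else - wsgn w)"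
  by (simp_all add: wsgn_def)

lemma wsgn_abs: "\<bar>wsgn w\<bar> = 1" by (induction w) auto

lemma hcoef_sign: "0 \<le> wsgn w * hcoef (\<lambda>_. 1) w N"
proof (induction w arbitrary: N)
  case (Cons a w)
  have "0 \<le> (\<Sum>k<N. wsgn w * hcoef (\<lambda>_. 1) w k)" by (intro sum_nonneg Cons)
  then have "0 \<le> wsgn w * (\<Sum>k<N. hcoef (\<lambda>_. 1) w k)" by (simp add: sum_distrib_left)
  then show ?case using Cons[of N] by (simp add: conv_1)
qed simp

lemma hl_sign:
  assumes "0 \<le> s" "s < 1" shows "\<bar>hl w s\<bar> = wsgn w * hl w s"
proof -
  have sm: "summable (\<lambda>n. hcoef (\<lambda>_. 1) w n * s ^ n)" by (rule hlog_summable[OF wbnd_1]) (use assms in simp)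
  have "0 \<le> (\<Sum>n. wsgn w * (hcoef (\<lambda>_. 1) w n * s ^ n))"
    using hcoef_sign assms by (intro suminf_nonneg summable_mult sm) (simp add: mult.assoc[symmetric])
  then have "0 \<le> wsgn w * hl w s" unfolding hlog_def suminf_mult[OF sm] .
  moreover have "\<bar>wsgn w * hl w s\<bar> = \<bar>hl w s\<bar>" by (simp add: abs_mult wsgn_abs)
  ultimately show ?thesis by simp
qed

lemma hl_at_1: "hl w 1 = zval w" by (simp add: hlog_def zval_def)

lemma hl_sign_1:
  assumes "zword w" shows "\<bar>hl w 1\<bar> = wsgn w * hl w 1"
proof -
  have sm: "summable (hcoef (\<lambda>_. 1) w)" by (rule summable_rabs_cancel[OF zword_summable[OF assms]])
  have "0 \<le> (\<Sum>n. wsgn w * hcoef (\<lambda>_. 1) w n)" by (intro suminf_nonneg summable_mult sm hcoef_sign)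
  then have "0 \<le> wsgn w * hl w 1" unfolding hl_at_1 zval_def suminf_mult[OF sm] .
  moreover have "\<bar>wsgn w * hl w 1\<bar> = \<bar>hl w 1\<bar>" by (simp add: abs_mult wsgn_abs)
  ultimately show ?thesis by simp
qed

lemma hl_kernel_measurable:
  "(\<lambda>s. indicator {0<..<T} s * (\<bar>hl w s\<bar> / \<bar>s - c\<bar>)) \<in> borel_measurable borel"
proof -
  have "(\<lambda>s. hl w s) \<in> borel_measurable borel" by (rule hlog_measurable) auto
  then show ?thesis
    by (intro borel_measurable_times borel_measurable_divide borel_measurable_abs borel_measurable_diff borel_measurable_indicator) auto
qed

lemma hl_continuous_on:
  assumes T: "0 < T" "T < 1 \<or> (T = 1 \<and> zword w)"
  shows "continuous_on {0..T} (hl w)"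
proof (cases "T < 1")
  case True
  then show ?thesis by (intro continuous_at_imp_continuous_on ballI hl_cont) simp_all
next
  case False
  then have T': "T = 1" "zword w" using T by simp_all
  show ?thesis unfolding continuous_on_eq_continuous_within T'(1)
  proof
    fix s :: real assume s: "s \<in> {0..1}"
    show "continuous (at s within {0..1}) (hl w)"
    proof (cases "s = 1")
      case True
      have e: "at 1 within {0..1::real} = at_left 1" by (rule at_within_Icc_at_left) simp
      show ?thesis unfolding True continuous_within e hl_at_1 by (rule zword_tendsto[OF T'(2)])
    next
      case False
      then have "0 \<le> s" "s < 1" using s by simp_all
      then show ?thesis by (rule continuous_at_imp_continuous_at_within[OF hl_cont])
    qed
  qed
qed

text \<open>The function of a word has constant sign on (0, 1), so absolute values can be taken
  inside and the iterated integral becomes one of nonnegative functions. For T = 1 the continuity of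
  the primitive up to the end point comes from the leading letter 0.\<close>

lemma hl_nn_integral:
  assumes T: "0 < T" "T < 1 \<or> (T = 1 \<and> zword (a # w))" and ok: "ok_word (a # w)"
  shows "(\<integral>\<^sup>+s. ennreal (indicator {0<..<T} s * (\<bar>hl w s\<bar> / \<bar>s - (if a = 0 then 0 else 1)\<bar>)) \<partial>lborel) = ennreal \<bar>hl (a # w) T\<bar>"
proof -
  define h where "h s = indicator {0<..<T} s * (\<bar>hl w s\<bar> / \<bar>s - (if a = 0 then 0 else 1)\<bar>)" for s
  define F where "F s = wsgn (a # w) * hl (a # w) s" for s
  have T1: "T \<le> 1" using T by auto
  have FT: "F T = \<bar>hl (a # w) T\<bar>"
  proof (cases "T < 1")
    case True then show ?thesis unfolding F_def using hl_sign[of T "a # w"] T(1) by (simp only: less_imp_le)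
  next
    case False then have "T = 1" "zword (a # w)" using T(2) by simp_all
    then show ?thesis unfolding F_def using hl_sign_1[of "a # w"] by (simp only:)
  qed
  have F0: "F 0 = 0" by (simp add: F_def hlog_at_0)
  have cont: "continuous_on {0..T} (hl (a # w))" by (rule hl_continuous_on[OF T])
  have "(h has_integral (F T - F 0)) {0..T}"
  proof (rule fundamental_theorem_of_calculus_interior)
    show "continuous_on {0..T} F" unfolding F_def[abs_def] by (intro continuous_intros cont)
    fix s assume s: "s \<in> {0<..<T}"
    then have s': "0 < s" "s < 1" using T1 by auto
    have "(F has_real_derivative wsgn (a # w) * (hl w s / (s - (if a = 0 then 0 else 1)))) (at s)"
      unfolding F_def[abs_def] by (intro DERIV_cmult hl_deriv s' ok)
    moreover have "wsgn (a # w) * (hl w s / (s - (if a = 0 then 0 else 1))) = h s"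
    proof -
      have e: "\<bar>hl w s\<bar> = wsgn w * hl w s" using s' by (intro hl_sign) auto
      show ?thesis
      proof (cases "a = 0")
        case True
        then show ?thesis unfolding h_def e using s s' by simp
      next
        case False
        have "hl w s / (s - 1) = - (hl w s / (1 - s))" by (simp only: minus_divide_right minus_diff_eq)
        moreover have "\<bar>s - 1\<bar> = 1 - s" using s' by simp
        moreover have "indicator {0<..<T} s = (1::real)" using s by simp
        ultimately show ?thesis unfolding h_def e using False by (simp only: wsgn_simps if_False mult_1) simp
      qed
    qed
    ultimately show "(F has_vector_derivative h s) (at s)" by (simp add: has_real_derivative_iff_has_vector_derivative)
  qed (use T in simp)
  then have "((\<lambda>s. if s \<in> {0..T} then h s else 0) has_integral F T) UNIV" unfolding has_integral_restrict_UNIV F0 diff_0_right .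
  moreover have "(\<lambda>s. if s \<in> {0..T} then h s else 0) = h"
  proof (rule ext)
    show "(if s \<in> {0..T} then h s else 0) = h s" for s by (cases "s \<in> {0<..<T}") (simp_all add: h_def)
  qed
  ultimately have hi: "(h has_integral F T) UNIV" by (simp only:)
  have hm: "h \<in> borel_measurable borel" unfolding h_def[abs_def] by (rule hl_kernel_measurable)
  have "(\<integral>\<^sup>+s. ennreal (h s) \<partial>lborel) = ennreal (F T)"
    by (rule nn_integral_has_integral_lborel[OF hm _ hi]) (simp add: h_def)
  then show ?thesis by (simp add: h_def FT)
qed

section \<open>Integrals of words over the cell\<close>

text \<open>The letters of the coordinates already integrated, the outermost first.\<close>

definition wpre :: "(nat \<Rightarrow> nat) \<Rightarrow> nat \<Rightarrow> nat list" where "wpre a m = map a (rev [1..<m])"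

lemma wpre_Suc: "1 \<le> m \<Longrightarrow> wpre a (Suc m) = a m # wpre a m" by (simp add: wpre_def)

lemma wpre_ok: "a 1 \<noteq> 0 \<Longrightarrow> 1 \<le> m \<Longrightarrow> ok_word (wpre a m)"
proof (induction m)
  case (Suc m)
  show ?case
  proof (cases "m = 0")
    case False
    then have "ok_word (wpre a m)" using Suc by simp
    moreover have "wpre a m = [] \<Longrightarrow> a m \<noteq> 0" using False Suc by (cases "m = 1") (auto simp: wpre_def)
    ultimately show ?thesis using False by (auto simp: wpre_Suc ok_word_Cons)
  qed (simp add: wpre_def)
qed simp

definition wE :: "nat \<Rightarrow> (nat \<Rightarrow> nat) \<Rightarrow> nat \<Rightarrow> (nat \<Rightarrow> real) \<Rightarrow> real" where
  "wE n a m t = indicator (ocell n m) t * (\<bar>tform n m a t\<bar> * \<bar>hl (wpre a m) (marked n t m)\<bar>)"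

lemma tform_measurable:
  assumes "a \<in> tarcs n m" shows "tform n m a \<in> borel_measurable (PL n m)"
  unfolding tform_def[abs_def]
proof (intro borel_measurable_prod borel_measurable_divide borel_measurable_diff borel_measurable_const)
  fix i assume i: "i \<in> {m..n - 3}"
  show "(\<lambda>t. t i) \<in> borel_measurable (PL n m)" using measurable_component_singleton[OF i, of "\<lambda>_. lborel"] by simp
  have "a i \<in> Lab n (Suc i)" using assms i by (auto simp: tarcs_def)
  then show "(\<lambda>t. marked n t (a i)) \<in> borel_measurable (PL n m)"
    using i by (intro marked_measurable) (auto simp: Lab_def)
qed

lemma ocell_indicator_measurable: "(indicator (ocell n m) :: _ \<Rightarrow> real) \<in> borel_measurable (PL n m)"
proof -
  have "ocell n m \<inter> space (PL n m) = {t \<in> space (PL n m). t \<in> ocell n m}" by blast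
  then show ?thesis unfolding borel_measurable_indicator_iff using ocell_measurable by simp
qed

text \<open>\<open>a 1 \<noteq> 0\<close> makes the innermost integral finite at 0, and
  \<open>a (n - 3) = 0\<close> makes the outermost one finite at 1. In between the upper end is a
  coordinate smaller than 1, where no condition on the word is needed.\<close>

lemma wE_step:
  assumes n: "5 \<le> n" and a: "\<And>i. a i \<in> {0, n - 2}" "a 1 \<noteq> 0" "a (n - 3) = 0" and m: "1 \<le> m" "m \<le> n - 3"
  shows "(\<integral>\<^sup>+t. ennreal (wE n a m t) \<partial>PL n m) = (\<integral>\<^sup>+t. ennreal (wE n a (Suc m) t) \<partial>PL n (Suc m))"
proof -
  have m4: "4 \<le> n" using n by simp
  have ta: "a \<in> tarcs n k" for k unfolding tarcs_def
  proof (intro CollectI ballI)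
    fix i assume "i \<in> {k..n - 3}"
    then show "a i \<in> Lab n (Suc i)" using a(1)[of i] n by (auto simp: Lab_def)
  qed
  have ins: "{m..n - 3} = insert m {Suc m..n - 3}" using m by auto
  have meas: "(\<lambda>t. ennreal (wE n a m t)) \<in> borel_measurable (PL n m)"
  proof -
    have "(\<lambda>t. hl (wpre a m) (marked n t m)) \<in> borel_measurable (PL n m)"
      by (rule hlog_measurable) (use m in \<open>auto intro!: marked_measurable simp: Lab_def\<close>)
    then show ?thesis unfolding wE_def[abs_def]
      using tform_measurable[OF ta, of m] ocell_indicator_measurable[of n m] 
      by (intro measurable_compose[OF _ measurable_ennreal] borel_measurable_times borel_measurable_abs)
  qed
  have "(\<integral>\<^sup>+t. ennreal (wE n a m t) \<partial>PL n m) = (\<integral>\<^sup>+t. (\<integral>\<^sup>+s. ennreal (wE n a m (t(m := s))) \<partial>lborel) \<partial>PL n (Suc m))"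
    unfolding ins by (rule lb.product_nn_integral_insert) (use meas in \<open>simp_all add: ins\<close>)
  also have "\<dots> = (\<integral>\<^sup>+t. ennreal (wE n a (Suc m) t) \<partial>PL n (Suc m))"
  proof (rule nn_integral_cong)
    fix t :: "nat \<Rightarrow> real"
    define T where "T = marked n t (Suc m)"
    define c where "c = indicator (ocell n (Suc m)) t * \<bar>tform n (Suc m) a t\<bar>"
    have c: "0 \<le> c" by (simp add: c_def)
    have am: "marked n t (a m) = (if a m = 0 then 0 else 1)" using a(1)[of m] n by (auto simp: marked_def)
    have mm: "marked n (t(m := s)) m = s" for s using m n by (auto simp: marked_def)
    have eq: "wE n a m (t(m := s)) = c * (indicator {0<..<T} s * (\<bar>hl (wpre a m) s\<bar> / \<bar>s - (if a m = 0 then 0 else 1)\<bar>))" for s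
      unfolding wE_def c_def T_def mm tform_upd[OF m m4 ta] am indicator_def ocell_upd[OF m m4] by (auto simp: abs_mult)
    have hm: "(\<lambda>s. indicator {0<..<T} s * (\<bar>hl (wpre a m) s\<bar> / \<bar>s - (if a m = 0 then 0 else 1)\<bar>)) \<in> borel_measurable lborel"
      using hl_kernel_measurable by simp
    show "(\<integral>\<^sup>+s. ennreal (wE n a m (t(m := s))) \<partial>lborel) = ennreal (wE n a (Suc m) t)"
    proof (cases "t \<in> ocell n (Suc m)")
      case False
      have z: "wE n a m (t(m := s)) = 0" for s unfolding eq by (simp add: c_def False)
      show ?thesis unfolding z using False by (simp add: wE_def)
    next
      case True
      have T0: "0 < T" unfolding T_def by (rule adm_exists(2)[OF True]) (use m n in auto)
      have okw: "ok_word (a m # wpre a m)" using wpre_ok[where a=a and m="Suc m", OF a(2)] m by (simp add: wpre_Suc)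
      have T1: "T < 1 \<or> (T = 1 \<and> zword (a m # wpre a m))"
      proof (cases "Suc m = n - 2")
        case True
        then have "m = n - 3" using n by linarith
        then have "T = 1" "a m = 0" using True n a(3) by (auto simp: T_def marked_def)
        then show ?thesis using okw by (simp add: zword_def)
      next
        case F: False
        have "marked n t (Suc m) < marked n t (n - 2)" by (rule ocell_less[OF True]) (use m n F in \<open>auto simp: Lab_def\<close>)
        then show ?thesis using n by (simp add: T_def marked_def[of n t "n - 2"])
      qed
      have "(\<integral>\<^sup>+s. ennreal (wE n a m (t(m := s))) \<partial>lborel) = ennreal c * ennreal \<bar>hl (a m # wpre a m) T\<bar>"
        unfolding eq ennreal_mult'[OF c] hl_nn_integral[OF T0 T1 okw, symmetric]
        by (rule nn_integral_cmult) (rule measurable_compose[OF hm measurable_ennreal])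
      also have "\<dots> = ennreal (wE n a (Suc m) t)"
        using c m True by (simp add: ennreal_mult'[symmetric] wE_def c_def wpre_Suc T_def)
      finally show ?thesis .
    qed
  qed
  finally show ?thesis .
qed

lemma wE_total:
  assumes n: "5 \<le> n" and a: "\<And>i. a i \<in> {0, n - 2}" "a 1 \<noteq> 0" "a (n - 3) = 0" and m: "1 \<le> m" "m \<le> n - 2"
  shows "(\<integral>\<^sup>+t. ennreal (wE n a m t) \<partial>PL n m) = ennreal \<bar>zval (wpre a (n - 2))\<bar>"
  using m
proof (induction "n - 2 - m" arbitrary: m)
  case 0
  then have m: "m = n - 2" by linarith
  have em: "{m..n - 3} = {}" using m n by simp
  define u where "u = (\<lambda>_::nat. undefined :: real)"
  have "u \<in> ocell n m" using n by (auto simp: ocell_def strict_mono_on_def m Lab_def marked_def)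
  moreover have "marked n u m = 1" using m n by (simp add: marked_def)
  moreover have "tform n m a u = 1" unfolding tform_def em by simp
  ultimately have "wE n a m u = \<bar>zval (wpre a m)\<bar>" by (simp add: wE_def hl_at_1)
  then have "wE n a m u = \<bar>zval (wpre a (n - 2))\<bar>" unfolding m .
  moreover have "(\<integral>\<^sup>+t. F t \<partial>count_space {u}) = F u" for F by (simp add: nn_integral_count_space_finite)
  ultimately show ?case unfolding em PiM_empty u_def by simp
next
  case (Suc k)
  have "m \<le> n - 3" using Suc.hyps(2) by linarith
  with wE_step[OF n a Suc.prems(1)] show ?case
    using Suc.hyps(1)[of "Suc m"] Suc.hyps(2) Suc.prems by simp
qed

text \<open>The form has the constant sign \<sigma> on the cell, which leads back from absolute
  values to the integral itself. Knowing it up to sign is enough, since a rational span is closed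
  under negation.\<close>

lemma word_integral:
  assumes n: "5 \<le> n" and a: "\<And>i. a i \<in> {0, n - 2}" "a 1 \<noteq> 0" "a (n - 3) = 0"
  shows "\<bar>LINT t|PL n 1. indicator (ocell n 1) t * tform n 1 a t\<bar> = \<bar>zval (wpre a (n - 2))\<bar>"
proof -
  have ta: "a \<in> tarcs n k" for k unfolding tarcs_def
  proof (intro CollectI ballI)
    fix i assume "i \<in> {k..n - 3}"
    then show "a i \<in> Lab n (Suc i)" using a(1)[of i] n by (auto simp: Lab_def)
  qed
  define \<sigma> :: real where "\<sigma> = (\<Prod>i\<in>{1..n - 3}. if a i = 0 then 1 else - 1)"
  have \<sigma>: "\<bar>\<sigma>\<bar> = 1" unfolding \<sigma>_def abs_prod by (rule prod.neutral) auto
  have sg: "\<bar>tform n 1 a t\<bar> = \<sigma> * tform n 1 a t" if t: "t \<in> ocell n 1" for t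
  proof -
    have "\<bar>1 / (t i - marked n t (a i))\<bar> = (if a i = 0 then 1 else - 1) * (1 / (t i - marked n t (a i)))" if i: "i \<in> {1..n - 3}" for i
    proof -
      have "marked n t 0 < marked n t i" by (rule ocell_less[OF t]) (use i in \<open>auto simp: Lab_def\<close>)
      moreover have "marked n t i < marked n t (n - 2)" by (rule ocell_less[OF t]) (use i n in \<open>auto simp: Lab_def\<close>)
      moreover have "marked n t i = t i" using i n by (auto simp: marked_def)
      ultimately have p: "0 < t i" "t i - marked n t (n - 2) < 0" by simp_all
      show ?thesis
      proof (cases "a i = 0")
        case True then show ?thesis using p by simp
      next
        case False
        then have "a i = n - 2" using a(1)[of i] by simp
        moreover have "1 / (t i - marked n t (n - 2)) < 0" using p(2) by (simp only: divide_less_0_iff) simp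
        ultimately show ?thesis using False by (simp only: abs_of_neg if_False mult_minus1)
      qed
    qed
    then show ?thesis unfolding tform_def abs_prod \<sigma>_def prod.distrib[symmetric] by (intro prod.cong refl)
  qed
  have wE1: "wE n a 1 t = \<sigma> * (indicator (ocell n 1) t * tform n 1 a t)" for t
    using sg by (simp add: wE_def wpre_def indicator_def)
  have meas: "wE n a 1 \<in> borel_measurable (PL n 1)"
    unfolding wE1[abs_def] by (intro borel_measurable_times borel_measurable_const tform_measurable[OF ta] ocell_indicator_measurable)
  have "(LINT t|PL n 1. wE n a 1 t) = \<bar>zval (wpre a (n - 2))\<bar>"
  proof (rule integral_eq_nn_integral[THEN trans])
    show "wE n a 1 \<in> borel_measurable (PL n 1)" by (rule meas)
    show "AE t in PL n 1. 0 \<le> wE n a 1 t" by (simp add: wE_def)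
    show "enn2real (\<integral>\<^sup>+t. ennreal (wE n a 1 t) \<partial>PL n 1) = \<bar>zval (wpre a (n - 2))\<bar>"
      using wE_total[OF n a, of 1] n by simp
  qed
  then have "\<sigma> * (LINT t|PL n 1. indicator (ocell n 1) t * tform n 1 a t) = \<bar>zval (wpre a (n - 2))\<bar>"
    unfolding wE1 by simp
  then have "\<bar>\<sigma>\<bar> * \<bar>LINT t|PL n 1. indicator (ocell n 1) t * tform n 1 a t\<bar> = \<bar>zval (wpre a (n - 2))\<bar>"
    unfolding abs_mult[symmetric] by simp
  then show ?thesis using \<sigma> by simp
qed

section \<open>Pole orders of the forms that belong to words\<close>

lemma powi_bigo_prod:
  assumes "finite I" "\<And>i. i \<in> I \<Longrightarrow> f i \<in> O[at 0](\<lambda>e::complex. e powi p i)"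
  shows "(\<lambda>e. \<Prod>i\<in>I. f i e :: complex) \<in> O[at 0](\<lambda>e. e powi (\<Sum>i\<in>I. p i))"
  using assms
proof (induction I rule: finite_induct)
  case (insert i I)
  have "(\<lambda>e. f i e * (\<Prod>i\<in>I. f i e)) \<in> O[at 0](\<lambda>e. e powi (p i + (\<Sum>i\<in>I. p i)))"
    by (rule powi_bigo_mult) (use insert in simp_all)
  then show ?case using insert by simp
qed simp

lemma powi_bigo_le:
  assumes "q \<le> p" shows "(\<lambda>e::complex. e powi p) \<in> O[at 0](\<lambda>e. e powi q)"
proof (rule bigoI[of _ 1])
  have "\<forall>\<^sub>F e::complex in at 0. e \<noteq> 0 \<and> norm e < 1"
    unfolding eventually_at by (intro exI[of _ 1]) simp
  then show "\<forall>\<^sub>F e::complex in at 0. norm (e powi p) \<le> 1 * norm (e powi q)"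
  proof eventually_elim
    case (elim e)
    have "norm (e powi p) = norm (e powi q) * norm e powi (p - q)"
      using elim by (simp add: norm_power_int power_int_diff)
    also have "norm e powi (p - q) \<le> 1"
      using assms elim by (simp add: power_int_def power_le_one)
    then have "norm (e powi q) * norm e powi (p - q) \<le> norm (e powi q) * 1" by (intro mult_left_mono) simp_all
    finally show ?case by simp
  qed
qed

text \<open>The ties of a convergent word in 0 and 1: every point is tied to 0 or 1, the first to 1
  and the last to 0.\<close>

definition warcs :: "nat \<Rightarrow> (nat \<Rightarrow> nat) \<Rightarrow> bool" where
  "warcs n a \<longleftrightarrow> 5 \<le> n \<and> (\<forall>i. a i \<in> {0, n - 2}) \<and> a 1 \<noteq> 0 \<and> a (n - 3) = 0"

lemma tform_regular:
  assumes "warcs n a" shows "tform n 1 a \<in> regular_functions n"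
proof -
  have n: "5 \<le> n" and a: "\<And>i. a i \<in> {0, n - 2}" using assms by (auto simp: warcs_def)
  have g: "(\<lambda>t. 1 / (t i - marked n t (a i))) \<in> regular_functions n" if i: "i \<in> {1..n - 3}" for i
  proof (cases "a i = 0")
    case True
    have "(\<lambda>t. 1 / (marked n t i - marked n t 0)) \<in> regular_functions n" by (rule regular_functions.inv_diff) (use i in auto)
    moreover have "marked n t i = t i" for t :: "nat \<Rightarrow> complex" using i n by (auto simp: marked_def)
    ultimately show ?thesis using True by simp
  next
    case False
    then have an: "a i = n - 2" using a[of i] by simp
    have mi: "marked n t i = t i" for t :: "nat \<Rightarrow> complex" using i n by (auto simp: marked_def)
    have "(\<lambda>t. of_rat (-1) * (1 / (marked n t (n - 2) - marked n t i))) \<in> regular_functions n"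
      by (intro regular_functions.mult regular_functions.const regular_functions.inv_diff) (use i n in auto)
    moreover have "of_rat (-1) * (1 / (marked n t (n - 2) - marked n t i)) = 1 / (t i - marked n t (a i))" for t :: "nat \<Rightarrow> complex"
    proof -
      have "- (1 / (marked n t (n - 2) - t i)) = 1 / (t i - marked n t (n - 2))" by (simp only: minus_divide_right minus_diff_eq)
      then show ?thesis by (simp add: mi an of_rat_minus)
    qed
    ultimately show ?thesis by simp
  qed
  have "(\<lambda>t. \<Prod>i\<in>I. 1 / (t i - marked n t (a i))) \<in> regular_functions n" if "finite I" "I \<subseteq> {1..n - 3}" for I
    using that
  proof (induction I rule: finite_induct)
    case empty
    show ?case using regular_functions.const[of 1 n] by simp
  next
    case (insert i I)
    have "(\<lambda>t. 1 / (t i - marked n t (a i)) * (\<Prod>i\<in>I. 1 / (t i - marked n t (a i)))) \<in> regular_functions n"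
      using insert by (intro regular_functions.mult g) auto
    then show ?case using insert by simp
  qed
  then show ?thesis unfolding tform_def[abs_def] by blast
qed

text \<open>Each factor equals D divided by the difference of the positions of i and
  \<open>a i\<close>. D contributes order 1 if S contains 0 and n - 2, and the denominator takes
  away order 1 if S contains i and \<open>a i\<close>. Hypothesis \<open>k\<close> is the resulting
  count over the n - 3 factors.\<close>

lemma tform_order:
  assumes wa: "warcs n a" and S: "S \<in> boundary_divisors n" and x: "x \<in> open_stratum n S"
    and k: "int (card {i\<in>{1..n - 3}. i \<in> S \<and> a i \<in> S}) \<le> (if 0 \<in> S \<and> n - 2 \<in> S then int n - 3 else 0) + k + volume_order n S"
  shows "(\<lambda>e. tform n 1 a (smoothing n S x e)) \<in> O[at 0](\<lambda>e. e powi (- k - volume_order n S))"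
proof -
  have n: "5 \<le> n" and a: "\<And>i. a i \<in> {0, n - 2}" using wa by (auto simp: warcs_def)
  have L: "Lab n 1 = {..n - 2}" by (auto simp: Lab_def)
  have Sn: "S \<subseteq> Lab n 1"
  proof
    fix i assume "i \<in> S"
    then have "i < n" "i \<noteq> n - 1" using S by (auto simp: boundary_divisors_def)
    then show "i \<in> Lab n 1" unfolding L by simp
  qed
  have xs: "x \<in> strat n 1 S" using x unfolding strat_def open_stratum_def L .
  have xx: "inj_on x S" "inj_on x (Lab n 1 - S)" "\<And>k. k \<in> Lab n 1 \<Longrightarrow> k \<notin> S \<Longrightarrow> x k \<noteq> 0" using xs by (auto simp: strat_def)
  define w where "w k e = wpos S x e k" for k e
  define D where "D e = w (n - 2) e - w 0 e" for e
  define d :: int where "d = (if 0 \<in> S \<and> n - 2 \<in> S then 1 else 0)"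
  define ev :: "nat \<Rightarrow> int" where "ev i = (if i \<in> S \<and> a i \<in> S then 1 else 0)" for i
  have wl: "(w k \<longlongrightarrow> (if k \<in> S then 0 else x k)) (at 0)" for k
  proof -
    have "w k = (\<lambda>e. if k \<in> S then e * x k else x k)" by (simp add: fun_eq_iff w_def wpos_def)
    then show ?thesis by (auto intro!: tendsto_eq_intros)
  qed
  have DO: "D \<in> O[at 0](\<lambda>e. e powi d)"
  proof (cases "0 \<in> S \<and> n - 2 \<in> S")
    case True
    have "D = (\<lambda>e. (x (n - 2) - x 0) * e)" using True by (simp add: fun_eq_iff D_def w_def wpos_def algebra_simps)
    then show ?thesis using True by (simp add: d_def)
  next
    case False
    have "D \<in> O[at 0](\<lambda>_. 1)" unfolding D_def[abs_def] by (rule tendsto_bigo_1[OF tendsto_diff[OF wl wl]])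
    then show ?thesis unfolding d_def if_not_P[OF False] by simp
  qed
  have iO: "(\<lambda>e. inverse (w i e - w (a i) e)) \<in> O[at 0](\<lambda>e. e powi (- ev i))" if i: "i \<in> {1..n - 3}" for i
  proof -
    have iL: "i \<in> Lab n 1" "a i \<in> Lab n 1" "i \<noteq> a i" using i a[of i] n unfolding L by auto
    show ?thesis
    proof (cases "i \<in> S \<and> a i \<in> S")
      case True
      have "(\<lambda>e. inverse (w i e - w (a i) e)) = (\<lambda>e. inverse (x i - x (a i)) * inverse e)"
      proof
        fix e
        have "w i e - w (a i) e = (x i - x (a i)) * e" using True by (simp add: w_def wpos_def algebra_simps)
        then show "inverse (w i e - w (a i) e) = inverse (x i - x (a i)) * inverse e" by (simp add: inverse_mult_distrib)
      qed
      then show ?thesis using True by (simp add: ev_def power_int_minus)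
    next
      case False
      have "(if i \<in> S then 0 else x i) - (if a i \<in> S then 0 else x (a i)) \<noteq> 0"
      proof -
        consider "i \<in> S" "a i \<notin> S" | "i \<notin> S" "a i \<in> S" | "i \<notin> S" "a i \<notin> S" using False by blast
        then show ?thesis
        proof cases
          case 3
          then have "x i \<noteq> x (a i)" using inj_onD[OF xx(2), of i "a i"] iL by blast
          then show ?thesis using 3 by simp
        qed (use xx(3) iL in simp_all)
      qed
      from tendsto_inverse[OF tendsto_diff[OF wl wl] this]
      have "(\<lambda>e. inverse (w i e - w (a i) e)) \<in> O[at 0](\<lambda>_. 1)" by (rule tendsto_bigo_1)
      then show ?thesis unfolding ev_def if_not_P[OF False] by simp
    qed
  qed
  have eq: "\<forall>\<^sub>F e in at 0. (\<Prod>i\<in>{1..n - 3}. D e * inverse (w i e - w (a i) e)) = tform n 1 a (smoothing n S x e)"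
    using wpos_inj[OF xs finite_Lab Sn]
  proof eventually_elim
    case (elim e)
    have m2: "1 \<le> n - 2" "3 \<le> n" using n by auto
    define t where "t = smoothing n S x e"
    have mk: "marked n t k = (w k e - w 0 e) / D e" if "k \<in> Lab n 1" for k
      unfolding t_def D_def w_def by (rule marked_smoothing[OF elim m2 that])
    have "D e * inverse (w i e - w (a i) e) = 1 / (t i - marked n t (a i))" if i: "i \<in> {1..n - 3}" for i
    proof -
      have iL: "i \<in> Lab n 1" "a i \<in> Lab n 1" using i a[of i] n unfolding L by auto
      have ti: "t i = (w i e - w 0 e) / D e" by (simp add: t_def smoothing_eq D_def w_def)
      have "(w i e - w 0 e) / D e - (w (a i) e - w 0 e) / D e = (w i e - w (a i) e) / D e"
        by (simp add: diff_divide_distrib[symmetric])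
      then show ?thesis unfolding ti mk[OF iL(2)] by (simp add: divide_inverse)
    qed
    then show ?case unfolding tform_def t_def[symmetric] by (intro prod.cong refl)
  qed
  have "(\<lambda>e. \<Prod>i\<in>{1..n - 3}. D e * inverse (w i e - w (a i) e)) \<in> O[at 0](\<lambda>e. e powi (\<Sum>i\<in>{1..n - 3}. d + (- ev i)))"
    by (intro powi_bigo_prod powi_bigo_mult DO iO) simp_all
  then have O: "(\<lambda>e. tform n 1 a (smoothing n S x e)) \<in> O[at 0](\<lambda>e. e powi (\<Sum>i\<in>{1..n - 3}. d + (- ev i)))"
    unfolding landau_o.big.in_cong[OF eq] .
  have sd: "(\<Sum>i\<in>{1..n - 3}. d + (- ev i)) = (int n - 3) * d - (\<Sum>i\<in>{1..n - 3}. ev i)"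
    unfolding sum.distrib sum_negf using n by (simp add: of_nat_diff)
  have "(\<Sum>i\<in>{1..n - 3}. ev i) = int (card {i\<in>{1..n - 3}. i \<in> S \<and> a i \<in> S})"
    by (simp add: ev_def sum.If_cases Int_def)
  then have "- k - volume_order n S \<le> (\<Sum>i\<in>{1..n - 3}. d + (- ev i))"
  proof (cases "0 \<in> S \<and> n - 2 \<in> S")
    case True
    then have "d = 1" by (simp add: d_def)
    then show ?thesis using k[unfolded if_P[OF True]] \<open>sum ev _ = _\<close> unfolding sd by simp
  next
    case False
    then have "d = 0" unfolding d_def by (rule if_not_P)
    then show ?thesis using k[unfolded if_not_P[OF False]] \<open>sum ev _ = _\<close> unfolding sd by simp
  qed
  from landau_o.big_trans[OF O powi_bigo_le[OF this]] show ?thesis .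
qed

text \<open>A run of consecutive labels modulo n that avoids n - 1 does not wrap around, so 0 can
  only be its first and n - 2 only its last element. With both it would consist of all labels but n
  - 1, against the size of the complement.\<close>

lemma cyc_props:
  assumes n: "5 \<le> n" and S: "cyclically_consecutive n S" "n - 1 \<notin> S" "2 \<le> card S" "2 \<le> card ({..<n} - S)" "S \<subseteq> {..<n}"
  shows "0 \<in> S \<Longrightarrow> 1 \<in> S" "n - 2 \<in> S \<Longrightarrow> n - 3 \<in> S" "\<not> (0 \<in> S \<and> n - 2 \<in> S)"
proof -
  obtain b k where Sb: "S = (\<lambda>i. (b + i) mod n) ` {..<k}" using S(1) by (auto simp: cyclically_consecutive_def)
  have mem: thesis if "c \<in> S" "\<And>i. i < k \<Longrightarrow> (b + i) mod n = c \<Longrightarrow> thesis" for c thesis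
    using that unfolding Sb by blast
  have k2: "2 \<le> k"
    using S(3) card_image_le[of "{..<k}" "\<lambda>i. (b + i) mod n"] unfolding Sb by simp
  have pred: "(c + n - 1) mod n = n - 1" if "c mod n = 0" for c
  proof -
    have "c + n - 1 = c + (n - 1)" using n by simp
    then have "(c + n - 1) mod n = (c mod n + (n - 1)) mod n" by (simp only: mod_add_left_eq)
    then show ?thesis using that n by simp
  qed
  have b0: "b mod n = 0" if z: "0 \<in> S"
  proof -
    obtain i where i: "i < k" "(b + i) mod n = 0" by (rule mem[OF z])
    show ?thesis
    proof (cases i)
      case 0 then show ?thesis using i by simp
    next
      case (Suc j)
      have "b + i + n - 1 = b + j + n" using Suc by simp
      then have "(b + j + n) mod n = n - 1" using pred[OF i(2)] by simp
      then have "(b + j) mod n = n - 1" by (simp only: mod_add_self2)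
      then have "n - 1 \<in> S" unfolding Sb using Suc i by (intro image_eqI[of _ _ j]) auto
      then show ?thesis using S(2) by simp
    qed
  qed
  have sm: "(b + i) mod n = i mod n" if "b mod n = 0" for i
    using that by (metis add_0 mod_add_left_eq)
  show "1 \<in> S" if "0 \<in> S"
    unfolding Sb using k2 sm[OF b0[OF that], of 1] n by (intro image_eqI[of _ _ 1]) auto
  have kl: "i = k - 1" if "i < k" "(b + i) mod n = n - 2" for i
  proof (rule ccontr)
    assume "i \<noteq> k - 1"
    then have "Suc i < k" using that by simp
    moreover have "(b + Suc i) mod n = n - 1"
    proof -
      have "(b + Suc i) mod n = ((b + i) mod n + 1) mod n" by (simp add: mod_Suc_eq)
      then show ?thesis using that n by simp
    qed
    ultimately have "n - 1 \<in> S" unfolding Sb by (intro image_eqI[of _ _ "Suc i"]) auto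
    then show False using S(2) by simp
  qed
  show "n - 3 \<in> S" if n2: "n - 2 \<in> S"
  proof -
    obtain i where i: "i < k" "(b + i) mod n = n - 2" by (rule mem[OF n2])
    have "i = k - 1" by (rule kl[OF i])
    then have "i = Suc (i - 1)" "i - 1 < k" using k2 by linarith+
    then obtain j where j: "i = Suc j" "j < k" by blast
    have "(b + j) mod n = n - 3"
    proof -
      have "((b + j) mod n + 1) mod n = n - 2" using i j by (simp add: mod_Suc_eq)
      moreover have "(b + j) mod n < n" using n by simp
      ultimately show ?thesis using n by (cases "(b + j) mod n + 1 = n") auto
    qed
    then show ?thesis unfolding Sb using j by (intro image_eqI[of _ _ j]) auto
  qed
  show "\<not> (0 \<in> S \<and> n - 2 \<in> S)"
  proof
    assume h: "0 \<in> S \<and> n - 2 \<in> S"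
    note bz = b0[OF conjunct1[OF h]]
    obtain i where i: "i < k" "(b + i) mod n = n - 2" by (rule mem[OF conjunct2[OF h]])
    have "i mod n = n - 2" using i(2) sm[OF bz] by simp
    then have "n - 2 \<le> i" using mod_less_eq_dividend[of i n] by simp
    then have mem': "j \<in> S" if "j \<le> n - 2" for j
      unfolding Sb using that i(1) sm[OF bz, of j] n by (intro image_eqI[of _ _ j]) auto
    have "{..<n} - S \<subseteq> {n - 1}"
    proof
      fix j assume "j \<in> {..<n} - S"
      then have "j < n" "\<not> j \<le> n - 2" using mem' by auto
      then have "j = n - 1" by linarith
      then show "j \<in> {n - 1}" by simp
    qed
    from card_mono[OF _ this] have "card ({..<n} - S) \<le> 1" by simp
    then show False using S(4) by simp
  qed
qed

text \<open>By \<open>tform_order\<close> only those i in S count for which \<open>a i\<close> lies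
  in S as well. They are different from 0 and n - 2, which gives at most simple poles. A divisor
  bounding the cell contains at most one of 0 and n - 2; the neighbour of that point also lies in S
  but is tied to the other one, and this further missing element removes the pole.\<close>

lemma warcs_log:
  assumes wa: "warcs n a"
  shows "tform n 1 a \<in> log_forms n" "converges_on_cell n (tform n 1 a)"
proof -
  have n: "5 \<le> n" and a: "\<And>i. a i \<in> {0, n - 2}" "a 1 \<noteq> 0" "a (n - 3) = 0" using wa by (auto simp: warcs_def)
  have a1: "a 1 = n - 2" using a(1)[of 1] a(2) by simp
  define E where "E S = {i\<in>{1..n - 3}. i \<in> S \<and> a i \<in> S}" for S
  have fin: "finite S" if "S \<in> boundary_divisors n" for S
    using that finite_subset[of S "{..<n}"] by (auto simp: boundary_divisors_def)
  have "pole_order_le n (tform n 1 a) S 1" if S: "S \<in> boundary_divisors n" for S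
    unfolding pole_order_le_def
  proof (intro ballI tform_order[OF wa S])
    have c2: "2 \<le> card S" using S by (simp add: boundary_divisors_def)
    have E1: "E S \<subseteq> S - {0, n - 2}" using n by (auto simp: E_def)
    show "int (card {i\<in>{1..n - 3}. i \<in> S \<and> a i \<in> S}) \<le> (if 0 \<in> S \<and> n - 2 \<in> S then int n - 3 else 0) + 1 + volume_order n S"
    proof -
      have m: "card (E S) \<le> card (S - {0, n - 2})" by (rule card_mono[OF _ E1]) (use fin[OF S] in simp)
      show ?thesis
      proof (cases "0 \<in> S \<and> n - 2 \<in> S")
        case True
        have "card (S - {0, n - 2}) = card S - card {0, n - 2}" by (rule card_Diff_subset) (use True in auto)
        then have "card (S - {0, n - 2}) = card S - 2" using n by simp
        then show ?thesis using m True c2 unfolding volume_order_def E_def[symmetric] by simp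
      next
        case False
        show ?thesis
        proof (cases "0 \<in> S \<or> n - 2 \<in> S")
          case True
          then have "S - {0, n - 2} \<subset> S" by auto
          then have "card (S - {0, n - 2}) < card S" by (rule psubset_card_mono[OF fin[OF S]])
          then have "card (E S) \<le> card S - 1" using m by simp
          then show ?thesis unfolding volume_order_def if_not_P[OF False] E_def[symmetric] using c2 by simp
        next
          case F: False
          have "a i \<notin> S" for i using a(1)[of i] F by auto
          then have "E S = {}" by (simp add: E_def)
          then show ?thesis unfolding volume_order_def if_not_P[OF False] E_def[symmetric] using c2 by simp
        qed
      qed
    qed
  qed
  then show "tform n 1 a \<in> log_forms n" using tform_regular[OF wa] by (simp add: log_forms_def)
  have "pole_order_le n (tform n 1 a) S 0" if S: "S \<in> cell_divisors n" for S
    unfolding pole_order_le_def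
  proof (intro ballI)
    fix x assume x: "x \<in> open_stratum n S"
    have Sb: "S \<in> boundary_divisors n" and cyc: "cyclically_consecutive n S" using S by (auto simp: cell_divisors_def)
    have S': "n - 1 \<notin> S" "2 \<le> card S" "2 \<le> card ({..<n} - S)" "S \<subseteq> {..<n}" using Sb by (auto simp: boundary_divisors_def)
    note cp = cyc_props[OF n cyc S']
    show "(\<lambda>e. tform n 1 a (smoothing n S x e)) \<in> O[at 0](\<lambda>e. e powi (- 0 - volume_order n S))"
    proof (rule tform_order[OF wa Sb x])
      have "card (E S) \<le> card S - 2"
      proof (cases "0 \<in> S \<or> n - 2 \<in> S")
        case True
        define Q where "Q = (if 0 \<in> S then {0, 1} else {n - 3, n - 2})"
        have Q: "Q \<subseteq> S" "card Q = 2" using True cp n by (auto simp: Q_def)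
        have "E S \<subseteq> S - Q"
        proof
          fix i assume i: "i \<in> E S"
          show "i \<in> S - Q"
          proof (cases "0 \<in> S")
            case True
            then have "n - 2 \<notin> S" using cp(3) by blast
            then have "i \<noteq> 1" using i a1 by (auto simp: E_def)
            then show ?thesis using i True by (auto simp: E_def Q_def)
          next
            case False
            then have "i \<noteq> n - 3" using i a(3) by (auto simp: E_def)
            then show ?thesis using i False n by (auto simp: E_def Q_def)
          qed
        qed
        then have "card (E S) \<le> card (S - Q)" by (intro card_mono) (use fin[OF Sb] in simp_all)
        also have "\<dots> = card S - 2" using card_Diff_subset[of Q S] Q finite_subset[OF Q(1) fin[OF Sb]] by simp
        finally show ?thesis .
      next
        case F: False
        have "a i \<notin> S" for i using a(1)[of i] F by auto
        then have "E S = {}" by (simp add: E_def)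
        then show ?thesis by simp
      qed
      then show "int (card {i\<in>{1..n - 3}. i \<in> S \<and> a i \<in> S}) \<le> (if 0 \<in> S \<and> n - 2 \<in> S then int n - 3 else 0) + 0 + volume_order n S"
        unfolding volume_order_def if_not_P[OF cp(3)] E_def[symmetric] using S'(2) by simp
    qed
  qed
  then show "converges_on_cell n (tform n 1 a)" by (simp add: converges_on_cell_def)
qed

section \<open>Multizeta values are cell-zeta values\<close>

lemma hcoef_map_labels: "(\<And>c. f c = 0 \<longleftrightarrow> c = 0) \<Longrightarrow> hcoef (\<lambda>_. 1) (map f w) N = hcoef (\<lambda>_. 1) w N"
proof (induction w arbitrary: N)
  case (Cons c w)
  then have "hcoef (\<lambda>_. 1) (map f w) = hcoef (\<lambda>_. 1) w" by (simp add: fun_eq_iff)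
  then show ?case using Cons.prems by simp
qed simp

lemma cell_integral_tform:
  "cell_integral n (tform n 1 a) = complex_of_real (LINT t|PL n 1. indicator (ocell n 1) t * tform n 1 a t)"
proof -
  have L: "Lab n 1 = {..n - 2}" by (auto simp: Lab_def)
  have "cell_integral n (tform n 1 a) = (LINT t|PL n 1. complex_of_real (indicator (ocell n 1) t * tform n 1 a t))"
    unfolding cell_integral_def set_lebesgue_integral_def
  proof (rule Bochner_Integration.integral_cong[OF refl])
    fix t :: "nat \<Rightarrow> real" assume "t \<in> space (PL n 1)"
    then have "t \<in> {1..n - 3} \<rightarrow>\<^sub>E UNIV" by (simp add: space_PiM)
    then have iff: "t \<in> standard_cell n \<longleftrightarrow> t \<in> ocell n 1" unfolding standard_cell_def ocell_def L by simp
    show "indicator (standard_cell n) t *\<^sub>R tform n 1 a (\<lambda>i. complex_of_real (t i)) = complex_of_real (indicator (ocell n 1) t * tform n 1 a t)"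
      unfolding tform_of_real indicator_def iff by simp
  qed
  then show ?thesis unfolding integral_complex_of_real .
qed

lemma zval_cell:
  assumes w: "zword w" "2 \<le> length w"
  shows "zval w \<in> cell_zeta_algebra"
proof -
  define n where "n = length w + 3"
  \<comment> \<open>Words begin with the outermost integration, that of t (n - 3), so coordinate i
    carries the letter at position n - 3 - i. Outside the range of coordinates the value n - 2
    serves as a default that satisfies \<open>warcs\<close>.\<close>
  define a where "a i = (if i \<in> {1..n - 3} \<and> w ! (n - 3 - i) = 0 then 0 else n - 2)" for i
  have n: "5 \<le> n" using w by (simp add: n_def)
  have wn: "w \<noteq> []" "last w \<noteq> 0" "w ! 0 = 0" using w(1) by (auto simp: zword_def ok_word_def hd_conv_nth)
  have a1: "a 1 \<noteq> 0" using wn n by (simp add: a_def n_def last_conv_nth)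
  have al: "a (n - 3) = 0" using wn n by (simp add: a_def)
  have wa: "warcs n a" using n a1 al by (auto simp: warcs_def a_def)
  define f where "f c = (if c = 0 then 0 else n - 2)" for c :: nat
  have "wpre a (n - 2) = map f w"
  proof (rule nth_equalityI)
    show len: "length (wpre a (n - 2)) = length (map f w)" using w(2) by (simp add: wpre_def n_def)
    fix i assume "i < length (wpre a (n - 2))"
    then have i: "i < length w" using len by simp
    have ln: "length w = n - 3" by (simp add: n_def)
    have r: "rev [1..<n - 2] ! i = n - 3 - i" using i n unfolding ln by (simp add: rev_nth)
    have "wpre a (n - 2) ! i = a (n - 3 - i)" unfolding wpre_def using i n ln r by simp
    moreover have "n - 3 - (n - 3 - i) = i" "n - 3 - i \<in> {1..n - 3}" using i ln by auto
    ultimately show "wpre a (n - 2) ! i = map f w ! i" using i unfolding a_def f_def by simp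
  qed
  moreover have "f c = 0 \<longleftrightarrow> c = 0" for c using n by (simp add: f_def)
  ultimately have zv: "zval (wpre a (n - 2)) = zval w" using hcoef_map_labels[of f w] by (simp add: zval_def)
  define I where "I = (LINT t|PL n 1. indicator (ocell n 1) t * tform n 1 a t)"
  have aa: "a i \<in> {0, n - 2}" for i by (simp add: a_def)
  have "\<bar>I\<bar> = \<bar>zval w\<bar>" using word_integral[OF n aa a1 al] zv by (simp add: I_def)
  moreover have "I \<in> cell_zeta_algebra"
    unfolding cell_zeta_algebra_def
  proof (rule rat_real.span_base, intro CollectI exI[of _ n] conjI bexI[of _ "tform n 1 a"])
    show "complex_of_real I = cell_integral n (tform n 1 a)" by (simp only: cell_integral_tform I_def)
  qed (use n warcs_log[OF wa] in simp_all)
  then have "of_rat (-1) * I \<in> cell_zeta_algebra" "of_rat 1 * I \<in> cell_zeta_algebra"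
    unfolding cell_zeta_algebra_def by (rule rat_real.span_scale)+
  ultimately show ?thesis by (auto simp: abs_eq_iff of_rat_minus)
qed

lemma mzv_sub: "mzv_algebra \<subseteq> cell_zeta_algebra"
proof -
  have "mzv ns \<in> cell_zeta_algebra" if ns: "ns \<noteq> []" "\<forall>m\<in>set ns. 1 \<le> m" "2 \<le> last ns" for ns
  proof -
    obtain w where w: "zword w" "zval w = (- 1) ^ length ns * mzv ns" by (rule mzv_is_zval[OF ns])
    have "2 \<le> length w"
    proof -
      obtain v where v: "w = 0 # v" using w(1) by (cases w) (auto simp: zword_def)
      then have "v \<noteq> []" using w(1) by (auto simp: zword_def ok_word_Cons split: if_splits)
      then show ?thesis using v by (cases v) auto
    qed
    then have "of_rat ((- 1) ^ length ns) * zval w \<in> cell_zeta_algebra"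
      using zval_cell[OF w(1)] unfolding cell_zeta_algebra_def by (intro rat_real.span_scale)
    moreover have "of_rat ((- 1) ^ length ns) * zval w = mzv ns"
      unfolding w(2) by (simp add: of_rat_power of_rat_minus mult.assoc[symmetric] power_mult_distrib[symmetric])
    ultimately show ?thesis by simp
  qed
  then have "{mzv ns |ns. ns \<noteq> [] \<and> (\<forall>m\<in>set ns. 1 \<le> m) \<and> 2 \<le> last ns} \<subseteq> cell_zeta_algebra" by blast
  moreover have "rat_real.subspace cell_zeta_algebra" unfolding cell_zeta_algebra_def by (rule rat_real.subspace_span)
  ultimately show ?thesis unfolding mzv_algebra_def by (rule rat_real.span_minimal)
qed

theorem theorem2p25:
  shows "rat_subalgebra cell_zeta_algebra \<and> rat_subalgebra mzv_algebra \<and>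
         cell_zeta_algebra = mzv_algebra \<and>
         (\<exists>\<phi>. rat_algebra_iso \<phi> cell_zeta_algebra mzv_algebra)"
proof -
  have eq: "cell_zeta_algebra = mzv_algebra" using cell_zeta_sub mzv_sub by (rule equalityI)
  have "rat_real.subspace mzv_algebra" unfolding mzv_algebra_def by (rule rat_real.subspace_span)
  then have "rat_subalgebra mzv_algebra" using mzv_algebra_mult by (simp add: rat_subalgebra_def)
  moreover have "rat_algebra_iso id mzv_algebra mzv_algebra" by (simp add: rat_algebra_iso_def)
  ultimately show ?thesis unfolding eq by blast
qed

end
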